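(* Assume that $\nu(\mathbb R_0)=\infty$. Let $x\in\mathbb R$, let $f:\mathbb R\to\mathbb R$ be a function with bounded derivative which is monotone on a neighborhood of the point $x$, and let $h\in L^2(\mathbb R_0,\nu)\cap L^1(\mathbb R_0,\nu)$ with $h(y)\ne0$ for $y\in\mathbb R_0$. Let $Z$ be the solution of $$Z_t=x+\int_0^tf(Z_s)\,ds+\int_{[0,t]\times\mathbb R_0}h(y)\,dN(s,y),\qquad t\in[0,T].$$ Then the random variable $Z_T$ is absolutely continuous (that is, its law is absolutely continuous with respect to Lebesgue measure).
   Context: Fix $T>0$ and $\mathbb R_0=\mathbb R\setminus\{0\}$. $N$ is the jump measure on $(0,\infty)\times\mathbb R_0$ of a real Lévy process $X$ with Lévy measure $\nu$ on a complete probability space $(\Omega,\mathcal F,\mathbb P)$, i.e. $N(B)=\#\{t>0:(t,\Delta X_t)\in B\}$; it is a Poisson random measure with intensity $dt\,\nu(dx)$. The integral with respect to $dN$ is non-compensated.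
   Formalization: "Monotone on a neighborhood of x" is taken as strictly monotone (increasing or decreasing); with weak monotonicity the claim fails, e.g. f = 0, h(y) = y, ν = Σ δ_{1/n!}, where the characteristic function of Z_T does not vanish at infinity. *)

theory Defs
  imports "HOL-Probability.Probability"
begin

text \<open>
  Processes have type \<open>real \<Rightarrow> 'a \<Rightarrow> real\<close>; only their values at times \<open>t \<ge> 0\<close>
  matter. The set of nonzero reals is \<open>- {0}\<close>.
\<close>

definition cadlag :: "(real \<Rightarrow> real) \<Rightarrow> bool" where
  "cadlag g \<longleftrightarrow>
     (\<forall>t\<ge>0. (g \<longlongrightarrow> g t) (at_right t)) \<and> (\<forall>t>0. \<exists>l. (g \<longlongrightarrow> l) (at_left t))"

text \<open>
  Continuity in probability is not listed: it follows from right-continuity at \<open>0\<close>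
  and stationarity of the increments.
\<close>

locale levy_process = prob_space M for M :: "'a measure" +
  fixes X :: "real \<Rightarrow> 'a \<Rightarrow> real"
  assumes random_variable: "\<And>t. 0 \<le> t \<Longrightarrow> X t \<in> borel_measurable M"
    and start_zero: "AE \<omega> in M. X 0 \<omega> = 0"
    and independent_increments:
      "\<And>(n::nat) (\<tau>::nat \<Rightarrow> real). 0 \<le> \<tau> 0 \<Longrightarrow> mono_on {..n} \<tau> \<Longrightarrow>
         indep_vars (\<lambda>_. borel) (\<lambda>i \<omega>. X (\<tau> (Suc i)) \<omega> - X (\<tau> i) \<omega>) {..<n}"
    and stationary_increments:
      "\<And>s t. 0 \<le> s \<Longrightarrow> 0 \<le> t \<Longrightarrow>
         distr M borel (\<lambda>\<omega>. X (s + t) \<omega> - X s \<omega>) = distr M borel (X t)"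
    and cadlag_paths: "AE \<omega> in M. cadlag (\<lambda>t. X t \<omega>)"

text \<open>
  \<open>Lim\<close> is a choice of limit, so the jump is meaningful only where the left limit
  exists; for a Levy process this is so at every \<open>t > 0\<close> outside a null set of \<open>\<omega>\<close>.
\<close>

definition jump :: "(real \<Rightarrow> 'a \<Rightarrow> real) \<Rightarrow> real \<Rightarrow> 'a \<Rightarrow> real" where
  "jump X t \<omega> = X t \<omega> - Lim (at_left t) (\<lambda>s. X s \<omega>)"

text \<open>
  For each \<open>\<omega>\<close>, the counting measure of the points \<open>(t, jump X t \<omega>)\<close>, as a Borel measure
  on \<open>{0<..} \<times> (- {0})\<close>; see \<open>emeasure_jump_measure\<close> for its values.
\<close>

definition jump_measure :: "(real \<Rightarrow> 'a \<Rightarrow> real) \<Rightarrow> 'a \<Rightarrow> (real \<times> real) measure" where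
  "jump_measure X \<omega> =
     distr (count_space {t. 0 < t \<and> jump X t \<omega> \<noteq> 0})
       (restrict_space borel ({0<..} \<times> (- {0}))) (\<lambda>t. (t, jump X t \<omega>))"

lemma emeasure_jump_measure:
  assumes B: "B \<in> sets (restrict_space borel ({0<..} \<times> (- {0})))"
  shows "emeasure (jump_measure X \<omega>) B =
    emeasure (count_space UNIV) {t. 0 < t \<and> (t, jump X t \<omega>) \<in> B}"
proof -
  let ?J = "{t. 0 < t \<and> jump X t \<omega> \<noteq> 0}"
  have sub: "B \<subseteq> {0<..} \<times> (- {0})"
    using sets.sets_into_space[OF B] by (simp add: space_restrict_space)
  have "emeasure (jump_measure X \<omega>) B =
      emeasure (count_space ?J) ((\<lambda>t. (t, jump X t \<omega>)) -` B \<inter> ?J)"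
    unfolding jump_measure_def using B
    by (subst emeasure_distr) (auto simp: space_restrict_space)
  also have "(\<lambda>t. (t, jump X t \<omega>)) -` B \<inter> ?J = {t. 0 < t \<and> (t, jump X t \<omega>) \<in> B}"
    using sub by auto
  also have "emeasure (count_space ?J) {t. 0 < t \<and> (t, jump X t \<omega>) \<in> B} =
      emeasure (count_space UNIV) {t. 0 < t \<and> (t, jump X t \<omega>) \<in> B}"
  proof -
    have "{t. 0 < t \<and> (t, jump X t \<omega>) \<in> B} \<subseteq> ?J" using sub by auto
    then show ?thesis by (simp only: emeasure_count_space subset_UNIV)
  qed
  finally show ?thesis .
qed

text \<open>
  The Levy measure of \<open>X\<close>: \<open>\<nu> B\<close> is the expected number of jumps with size in \<open>B\<close> per
  unit of time, so that \<open>dt \<nu>(dx)\<close> is the intensity of the jump measure. It is a Borel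
  measure on the nonzero reals, with \<open>space \<nu> = - {0}\<close>.
\<close>

definition is_levy_measure ::
  "'a measure \<Rightarrow> (real \<Rightarrow> 'a \<Rightarrow> real) \<Rightarrow> real measure \<Rightarrow> bool" where
  "is_levy_measure M X \<nu> \<longleftrightarrow>
     sets \<nu> = sets (restrict_space borel (- {0})) \<and>
     (\<forall>B\<in>sets \<nu>. emeasure \<nu> B = (\<integral>\<^sup>+\<omega>. emeasure (jump_measure X \<omega>) ({0<..1} \<times> B) \<partial>M))"

text \<open>
  The integral with respect to the jump measure is the pathwise, non-compensated
  Lebesgue integral. The library integrals return \<open>0\<close> for non-integrable functions,
  hence the explicit integrability conditions.
\<close>

definition solves_sde ::
  "'a measure \<Rightarrow> (real \<Rightarrow> 'a \<Rightarrow> real) \<Rightarrow> (real \<Rightarrow> real) \<Rightarrow> (real \<Rightarrow> real) \<Rightarrow> real \<Rightarrow> real \<Rightarrow>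
   (real \<Rightarrow> 'a \<Rightarrow> real) \<Rightarrow> bool" where
  "solves_sde M X f h x T Z \<longleftrightarrow>
     (\<forall>t\<in>{0..T}. Z t \<in> borel_measurable M) \<and>
     (AE \<omega> in M. \<forall>t\<in>{0..T}.
        set_integrable lborel {0..t} (\<lambda>s. f (Z s \<omega>)) \<and>
        set_integrable (jump_measure X \<omega>) ({0..t} \<times> (- {0})) (\<lambda>(s, y). h y) \<and>
        Z t \<omega> = x + (LINT s:{0..t}|lborel. f (Z s \<omega>))
                  + (LINT (s, y):{0..t} \<times> (- {0})|jump_measure X \<omega>. h y))"

end

theory Submission
  imports Defs
begin

text \<open>
  Only finitely many jumps of size \<open>\<bar>h\<bar> > c\<close> occur, while \<open>\<nu>\<close> being infinite forces jumps arbitrarily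
  close to time 0. So almost surely some short interval \<open>(p, q]\<close> near 0 contains exactly one jump with
  \<open>\<bar>h\<bar> > c\<close>, and up to time \<open>q\<close> the solution stays where \<open>f\<close> is strictly monotone. Given all the other
  jumps, the time \<open>u\<close> of this jump is uniform in \<open>(p, q]\<close>. While the jump is delayed,
  the drift is \<open>f\<close> at the lower or upper of two points a definite distance apart, depending on whether the
  jump has occurred, so strict monotonicity makes \<open>Z T\<close> move at
  speed at least some constant as a function of \<open>u\<close>. Hence \<open>Z T\<close> has a bounded density on this event, and countably
  many such events cover almost every \<open>\<omega>\<close>.

  To avoid the Levy-Ito decomposition, uniformity of \<open>u\<close> is replaced by exchangeability: \<open>[0, T]\<close> is cut
  into equal cells, on which the path segments are i.i.d., \<open>Z\<close> is replaced by its Euler scheme on that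
  grid, and the cell with the big jump is swapped with another one in \<open>(p, q]\<close>. The small jumps that are
  misplaced by the swap are negligible for most cells.
\<close>

section \<open>Euler schemes with one displaced jump\<close>

text \<open>The estimate rests on the order of two limits. Let the interval with the big jump
  consist of \<open>K\<close> cells of length \<open>l\<close>, with \<open>K * l\<close> fixed.
  Moving the jump by one cell moves the endpoint by at least a constant times
  \<open>l * \<kappa>\<close>, so an interval of length \<open>\<beta> - \<alpha>\<close> is hit
  from about \<open>(\<beta> - \<alpha>) / (l * \<kappa>)\<close> positions at most, a multiple of
  \<open>K * (\<beta> - \<alpha>)\<close> out of \<open>K\<close>. A swap, however, also carries the
  increment of the other cell to a wrong place. Given a tolerance \<open>\<epsilon>\<close>, at most
  \<open>\<delta> / 2 / \<epsilon>\<close> cells have variation above \<open>\<epsilon>\<close>,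
  because the total variation of the noise is at most \<open>\<delta> / 2\<close>; this number does
  not depend on \<open>K\<close>. The remaining swaps cost only a multiple of
  \<open>\<epsilon>\<close>. Hence \<open>K\<close> tends to infinity first and
  \<open>\<epsilon>\<close> to 0 afterwards. The exponential factors are Gronwall constants. The
  upper one, \<open>exp (T * L)\<close>, controls the misplaced increments. The lower one,
  \<open>exp (- 2 * T * L)\<close>, lets the separation gained near time 0 survive until
  \<open>T\<close>, although away from \<open>x\<close> the drift is only known to be
  Lipschitz.\<close>

primrec euler :: "(real \<Rightarrow> real) \<Rightarrow> real \<Rightarrow> real \<Rightarrow> (nat \<Rightarrow> real) \<Rightarrow> nat \<Rightarrow> real" where
  "euler f \<eta> x b 0 = x"
| "euler f \<eta> x b (Suc k) = euler f \<eta> x b k + \<eta> * f (euler f \<eta> x b k) + b k"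

lemma euler_cong:
  assumes "\<And>k. k < n \<Longrightarrow> b k = b' k"
  shows "euler f \<eta> x b n = euler f \<eta> x b' n"
  using assms by (induction n) auto

text \<open>Discrete Gronwall inequality. Every noise difference is charged with the full factor
  \<open>(1 + \<eta> * L) ^ n\<close>, whatever the step at which it occurs.\<close>

lemma euler_upper_stability:
  fixes f :: "real \<Rightarrow> real"
  assumes lip: "\<And>u v. \<bar>f u - f v\<bar> \<le> L * \<bar>u - v\<bar>" and "0 \<le> \<eta>"
  shows "\<bar>euler f \<eta> x b n - euler f \<eta> x b' n\<bar> \<le> (1 + \<eta> * L) ^ n * (\<Sum>k<n. \<bar>b k - b' k\<bar>)"
proof (induction n)
  case (Suc n)
  let ?u = "euler f \<eta> x b n" and ?v = "euler f \<eta> x b' n"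
  have L: "0 \<le> L" using lip[of 1 0] by simp
  have "\<bar>\<eta> * (f ?u - f ?v)\<bar> \<le> \<eta> * (L * \<bar>?u - ?v\<bar>)"
    using lip[of ?u ?v] \<open>0 \<le> \<eta>\<close> by (simp add: abs_mult mult_left_mono)
  then have "\<bar>euler f \<eta> x b (Suc n) - euler f \<eta> x b' (Suc n)\<bar>
      \<le> (1 + \<eta> * L) * \<bar>?u - ?v\<bar> + \<bar>b n - b' n\<bar>"
    by (simp add: algebra_simps)
  also have "\<dots> \<le> (1 + \<eta> * L) * ((1 + \<eta> * L) ^ n * (\<Sum>k<n. \<bar>b k - b' k\<bar>))
      + (1 + \<eta> * L) ^ Suc n * \<bar>b n - b' n\<bar>"
  proof (intro add_mono mult_left_mono Suc)
    have "1 * \<bar>b n - b' n\<bar> \<le> (1 + \<eta> * L) ^ Suc n * \<bar>b n - b' n\<bar>"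
      using L \<open>0 \<le> \<eta>\<close> by (intro mult_right_mono one_le_power) auto
    then show "\<bar>b n - b' n\<bar> \<le> (1 + \<eta> * L) ^ Suc n * \<bar>b n - b' n\<bar>" by simp
  qed (use L \<open>0 \<le> \<eta>\<close> in simp)
  finally show ?case by (simp add: algebra_simps)
qed simp

text \<open>Equal noise cancels, and by \<open>\<eta> * L \<le> 1\<close> one step of the drift
  shrinks a distance at most by the factor \<open>1 - \<eta> * L\<close>. If that factor is
  positive, separated schemes never merge again.\<close>

lemma euler_lower_stability:
  fixes f :: "real \<Rightarrow> real"
  assumes lip: "\<And>u v. \<bar>f u - f v\<bar> \<le> L * \<bar>u - v\<bar>" and "0 \<le> \<eta>" "\<eta> * L \<le> 1"
    and "m \<le> n" and eq: "\<And>k. m \<le> k \<Longrightarrow> k < n \<Longrightarrow> b k = b' k"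
  shows "(1 - \<eta> * L) ^ (n - m) * \<bar>euler f \<eta> x b m - euler f \<eta> x b' m\<bar>
    \<le> \<bar>euler f \<eta> x b n - euler f \<eta> x b' n\<bar>"
  using \<open>m \<le> n\<close> eq
proof (induction n rule: dec_induct)
  case (step n)
  let ?u = "euler f \<eta> x b n" and ?v = "euler f \<eta> x b' n"
  have "\<bar>\<eta> * (f ?u - f ?v)\<bar> \<le> \<eta> * (L * \<bar>?u - ?v\<bar>)"
    using lip[of ?u ?v] \<open>0 \<le> \<eta>\<close> by (simp add: abs_mult mult_left_mono)
  moreover have "euler f \<eta> x b (Suc n) - euler f \<eta> x b' (Suc n) = (?u - ?v) + \<eta> * (f ?u - f ?v)"
    using step by (simp add: algebra_simps)
  ultimately have *: "(1 - \<eta> * L) * \<bar>?u - ?v\<bar> \<le> \<bar>euler f \<eta> x b (Suc n) - euler f \<eta> x b' (Suc n)\<bar>"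
    by (simp add: algebra_simps abs_if split: if_splits)
  have "(1 - \<eta> * L) ^ (Suc n - m) * \<bar>euler f \<eta> x b m - euler f \<eta> x b' m\<bar>
      = (1 - \<eta> * L) * ((1 - \<eta> * L) ^ (n - m) * \<bar>euler f \<eta> x b m - euler f \<eta> x b' m\<bar>)"
    using step by (simp add: Suc_diff_le)
  also have "\<dots> \<le> (1 - \<eta> * L) * \<bar>?u - ?v\<bar>"
    using step \<open>\<eta> * L \<le> 1\<close> by (intro mult_left_mono) auto
  finally show ?case using * by linarith
qed simp

text \<open>Bootstrap: while the scheme stays within \<open>\<delta>\<close> of \<open>x\<close>,
  the drift is at most \<open>\<bar>f x\<bar> + L * \<delta>\<close>, and then drift and noise each
  use up at most half of the allowance \<open>\<delta>\<close>.\<close>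

lemma euler_near_start:
  fixes f :: "real \<Rightarrow> real"
  assumes lip: "\<And>u v. \<bar>f u - f v\<bar> \<le> L * \<bar>u - v\<bar>" and "0 \<le> \<eta>"
    and drift: "real n * \<eta> * (\<bar>f x\<bar> + L * \<delta>) \<le> \<delta> / 2" and noise: "(\<Sum>k<n. \<bar>b k\<bar>) \<le> \<delta> / 2"
    and "k \<le> n"
  shows "\<bar>euler f \<eta> x b k - x\<bar> \<le> \<delta>"
proof -
  have L: "0 \<le> L" using lip[of 1 0] by simp
  have "0 \<le> (\<Sum>k<n. \<bar>b k\<bar>)" by (simp add: sum_nonneg)
  with noise have d: "0 \<le> \<delta>" by linarith
  let ?C = "\<bar>f x\<bar> + L * \<delta>"
  have C: "0 \<le> ?C" using L d by simp
  have bound: "real k * \<eta> * ?C + (\<Sum>i<k. \<bar>b i\<bar>) \<le> \<delta>" if "k \<le> n" for k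
  proof -
    have "real k * \<eta> * ?C \<le> real n * \<eta> * ?C"
      using that C \<open>0 \<le> \<eta>\<close> by (intro mult_right_mono) auto
    moreover have "(\<Sum>i<k. \<bar>b i\<bar>) \<le> (\<Sum>i<n. \<bar>b i\<bar>)"
      using that by (intro sum_mono2) auto
    ultimately show ?thesis using drift noise by linarith
  qed
  have "\<bar>euler f \<eta> x b k - x\<bar> \<le> real k * \<eta> * ?C + (\<Sum>i<k. \<bar>b i\<bar>)" using \<open>k \<le> n\<close>
  proof (induction k)
    case (Suc k)
    let ?u = "euler f \<eta> x b k"
    have "\<bar>?u - x\<bar> \<le> \<delta>" using Suc bound[of k] by simp
    then have "L * \<bar>?u - x\<bar> \<le> L * \<delta>" by (intro mult_left_mono L)
    then have "\<bar>f ?u\<bar> \<le> ?C" using lip[of ?u x] by linarith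
    then have "\<bar>\<eta> * f ?u\<bar> \<le> \<eta> * ?C" using \<open>0 \<le> \<eta>\<close> by (simp add: abs_mult mult_left_mono)
    moreover have "real (Suc k) * \<eta> * ?C = real k * \<eta> * ?C + \<eta> * ?C" by (simp add: algebra_simps)
    moreover have "\<bar>?u - x\<bar> \<le> real k * \<eta> * ?C + (\<Sum>i<k. \<bar>b i\<bar>)" using Suc by simp
    moreover have "\<bar>euler f \<eta> x b (Suc k) - x\<bar> \<le> \<bar>?u - x\<bar> + \<bar>\<eta> * f ?u\<bar> + \<bar>b k\<bar>" by simp
    moreover have "(\<Sum>i<Suc k. \<bar>b i\<bar>) = (\<Sum>i<k. \<bar>b i\<bar>) + \<bar>b k\<bar>" by simp
    ultimately show ?case by linarith
  qed simp
  with bound[OF \<open>k \<le> n\<close>] show ?thesis by linarith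
qed

text \<open>A quantitative strict monotonicity, increasing or decreasing. Only points at distance at
  least \<open>d\<close> are compared: the derivative of a strictly monotone function may vanish, so
  no bound proportional to \<open>u - v\<close> is available. Strictness is what makes a displaced
  jump visible; for constant \<open>f\<close> its time has no influence on the endpoint.\<close>

definition monotone_gap :: "(real \<Rightarrow> real) \<Rightarrow> real set \<Rightarrow> real \<Rightarrow> real \<Rightarrow> bool" where
  "monotone_gap f S d \<kappa> \<longleftrightarrow> (\<forall>u\<in>S. \<forall>v\<in>S. d \<le> u - v \<longrightarrow> \<kappa> \<le> f u - f v) \<or>
     (\<forall>u\<in>S. \<forall>v\<in>S. d \<le> u - v \<longrightarrow> \<kappa> \<le> f v - f u)"

text \<open>The pairs at distance at least \<open>d\<close> form a compact set, on which the
  continuous positive difference attains its minimum; a decreasing \<open>f\<close> is treated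
  through \<open>- f\<close>.\<close>

lemma strict_mono_gap:
  fixes f :: "real \<Rightarrow> real"
  assumes cont: "continuous_on {a..b} f"
    and mono: "strict_mono_on {a..b} f \<or> strict_antimono_on {a..b} f" and "0 < d"
  obtains \<kappa> where "0 < \<kappa>" "monotone_gap f {a..b} d \<kappa>"
proof -
  let ?K = "{p \<in> {a..b} \<times> {a..b}. d \<le> fst p - snd p}"
  have cK: "compact ?K"
  proof -
    have "compact (({a..b} \<times> {a..b}) \<inter> {p. d \<le> fst p - snd p})"
      by (intro compact_Int_closed compact_Times compact_Icc closed_Collect_le continuous_intros)
    moreover have "?K = ({a..b} \<times> {a..b}) \<inter> {p. d \<le> fst p - snd p}" by auto
    ultimately show ?thesis by simp
  qed
  have *: "\<exists>\<kappa>>0. \<forall>u\<in>{a..b}. \<forall>v\<in>{a..b}. d \<le> u - v \<longrightarrow> \<kappa> \<le> g u - g v"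
    if cont: "continuous_on {a..b} g" and g: "\<And>u v. u \<in> {a..b} \<Longrightarrow> v \<in> {a..b} \<Longrightarrow> v < u \<Longrightarrow> g v < g u"
    for g :: "real \<Rightarrow> real"
  proof (cases "?K = {}")
    case True
    then have "\<forall>u\<in>{a..b}. \<forall>v\<in>{a..b}. d \<le> u - v \<longrightarrow> 1 \<le> g u - g v" by force
    then show ?thesis by (intro exI[of _ 1]) simp
  next
    case False
    have "continuous_on ?K (\<lambda>p. g (fst p) - g (snd p))"
      by (intro continuous_on_diff continuous_on_compose2[OF cont] continuous_intros) auto
    from continuous_attains_inf[OF cK False this] obtain p where p: "p \<in> ?K"
      "\<And>q. q \<in> ?K \<Longrightarrow> g (fst p) - g (snd p) \<le> g (fst q) - g (snd q)" by blast
    have "0 < g (fst p) - g (snd p)" using p(1) g[of "fst p" "snd p"] \<open>0 < d\<close> by auto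
    moreover have "g (fst p) - g (snd p) \<le> g u - g v" if "u\<in>{a..b}" "v\<in>{a..b}" "d \<le> u - v" for u v
      using p(2)[of "(u,v)"] that by auto
    ultimately show ?thesis by blast
  qed
  from mono show ?thesis
  proof
    assume "strict_mono_on {a..b} f"
    then have "v < u \<Longrightarrow> f v < f u" if "u \<in> {a..b}" "v \<in> {a..b}" for u v
      using that by (auto simp: strict_mono_on_def)
    with *[OF cont] that show ?thesis unfolding monotone_gap_def by blast
  next
    assume "strict_antimono_on {a..b} f"
    then have "v < u \<Longrightarrow> - f v < - f u" if "u \<in> {a..b}" "v \<in> {a..b}" for u v
      using that by (auto simp: monotone_on_def)
    with *[of "\<lambda>u. - f u"] cont obtain \<kappa> where "0 < \<kappa>"
      "\<forall>u\<in>{a..b}. \<forall>v\<in>{a..b}. d \<le> u - v \<longrightarrow> \<kappa> \<le> - f u - - f v"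
      by (auto intro: continuous_intros)
    then show ?thesis by (intro that[of \<kappa>]) (auto simp: monotone_gap_def)
  qed
qed

text \<open>Here \<open>u\<close> leads \<open>v\<close>. As long as the lead is at least
  \<open>d\<close>, every step changes it by at least \<open>\<eta> * \<kappa>\<close>, always in
  the same direction. For decreasing \<open>f\<close> the lead shrinks; this is why it starts at
  \<open>2 * d\<close> and why \<open>short\<close> limits the duration, so that by Bernoulli's
  inequality at least half of it remains.\<close>

lemma gap_drift:
  fixes f :: "real \<Rightarrow> real" and u v :: "nat \<Rightarrow> real"
  assumes lip: "\<And>u v. \<bar>f u - f v\<bar> \<le> L * \<bar>u - v\<bar>" and "0 \<le> \<eta>" "0 \<le> \<kappa>" "\<eta> * L \<le> 1"
    and gap: "monotone_gap f S d \<kappa>"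
    and uS: "\<And>k. k < n \<Longrightarrow> u k \<in> S" and vS: "\<And>k. k < n \<Longrightarrow> v k \<in> S"
    and step: "\<And>k. k < n \<Longrightarrow> u (Suc k) - v (Suc k) = u k - v k + \<eta> * (f (u k) - f (v k))"
    and start: "2 * d \<le> u 0 - v 0" and "0 \<le> d" and short: "real n * (\<eta> * L) \<le> 1 / 2"
  shows "real n * (\<eta> * \<kappa>) \<le> \<bar>(u n - v n) - (u 0 - v 0)\<bar>"
proof -
  let ?D = "\<lambda>k. u k - v k"
  have L: "0 \<le> L" using lip[of 1 0] by simp
  have low: "(1 - \<eta> * L) ^ k * ?D 0 \<le> ?D k" if "k \<le> n" for k using that
  proof (induction k)
    case (Suc k)
    have "0 \<le> (1 - \<eta> * L) ^ k * ?D 0"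
      using start \<open>0 \<le> d\<close> \<open>\<eta> * L \<le> 1\<close> by (intro mult_nonneg_nonneg) auto
    with Suc have D: "0 \<le> ?D k" by simp
    have "\<eta> * (f (v k) - f (u k)) \<le> \<eta> * (L * ?D k)"
      using lip[of "u k" "v k"] D \<open>0 \<le> \<eta>\<close> by (intro mult_left_mono) auto
    then have "(1 - \<eta> * L) * ?D k \<le> ?D (Suc k)" using step[of k] Suc by (simp add: algebra_simps)
    moreover have "(1 - \<eta> * L) * ((1 - \<eta> * L) ^ k * ?D 0) \<le> (1 - \<eta> * L) * ?D k"
      using Suc \<open>\<eta> * L \<le> 1\<close> by (intro mult_left_mono) auto
    ultimately show ?case by simp
  qed simp
  have dD: "d \<le> ?D k" if "k < n" for k
  proof -
    have "1 + real k * (- (\<eta> * L)) \<le> (1 + - (\<eta> * L)) ^ k"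
      using \<open>\<eta> * L \<le> 1\<close> by (intro Bernoulli_inequality) simp
    moreover have "real k * (\<eta> * L) \<le> real n * (\<eta> * L)"
      using that L \<open>0 \<le> \<eta>\<close> by (intro mult_right_mono) auto
    ultimately have "1 / 2 \<le> (1 - \<eta> * L) ^ k" using short by simp
    then have "1 / 2 * ?D 0 \<le> (1 - \<eta> * L) ^ k * ?D 0"
      using start \<open>0 \<le> d\<close> by (intro mult_right_mono) auto
    then show ?thesis using low[of k] that start by simp
  qed
  from gap[unfolded monotone_gap_def] show ?thesis
  proof
    assume g: "\<forall>u\<in>S. \<forall>v\<in>S. d \<le> u - v \<longrightarrow> \<kappa> \<le> f u - f v"
    have "real k * (\<eta> * \<kappa>) \<le> ?D k - ?D 0" if "k \<le> n" for k using that
    proof (induction k)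
      case (Suc k)
      have "\<kappa> \<le> f (u k) - f (v k)" using g uS[of k] vS[of k] dD[of k] Suc by simp
      then have "\<eta> * \<kappa> \<le> \<eta> * (f (u k) - f (v k))" by (intro mult_left_mono \<open>0 \<le> \<eta>\<close>)
      then show ?case using Suc step[of k] by (simp add: algebra_simps)
    qed simp
    from this[of n] show ?thesis by simp
  next
    assume g: "\<forall>u\<in>S. \<forall>v\<in>S. d \<le> u - v \<longrightarrow> \<kappa> \<le> f v - f u"
    have "real k * (\<eta> * \<kappa>) \<le> ?D 0 - ?D k" if "k \<le> n" for k using that
    proof (induction k)
      case (Suc k)
      have "\<kappa> \<le> f (v k) - f (u k)" using g uS[of k] vS[of k] dD[of k] Suc by simp
      then have "\<eta> * \<kappa> \<le> \<eta> * (f (v k) - f (u k))" by (intro mult_left_mono \<open>0 \<le> \<eta>\<close>)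
      then show ?case using Suc step[of k] by (simp add: algebra_simps)
    qed simp
    from this[of n] show ?thesis by simp
  qed
qed

text \<open>Follows from \<open>1 \<le> (1 + 2 * y) * (1 - y)\<close>, valid for \<open>y\<close>
  between 0 and \<open>1 / 2\<close>. The factor 2 here is the origin of the one in the lower
  constants \<open>exp (- 2 * T * L)\<close>.\<close>

lemma exp_le_power_one_minus:
  fixes y :: real
  assumes "0 \<le> y" "y \<le> 1 / 2"
  shows "exp (- 2 * real n * y) \<le> (1 - y) ^ n"
proof -
  have "1 \<le> (1 + 2 * y) * (1 - y)" using assms mult_left_mono[of y "1/2" y] by (simp add: algebra_simps)
  also have "\<dots> \<le> exp (2 * y) * (1 - y)"
    using assms exp_ge_add_one_self[of "2 * y"] by (intro mult_right_mono) auto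
  finally have "exp (- 2 * y) \<le> 1 - y" by (simp add: exp_minus field_simps)
  then have "exp (- 2 * y) ^ n \<le> (1 - y) ^ n" by (intro power_mono) auto
  then show ?thesis by (simp add: exp_of_nat_mult[symmetric] algebra_simps)
qed

text \<open>The scheme \<open>z\<close> receives the jump \<open>H\<close> at step \<open>j\<close>,
  the scheme \<open>y\<close> never does. Right after step \<open>j'\<close> the scheme with the
  late jump equals \<open>y + H\<close>, so its distance to \<open>z\<close> is the change of the
  lead \<open>z - y\<close> since its initial value \<open>H\<close>. That change is what
  \<open>gap_drift\<close> bounds from below; \<open>euler_lower_stability\<close> then carries it
  to \<open>M\<close>.\<close>

lemma euler_separation:
  fixes f :: "real \<Rightarrow> real" and a :: "nat \<Rightarrow> real"
  assumes lip: "\<And>u v. \<bar>f u - f v\<bar> \<le> L * \<bar>u - v\<bar>" and "0 \<le> \<eta>" "0 \<le> \<kappa>" "\<eta> * L \<le> 1 / 2"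
    and gap: "monotone_gap f {x-\<delta>..x+\<delta>} d \<kappa>"
    and drift: "real n * \<eta> * (\<bar>f x\<bar> + L * \<delta>) \<le> \<delta> / 2"
    and noise: "(\<Sum>k<n. \<bar>a k\<bar>) + \<bar>H\<bar> \<le> \<delta> / 2"
    and H: "2 * d \<le> \<bar>H\<bar>" "0 \<le> d" and short: "real n * (\<eta> * L) \<le> 1 / 2"
    and jj: "j < j'" "j' < n" "n \<le> M"
  shows "exp (- 2 * (real M * \<eta>) * L) * (\<eta> * \<kappa>) * real (j' - j) \<le>
    \<bar>euler f \<eta> x (a(j' := a j' + H)) M - euler f \<eta> x (a(j := a j + H)) M\<bar>"
proof -
  let ?b = "a(j := a j + H)" and ?b' = "a(j' := a j' + H)"
  have L: "0 \<le> L" using lip[of 1 0] by simp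
  define z where "z = euler f \<eta> x ?b"
  define y where "y = euler f \<eta> x a"
  have z1: "z (Suc j) = y (Suc j) + H"
    using euler_cong[of j a ?b f \<eta> x] by (simp add: z_def y_def)
  have y2: "euler f \<eta> x ?b' (Suc j') = y (Suc j') + H"
    using euler_cong[of j' a ?b' f \<eta> x] by (simp add: y_def)
  have aH: "(\<Sum>k<n. \<bar>?b k\<bar>) \<le> (\<Sum>k<n. \<bar>a k\<bar>) + \<bar>H\<bar>"
  proof -
    have "(\<Sum>k<n. \<bar>?b k\<bar>) \<le> (\<Sum>k<n. \<bar>a k\<bar> + (if k = j then \<bar>H\<bar> else 0))"
      by (intro sum_mono) auto
    also have "\<dots> = (\<Sum>k<n. \<bar>a k\<bar>) + \<bar>H\<bar>" using jj by (simp add: sum.distrib)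
    finally show ?thesis .
  qed
  have zS: "z k \<in> {x-\<delta>..x+\<delta>}" if "k \<le> n" for k
    using euler_near_start[OF lip \<open>0 \<le> \<eta>\<close> drift _ that, of ?b] aH noise
    unfolding z_def by (auto simp: abs_le_iff)
  have "(\<Sum>k<n. \<bar>a k\<bar>) \<le> \<delta> / 2" using noise by (smt (verit))
  from euler_near_start[OF lip \<open>0 \<le> \<eta>\<close> drift this]
  have yS: "y k \<in> {x-\<delta>..x+\<delta>}" if "k \<le> n" for k
    using that unfolding y_def by (smt (verit) atLeastAtMost_iff)
  have zstep: "z (Suc k) = z k + \<eta> * f (z k) + a k" if "j < k" for k
    using that by (simp add: z_def)
  have ystep: "y (Suc k) = y k + \<eta> * f (y k) + a k" for k by (simp add: y_def)
  let ?s = "\<lambda>k. Suc j + k"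
  have l1: "\<eta> * L \<le> 1" using \<open>\<eta> * L \<le> 1 / 2\<close> by linarith
  have short': "real (j' - j) * (\<eta> * L) \<le> 1 / 2"
  proof -
    have "real (j' - j) * (\<eta> * L) \<le> real n * (\<eta> * L)"
      using jj L \<open>0 \<le> \<eta>\<close> by (intro mult_right_mono) auto
    with short show ?thesis by linarith
  qed
  have "real (j' - j) * (\<eta> * \<kappa>) \<le> \<bar>(z (Suc j') - y (Suc j')) - H\<bar>"
  \<comment> \<open>\<open>gap_drift\<close> expects the leading scheme first: \<open>z\<close>
    after an upward jump, \<open>y\<close> after a downward one.\<close>
  proof (cases "0 \<le> H")
    case True
    have "real (j' - j) * (\<eta> * \<kappa>) \<le> \<bar>(z (?s (j' - j)) - y (?s (j' - j))) - (z (?s 0) - y (?s 0))\<bar>"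
    proof (rule gap_drift[OF lip \<open>0 \<le> \<eta>\<close> \<open>0 \<le> \<kappa>\<close> l1 gap _ _ _ _ \<open>0 \<le> d\<close> short',
        where u = "\<lambda>k. z (?s k)" and v = "\<lambda>k. y (?s k)"])
      show "2 * d \<le> z (?s 0) - y (?s 0)" using z1 H True by simp
      fix k assume k: "k < j' - j"
      show "z (?s k) \<in> {x-\<delta>..x+\<delta>}" "y (?s k) \<in> {x-\<delta>..x+\<delta>}"
        using zS[of "?s k"] yS[of "?s k"] k jj by auto
      show "z (?s (Suc k)) - y (?s (Suc k)) = z (?s k) - y (?s k) + \<eta> * (f (z (?s k)) - f (y (?s k)))"
        using zstep[of "?s k"] ystep[of "?s k"] by (simp add: algebra_simps)
    qed
    then show ?thesis using z1 jj by simp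
  next
    case False
    have "real (j' - j) * (\<eta> * \<kappa>) \<le> \<bar>(y (?s (j' - j)) - z (?s (j' - j))) - (y (?s 0) - z (?s 0))\<bar>"
    proof (rule gap_drift[OF lip \<open>0 \<le> \<eta>\<close> \<open>0 \<le> \<kappa>\<close> l1 gap _ _ _ _ \<open>0 \<le> d\<close> short',
        where u = "\<lambda>k. y (?s k)" and v = "\<lambda>k. z (?s k)"])
      show "2 * d \<le> y (?s 0) - z (?s 0)" using z1 H False by simp
      fix k assume k: "k < j' - j"
      show "z (?s k) \<in> {x-\<delta>..x+\<delta>}" "y (?s k) \<in> {x-\<delta>..x+\<delta>}"
        using zS[of "?s k"] yS[of "?s k"] k jj by auto
      show "y (?s (Suc k)) - z (?s (Suc k)) = y (?s k) - z (?s k) + \<eta> * (f (y (?s k)) - f (z (?s k)))"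
        using zstep[of "?s k"] ystep[of "?s k"] by (simp add: algebra_simps)
    qed
    then show ?thesis using z1 jj by (simp add: abs_minus_commute algebra_simps)
  qed
  then have sep: "real (j' - j) * (\<eta> * \<kappa>) \<le> \<bar>euler f \<eta> x ?b' (Suc j') - euler f \<eta> x ?b (Suc j')\<bar>"
    unfolding y2 z_def[symmetric] by (simp add: abs_minus_commute algebra_simps)
  have "exp (- 2 * real M * (\<eta> * L)) \<le> (1 - \<eta> * L) ^ M"
    using L \<open>0 \<le> \<eta>\<close> \<open>\<eta> * L \<le> 1 / 2\<close> by (intro exp_le_power_one_minus) auto
  also have "\<dots> \<le> (1 - \<eta> * L) ^ (M - Suc j')"
    using L \<open>0 \<le> \<eta>\<close> l1 by (intro power_decreasing) auto
  finally have e: "exp (- 2 * (real M * \<eta>) * L) \<le> (1 - \<eta> * L) ^ (M - Suc j')"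
    by (simp add: algebra_simps)
  have "exp (- 2 * (real M * \<eta>) * L) * (real (j' - j) * (\<eta> * \<kappa>)) \<le>
      (1 - \<eta> * L) ^ (M - Suc j') * \<bar>euler f \<eta> x ?b' (Suc j') - euler f \<eta> x ?b (Suc j')\<bar>"
    using sep \<open>0 \<le> \<eta>\<close> \<open>0 \<le> \<kappa>\<close> l1 by (intro mult_mono[OF e]) auto
  also have "\<dots> \<le> \<bar>euler f \<eta> x ?b' M - euler f \<eta> x ?b M\<bar>"
    using jj by (intro euler_lower_stability[OF lip \<open>0 \<le> \<eta>\<close> l1]) auto
  finally show ?thesis by (simp add: algebra_simps)
qed

section \<open>Counting the positions of the displaced jump\<close>

lemma card_separated_le:
  fixes g :: "nat \<Rightarrow> real"
  assumes "finite S" "0 < c" and sep: "\<And>j j'. j \<in> S \<Longrightarrow> j' \<in> S \<Longrightarrow> j < j' \<Longrightarrow> c * real (j' - j) \<le> \<bar>g j' - g j\<bar>"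
    and range: "\<And>j. j \<in> S \<Longrightarrow> g j \<in> {\<alpha><..<\<beta>}" and "\<alpha> \<le> \<beta>"
  shows "real (card S) \<le> 1 + (\<beta> - \<alpha>) / c"
proof (cases "S = {}")
  case True
  then show ?thesis using assms by simp
next
  case False
  let ?a = "Min S" and ?b = "Max S"
  have ab: "?a \<in> S" "?b \<in> S" "?a \<le> ?b" using False \<open>finite S\<close> by auto
  have "S \<subseteq> {?a..?b}" using \<open>finite S\<close> by auto
  then have "card S \<le> Suc (?b - ?a)" using card_mono[of "{?a..?b}" S] ab by simp
  moreover have "c * real (?b - ?a) \<le> \<beta> - \<alpha>"
  proof (cases "?a = ?b")
    case False
    then have "c * real (?b - ?a) \<le> \<bar>g ?b - g ?a\<bar>" using ab by (intro sep) auto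
    then show ?thesis using range[OF ab(1)] range[OF ab(2)] by auto
  qed (use \<open>\<alpha> \<le> \<beta>\<close> in simp)
  then have "real (?b - ?a) \<le> (\<beta> - \<alpha>) / c" using \<open>0 < c\<close> by (simp add: field_simps)
  ultimately show ?thesis by linarith
qed

text \<open>Markov's inequality for the counting measure.\<close>

lemma card_large_le:
  fixes v :: "nat \<Rightarrow> real"
  assumes "finite A" "0 < \<epsilon>" "\<And>k. k \<in> A \<Longrightarrow> 0 \<le> v k" "(\<Sum>k\<in>A. v k) \<le> s"
  shows "real (card {k \<in> A. \<epsilon> < v k}) \<le> s / \<epsilon>"
proof -
  have "\<epsilon> * real (card {k \<in> A. \<epsilon> < v k}) = (\<Sum>k\<in>{k \<in> A. \<epsilon> < v k}. \<epsilon>)" by simp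
  also have "\<dots> \<le> (\<Sum>k\<in>{k \<in> A. \<epsilon> < v k}. v k)" by (intro sum_mono) auto
  also have "\<dots> \<le> (\<Sum>k\<in>A. v k)" using assms by (intro sum_mono2) auto
  finally show ?thesis using assms by (simp add: field_simps)
qed

text \<open>
  Exchanging the increments \<open>i\<close> and \<open>j\<close> amounts to moving the large increment \<open>b i\<close>
  to \<open>j\<close>, up to the misplacement of the increment \<open>b j\<close>, which is small for most \<open>j\<close>.
\<close>

lemma card_swaps_hitting_interval:
  fixes f :: "real \<Rightarrow> real" and b v :: "nat \<Rightarrow> real"
  assumes lip: "\<And>u v. \<bar>f u - f v\<bar> \<le> L * \<bar>u - v\<bar>" and "0 < \<eta>" "0 < \<kappa>" "\<eta> * L \<le> 1 / 2"
    and gap: "monotone_gap f {x-\<delta>..x+\<delta>} d \<kappa>"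
    and drift: "real n * \<eta> * (\<bar>f x\<bar> + L * \<delta>) \<le> \<delta> / 2"
    and bv: "\<And>k. k < n \<Longrightarrow> \<bar>b k\<bar> \<le> v k" and noise: "(\<Sum>k<n. v k) \<le> \<delta> / 2"
    and H: "2 * d \<le> \<bar>b i\<bar>" "0 \<le> d" and short: "real n * (\<eta> * L) \<le> 1 / 2"
    and i: "i < n" "n \<le> M" and B: "B \<subseteq> {..<n}" and "0 < \<epsilon>" "\<alpha> \<le> \<beta>"
  defines "r \<equiv> 2 * exp (real M * \<eta> * L) * \<epsilon>"
  shows "real (card {j \<in> B. euler f \<eta> x (b \<circ> Transposition.transpose i j) M \<in> {\<alpha><..<\<beta>}}) \<le>
    \<delta> / 2 / \<epsilon> + (1 + (\<beta> - \<alpha> + 2 * r) / (exp (- 2 * (real M * \<eta>) * L) * (\<eta> * \<kappa>)))"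
proof -
  have L: "0 \<le> L" using lip[of 1 0] by simp
  define a where "a = b(i := 0)"
  \<comment> \<open>\<open>ideal j\<close> moves the big increment to \<open>j\<close> and leaves
    \<open>b j\<close> in place, so \<open>euler_separation\<close> applies to it. The actual swap
    also puts \<open>b j\<close> at \<open>i\<close>; the two noises differ by \<open>b j\<close> at
    \<open>i\<close> and at \<open>j\<close>, whence the factor 2 in \<open>r\<close>.\<close>
  define ideal where "ideal j = euler f \<eta> x (a(j := a j + b i)) M" for j
  let ?sw = "\<lambda>j. euler f \<eta> x (b \<circ> Transposition.transpose i j) M"
  let ?S = "{j \<in> B. ?sw j \<in> {\<alpha><..<\<beta>}}"
  let ?S1 = "{k \<in> B. \<epsilon> < v k}"
  let ?S2 = "{j \<in> B. \<not> \<epsilon> < v j \<and> ?sw j \<in> {\<alpha><..<\<beta>}}"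
  have fB: "finite B" using B finite_subset by blast
  have v0: "0 \<le> v k" if "k < n" for k using bv[OF that] by linarith
  have "(\<Sum>k\<in>B. v k) \<le> (\<Sum>k<n. v k)" using B v0 by (intro sum_mono2) auto
  then have S1: "real (card ?S1) \<le> \<delta> / 2 / \<epsilon>"
    using v0 B noise by (intro card_large_le fB \<open>0 < \<epsilon>\<close>) auto
  have close: "\<bar>?sw j - ideal j\<bar> \<le> r" if j: "j \<in> B" "\<not> \<epsilon> < v j" for j
  proof -
    let ?c = "a(j := a j + b i)"
    have jn: "j < n" using j B by auto
    have bj: "\<bar>b j\<bar> \<le> \<epsilon>" using bv[OF jn] j by linarith
    have "\<bar>?sw j - ideal j\<bar> \<le>
        (1 + \<eta> * L) ^ M * (\<Sum>k<M. \<bar>(b \<circ> Transposition.transpose i j) k - ?c k\<bar>)"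
      unfolding ideal_def using \<open>0 < \<eta>\<close> by (intro euler_upper_stability[OF lip]) auto
    also have "\<dots> \<le> exp (\<eta> * L) ^ M * (\<Sum>k<M. (if k = i then \<epsilon> else 0) + (if k = j then \<epsilon> else 0))"
    proof (intro mult_mono power_mono exp_ge_add_one_self)
      show "(\<Sum>k<M. \<bar>(b \<circ> Transposition.transpose i j) k - ?c k\<bar>) \<le>
          (\<Sum>k<M. (if k = i then \<epsilon> else 0) + (if k = j then \<epsilon> else 0))"
        using bj \<open>0 < \<epsilon>\<close> by (intro sum_mono) (auto simp: a_def Transposition.transpose_def)
    qed (use L \<open>0 < \<eta>\<close> in \<open>auto intro: sum_nonneg\<close>)
    also have "\<dots> = r"
      using i jn by (simp add: sum.distrib r_def exp_of_nat_mult[symmetric] mult_ac)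
    finally show ?thesis .
  qed
  have "(\<Sum>k<n. \<bar>a k\<bar>) + \<bar>b i\<bar> = (\<Sum>k<n. \<bar>a k\<bar> + (if k = i then \<bar>b i\<bar> else 0))"
    using i by (simp add: sum.distrib)
  also have "\<dots> \<le> (\<Sum>k<n. v k)" using bv by (intro sum_mono) (auto simp: a_def)
  finally have noise': "(\<Sum>k<n. \<bar>a k\<bar>) + \<bar>b i\<bar> \<le> \<delta> / 2" using noise by linarith
  \<comment> \<open>If a swap with small \<open>v j\<close> leads into the interval, then the
    \<open>ideal\<close> endpoint lies in the interval enlarged by \<open>r\<close> on both sides,
    where separation limits the number of candidates.\<close>
  have S2: "real (card ?S2) \<le> 1 + ((\<beta> + r) - (\<alpha> - r)) / (exp (- 2 * (real M * \<eta>) * L) * (\<eta> * \<kappa>))"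
  proof (rule card_separated_le[where g = ideal])
    fix j j' assume *: "j \<in> ?S2" "j' \<in> ?S2" "j < j'"
    show "exp (- 2 * (real M * \<eta>) * L) * (\<eta> * \<kappa>) * real (j' - j) \<le> \<bar>ideal j' - ideal j\<bar>"
      unfolding ideal_def using * B i \<open>0 < \<eta>\<close> \<open>0 < \<kappa>\<close>
      by (intro euler_separation[OF lip _ _ \<open>\<eta> * L \<le> 1 / 2\<close> gap drift noise' H short]) auto
  next
    fix j assume "j \<in> ?S2"
    with close[of j] show "ideal j \<in> {\<alpha> - r<..<\<beta> + r}" by auto
  next
    have "0 \<le> r" using \<open>0 < \<epsilon>\<close> by (simp add: r_def)
    then show "\<alpha> - r \<le> \<beta> + r" using \<open>\<alpha> \<le> \<beta>\<close> by linarith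
  qed (use fB \<open>0 < \<eta>\<close> \<open>0 < \<kappa>\<close> in auto)
  have "card ?S \<le> card (?S1 \<union> ?S2)" using fB by (intro card_mono) auto
  also have "\<dots> \<le> card ?S1 + card ?S2" by (rule card_Un_le)
  finally have "real (card ?S) \<le> real (card ?S1) + real (card ?S2)" by linarith
  with S1 S2 show ?thesis by (simp add: algebra_simps)
qed

section \<open>Jumps of cadlag paths\<close>

definition path_jump :: "(real \<Rightarrow> real) \<Rightarrow> real \<Rightarrow> real" where
  "path_jump g t = g t - Lim (at_left t) g"

text \<open>The times are forgotten because the integrand \<open>h y\<close> depends on the size
  only. Half-open intervals make the measure additive over adjacent cells.\<close>

definition jump_sizes :: "(real \<Rightarrow> real) \<Rightarrow> real \<Rightarrow> real \<Rightarrow> real measure" where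
  "jump_sizes g s t = distr (count_space {r \<in> {s<..t}. path_jump g r \<noteq> 0}) borel (path_jump g)"

text \<open>Events of the product sigma-algebra depend on countably many coordinates, which in
  general is not enough to see jumps. On cadlag paths it is enough, see
  \<open>exists_jump_iff\<close>; hence the restriction.\<close>

definition path_space :: "(real \<Rightarrow> real) measure" where
  "path_space = restrict_space (\<Pi>\<^sub>M t\<in>UNIV. borel) {g. cadlag g}"

lemma jump_eq_path_jump: "jump X t \<omega> = path_jump (\<lambda>s. X s \<omega>) t"
  by (simp add: jump_def path_jump_def)

lemma cadlag_tendsto_left:
  assumes "cadlag g" "0 < r"
  shows "(g \<longlongrightarrow> g r - path_jump g r) (at_left r)"
proof -
  obtain l where "(g \<longlongrightarrow> l) (at_left r)" using assms by (auto simp: cadlag_def)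
  moreover from this have "Lim (at_left r) g = l" by (intro tendsto_Lim) auto
  ultimately show ?thesis by (simp add: path_jump_def)
qed

lemma path_jump_unique:
  assumes "(g \<longlongrightarrow> l) (at_left r)"
  shows "path_jump g r = g r - l"
  using assms tendsto_Lim[of "at_left r" g l] by (simp add: path_jump_def)

lemma cadlag_continuous_right:
  assumes "cadlag g" "0 \<le> r"
  shows "continuous (at r within {r..}) g"
proof -
  have "at r within {r..} = at_right r"
    unfolding at_within_def by (intro arg_cong2[of _ _ _ _ inf] arg_cong[of _ _ principal]) auto
  then show ?thesis using assms by (simp add: continuous_within cadlag_def)
qed

text \<open>Near \<open>r\<close> the path is almost constant on the right, including
  \<open>r\<close>, and almost constant on the left, excluding \<open>r\<close>. A large increment
  over times close to \<open>r\<close> must therefore straddle \<open>r\<close>.\<close>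

lemma cadlag_oscillation:
  assumes g: "cadlag g" and r: "0 \<le> r" and e: "0 < e"
  obtains d where "0 < d"
    "\<And>u v. r \<le> u \<Longrightarrow> u < r + d \<Longrightarrow> r \<le> v \<Longrightarrow> v < r + d \<Longrightarrow> \<bar>g u - g v\<bar> < e"
    "\<And>u v. 0 < r \<Longrightarrow> r - d < u \<Longrightarrow> u < r \<Longrightarrow> r - d < v \<Longrightarrow> v < r \<Longrightarrow> \<bar>g u - g v\<bar> < e"
proof -
  have "eventually (\<lambda>u. dist (g u) (g r) < e / 2) (at_right r)"
    using g r e by (intro tendstoD) (auto simp: cadlag_def)
  then obtain c where c: "r < c" "\<And>u. r < u \<Longrightarrow> u < c \<Longrightarrow> dist (g u) (g r) < e / 2"
    by (auto simp: eventually_at_right_field)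
  have right: "dist (g u) (g r) < e / 2" if "r \<le> u" "u < c" for u
    using c(2)[of u] that e by (cases "u = r") auto
  obtain b where b: "b < r"
    "\<And>u. 0 < r \<Longrightarrow> b < u \<Longrightarrow> u < r \<Longrightarrow> dist (g u) (g r - path_jump g r) < e / 2"
  proof (cases "0 < r")
    case True
    then have "eventually (\<lambda>u. dist (g u) (g r - path_jump g r) < e / 2) (at_left r)"
      using cadlag_tendsto_left[OF g] e by (intro tendstoD) auto
    then show ?thesis using that by (auto simp: eventually_at_left_field)
  qed (use that[of "r - 1"] in auto)
  show ?thesis
  proof (rule that[of "min (c - r) (r - b)"])
    show "0 < min (c - r) (r - b)" using b c by simp
    fix u v assume "r \<le> u" "u < r + min (c - r) (r - b)" "r \<le> v" "v < r + min (c - r) (r - b)"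
    then have "dist (g u) (g r) < e / 2" "dist (g v) (g r) < e / 2" by (intro right; linarith)+
    then show "\<bar>g u - g v\<bar> < e" unfolding dist_real_def by linarith
  next
    fix u v assume "0 < r" "r - min (c - r) (r - b) < u" "u < r" "r - min (c - r) (r - b) < v" "v < r"
    then have "dist (g u) (g r - path_jump g r) < e / 2" "dist (g v) (g r - path_jump g r) < e / 2"
      by (intro b(2); linarith)+
    then show "\<bar>g u - g v\<bar> < e" unfolding dist_real_def by linarith
  qed
qed

text \<open>Detects jumps from countably many coordinates. A jump with size in \<open>F\<close>
  yields, at every scale, two close times in \<open>Q\<close> whose increment is near
  \<open>F\<close>. Conversely, such pairs accumulate at some \<open>r\<close>; their increments
  stay away from 0, so by \<open>cadlag_oscillation\<close> the pairs eventually straddle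
  \<open>r\<close>, and the increments converge to the jump at \<open>r\<close>, which lies in
  \<open>F\<close> because \<open>F\<close> is closed.\<close>

lemma exists_jump_iff:
  assumes g: "cadlag g" and st: "0 \<le> s" "s < t" and F: "closed F" "0 \<notin> F"
  defines "Q \<equiv> insert s (insert t (\<rat> \<inter> {s<..<t}))"
  shows "(\<exists>r\<in>{s<..t}. path_jump g r \<in> F) \<longleftrightarrow>
    (\<forall>n. \<exists>u\<in>Q. \<exists>v\<in>Q. u < v \<and> v - u < inverse (Suc n) \<and> (\<exists>y\<in>F. \<bar>g v - g u - y\<bar> < inverse (Suc n)))"
    (is "?L \<longleftrightarrow> ?R")
proof
  assume ?L
  then obtain r where r: "s < r" "r \<le> t" "path_jump g r \<in> F" by auto
  show ?R
  proof
    fix n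
    let ?e = "inverse (real (Suc n))"
    have e: "0 < ?e / 2" by simp
    let ?l = "g r - path_jump g r"
    have "eventually (\<lambda>u. dist (g u) ?l < ?e / 2) (at_left r)"
      using cadlag_tendsto_left[OF g, of r] r st e by (intro tendstoD) auto
    then obtain b where b: "b < r" "\<And>u. b < u \<Longrightarrow> u < r \<Longrightarrow> dist (g u) ?l < ?e / 2"
      by (auto simp: eventually_at_left_field)
    have "max b (max s (r - ?e / 2)) < r" using b r e by simp
    from Rats_dense_in_real[OF this]
    obtain u where u: "u \<in> \<rat>" "b < u" "s < u" "r - ?e / 2 < u" "u < r" by auto
    have "\<exists>v\<in>Q. r \<le> v \<and> v < r + ?e / 2 \<and> dist (g v) (g r) < ?e / 2"
    \<comment> \<open>A jump at the right end \<open>t\<close> cannot be detected from later times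
      in the interval; there \<open>v\<close> is \<open>t\<close> itself, which is why
      \<open>Q\<close> contains \<open>t\<close>.\<close>
    proof (cases "r = t")
      case True
      then show ?thesis using e by (intro bexI[of _ r]) (auto simp: Q_def)
    next
      case False
      have "eventually (\<lambda>u. dist (g u) (g r) < ?e / 2) (at_right r)"
        using g r st e by (intro tendstoD) (auto simp: cadlag_def)
      then obtain c where c: "c > r" "\<And>u. r < u \<Longrightarrow> u < c \<Longrightarrow> dist (g u) (g r) < ?e / 2"
        by (auto simp: eventually_at_right_field)
      have "r < min c (min t (r + ?e / 2))" using c r e False by simp
      from Rats_dense_in_real[OF this] obtain v where
        "v \<in> \<rat>" "r < v" "v < c" "v < t" "v < r + ?e / 2" by auto
      then show ?thesis using c r by (intro bexI[of _ v]) (auto simp: Q_def)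
    qed
    then obtain v where v: "v \<in> Q" "r \<le> v" "v < r + ?e / 2" "dist (g v) (g r) < ?e / 2" by blast
    have "\<bar>g v - g u - path_jump g r\<bar> < ?e"
      using b(2)[of u] u v by (simp add: dist_real_def) (smt (verit) field_sum_of_halves)
    moreover have "u \<in> Q" "u < v" using u v r by (auto simp: Q_def)
    moreover have "v - u < ?e" using u v by linarith
    ultimately show "\<exists>u\<in>Q. \<exists>v\<in>Q. u < v \<and> v - u < ?e \<and> (\<exists>y\<in>F. \<bar>g v - g u - y\<bar> < ?e)"
      using r v by blast
  qed
next
  assume ?R
  then obtain u v y where uvy: "\<And>n. u n \<in> Q" "\<And>n. v n \<in> Q" "\<And>n. u n < v n"
      "\<And>n. v n - u n < inverse (real (Suc n))" "\<And>n. y n \<in> F"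
      "\<And>n. \<bar>g (v n) - g (u n) - y n\<bar> < inverse (real (Suc n))"
    by metis
  have Q: "Q \<subseteq> {s..t}" using st by (auto simp: Q_def)
  obtain r \<phi> where r: "r \<in> {s..t}" and \<phi>: "strict_mono (\<phi> :: nat \<Rightarrow> nat)" and lim: "(u \<circ> \<phi>) \<longlonglongrightarrow> r"
    using compact_imp_seq_compact[OF compact_Icc[of s t]] uvy(1) Q
    unfolding seq_compact_def by (metis subsetD)
  define a where "a = u \<circ> \<phi>"
  define b where "b = v \<circ> \<phi>"
  define z where "z = y \<circ> \<phi>"
  have \<phi>0: "(\<lambda>n. inverse (real (Suc (\<phi> n)))) \<longlonglongrightarrow> 0"
    using LIMSEQ_subseq_LIMSEQ[OF LIMSEQ_inverse_real_of_nat \<phi>] by (simp add: o_def)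
  have a_lim: "a \<longlonglongrightarrow> r" using lim by (simp add: a_def)
  have diff: "\<bar>b n - a n\<bar> \<le> inverse (real (Suc (\<phi> n)))" for n
    using uvy(3,4)[of "\<phi> n"] by (simp add: a_def b_def)
  have "(\<lambda>n. b n - a n) \<longlonglongrightarrow> 0"
    by (rule Lim_null_comparison[OF always_eventually \<phi>0]) (use diff in auto)
  from tendsto_add[OF this a_lim] have b_lim: "b \<longlonglongrightarrow> r" by simp
  have zdiff: "\<bar>g (b n) - g (a n) - z n\<bar> \<le> inverse (real (Suc (\<phi> n)))" for n
    using uvy(6)[of "\<phi> n"] by (simp add: a_def b_def z_def)
  have z0: "(\<lambda>n. g (b n) - g (a n) - z n) \<longlonglongrightarrow> 0"
    by (rule Lim_null_comparison[OF always_eventually \<phi>0]) (use zdiff in auto)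
  have ab: "a n < b n" "a n \<in> {s..t}" "b n \<in> {s..t}" for n
    using uvy(1-3)[of "\<phi> n"] Q by (auto simp: a_def b_def)
  \<comment> \<open>A closed set without 0 keeps a distance \<open>e\<close> from 0, so increments
    close to \<open>F\<close> do not become small.\<close>
  obtain e where e: "0 < e" "\<And>w. w \<in> F \<Longrightarrow> e \<le> \<bar>w\<bar>"
  proof -
    have "open (- F)" "0 \<in> - F" using F by (auto simp: open_Compl)
    then obtain e where "0 < e" "ball 0 e \<subseteq> - F" by (meson open_contains_ball)
    then show ?thesis by (intro that[of e]) (auto simp: subset_iff not_less[symmetric])
  qed
  have "0 < e / 2" using e by simp
  have "0 \<le> r" using r st by simp
  from cadlag_oscillation[OF g this \<open>0 < e / 2\<close>] obtain d1 where d1: "0 < d1"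
    "\<And>u v. r \<le> u \<Longrightarrow> u < r + d1 \<Longrightarrow> r \<le> v \<Longrightarrow> v < r + d1 \<Longrightarrow> \<bar>g u - g v\<bar> < e / 2"
    "\<And>u v. 0 < r \<Longrightarrow> r - d1 < u \<Longrightarrow> u < r \<Longrightarrow> r - d1 < v \<Longrightarrow> v < r \<Longrightarrow> \<bar>g u - g v\<bar> < e / 2"
    by metis
  have "eventually (\<lambda>n. a n < r \<and> r \<le> b n) sequentially"
  proof -
    have "eventually (\<lambda>n. dist (a n) r < d1) sequentially"
      "eventually (\<lambda>n. dist (b n) r < d1) sequentially"
      "eventually (\<lambda>n. dist (g (b n) - g (a n) - z n) 0 < e / 2) sequentially"
      using d1(1) e(1) by (intro tendstoD a_lim b_lim z0, simp)+
    then show ?thesis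
    proof eventually_elim
      case (elim n)
      have "e \<le> \<bar>z n\<bar>" using e(2)[of "z n"] uvy(5) by (simp add: z_def)
      then have big: "\<bar>g (b n) - g (a n)\<bar> > e / 2"
        using elim by (simp add: dist_real_def) (smt (verit) field_sum_of_halves)
      have "\<not> r \<le> a n"
      proof
        assume "r \<le> a n"
        then have "\<bar>g (b n) - g (a n)\<bar> < e / 2"
          using ab(1)[of n] elim by (intro d1(2)) (auto simp: dist_real_def)
        with big show False by simp
      qed
      moreover have "\<not> b n < r"
      proof
        assume "b n < r"
        then have "\<bar>g (b n) - g (a n)\<bar> < e / 2"
          using ab[of n] st elim by (intro d1(3)) (auto simp: dist_real_def)
        with big show False by simp
      qed
      ultimately show ?case by simp
    qed
  qed
  then have ev: "eventually (\<lambda>n. a n < r) sequentially" "eventually (\<lambda>n. b n \<in> {r..}) sequentially"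
    by (auto elim: eventually_mono)
  \<comment> \<open>All \<open>a n\<close> are at least \<open>s\<close>, so the accumulation point
    is not the excluded end point \<open>s\<close>.\<close>
  obtain n where "a n < r" using eventually_happens[OF ev(1)] by auto
  then have sr: "s < r" using ab[of n] by simp
  have "filterlim a (at_left r) sequentially"
    using a_lim ev(1) by (auto simp: filterlim_at elim: eventually_mono)
  then have "(\<lambda>n. g (a n)) \<longlonglongrightarrow> g r - path_jump g r"
    using cadlag_tendsto_left[OF g, of r] sr st by (auto intro: filterlim_compose)
  moreover have "(\<lambda>n. g (b n)) \<longlonglongrightarrow> g r"
    using continuous_within_tendsto_compose[OF cadlag_continuous_right[OF g] ev(2) b_lim] r st by simp
  ultimately have "(\<lambda>n. g (b n) - g (a n) - (g (b n) - g (a n) - z n)) \<longlonglongrightarrow> g r - (g r - path_jump g r) - 0"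
    by (intro tendsto_diff z0)
  then have "z \<longlonglongrightarrow> path_jump g r" by simp
  then have "path_jump g r \<in> F"
    using closed_sequentially[OF F(1), of z] uvy(5) by (simp add: z_def)
  then show ?L using sr r by auto
qed

lemma path_jump_le_oscillation:
  assumes g: "cadlag g" and r: "0 < r" "r \<in> {a<..<b}"
    and osc: "\<And>u v. u \<in> {a<..<b} \<Longrightarrow> v \<in> {a<..<b} \<Longrightarrow> \<bar>g u - g v\<bar> < e"
  shows "\<bar>path_jump g r\<bar> \<le> e"
proof -
  have "((\<lambda>u. \<bar>g r - g u\<bar>) \<longlongrightarrow> \<bar>g r - (g r - path_jump g r)\<bar>) (at_left r)"
    by (intro tendsto_intros cadlag_tendsto_left[OF g r(1)])
  moreover have "eventually (\<lambda>u. u \<in> {a<..<r}) (at_left r)"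
    using r by (intro eventually_at_left_real) auto
  then have "eventually (\<lambda>u. \<bar>g r - g u\<bar> \<le> e) (at_left r)"
    by eventually_elim (use osc[of r] r in \<open>auto intro: less_imp_le\<close>)
  ultimately have "\<bar>g r - (g r - path_jump g r)\<bar> \<le> e"
    by (intro tendsto_upperbound) auto
  then show ?thesis by simp
qed

text \<open>Infinitely many big jump times would accumulate at some \<open>r\<close>. But every
  other time close to \<open>r\<close> lies inside a one-sided neighbourhood of \<open>r\<close> on
  which the path oscillates by less than \<open>e / 2\<close>.\<close>

lemma finite_big_jumps:
  assumes g: "cadlag g" and "0 \<le> s" and "0 < e"
  shows "finite {r \<in> {s<..t}. e \<le> \<bar>path_jump g r\<bar>}" (is "finite ?S")
proof (rule ccontr)
  assume inf: "infinite ?S"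
  have "compact {s..t}" by simp
  moreover have "?S \<subseteq> {s..t}" by auto
  ultimately obtain r where r: "r \<in> {s..t}" "r islimpt ?S"
    using inf unfolding compact_eq_Bolzano_Weierstrass by blast
  have "0 < e / 2" using \<open>0 < e\<close> by simp
  have "0 \<le> r" using r \<open>0 \<le> s\<close> by simp
  from cadlag_oscillation[OF g this \<open>0 < e / 2\<close>] obtain d1 where d1: "0 < d1"
    "\<And>u v. r \<le> u \<Longrightarrow> u < r + d1 \<Longrightarrow> r \<le> v \<Longrightarrow> v < r + d1 \<Longrightarrow> \<bar>g u - g v\<bar> < e / 2"
    "\<And>u v. 0 < r \<Longrightarrow> r - d1 < u \<Longrightarrow> u < r \<Longrightarrow> r - d1 < v \<Longrightarrow> v < r \<Longrightarrow> \<bar>g u - g v\<bar> < e / 2"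
    by metis
  obtain w where w: "w \<in> ?S" "w \<noteq> r" "dist w r < d1"
    using r(2) d1(1) unfolding islimpt_approachable by metis
  have "\<bar>path_jump g w\<bar> \<le> e / 2"
  proof (cases "w < r")
    case True
    then show ?thesis using w \<open>0 \<le> s\<close>
      by (intro path_jump_le_oscillation[OF g _ _ d1(3), of w "r - d1" r]) (auto simp: dist_real_def)
  next
    case False
    then show ?thesis using w \<open>0 \<le> s\<close>
      by (intro path_jump_le_oscillation[OF g _ _ d1(2), of w r "r + d1"]) (auto simp: dist_real_def)
  qed
  then show False using w \<open>0 < e\<close> by auto
qed

section \<open>Counting points with grid cells\<close>

definition grid_cell :: "real \<Rightarrow> real \<Rightarrow> nat \<Rightarrow> nat \<Rightarrow> real set" where
  "grid_cell s t n k = {s + real k * ((t - s) / real n)<..s + real (Suc k) * ((t - s) / real n)}"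

lemma grid_cell_exists:
  assumes "r \<in> {s<..t}" "0 < n"
  obtains k where "k < n" "r \<in> grid_cell s t n k"
proof -
  define \<eta> where "\<eta> = (t - s) / real n"
  have \<eta>: "0 < \<eta>" using assms by (simp add: \<eta>_def)
  define c where "c = \<lceil>(r - s) / \<eta>\<rceil>"
  have c: "real_of_int c - 1 < (r - s) / \<eta>" "(r - s) / \<eta> \<le> real_of_int c"
    unfolding c_def by linarith+
  have "0 < (r - s) / \<eta>" using assms \<eta> by simp
  then have "0 < c" using c by linarith
  have "(r - s) / \<eta> \<le> real n"
    using assms \<eta> by (simp add: pos_divide_le_eq) (simp add: \<eta>_def)
  then have "c \<le> int n" unfolding c_def by (simp add: ceiling_le_iff)
  define k where "k = nat (c - 1)"
  have k: "real k = real_of_int c - 1" using \<open>0 < c\<close> by (simp add: k_def)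
  have "real k * \<eta> < r - s" "r - s \<le> real (Suc k) * \<eta>"
    using c \<eta> k by (auto simp: pos_divide_le_eq pos_less_divide_eq)
  then have "r \<in> grid_cell s t n k" by (simp add: grid_cell_def \<eta>_def[symmetric])
  moreover have "k < n" using \<open>c \<le> int n\<close> \<open>0 < c\<close> by (simp add: k_def)
  ultimately show ?thesis using that by blast
qed

lemma grid_cell_inj:
  assumes "r \<in> grid_cell s t n k" "r \<in> grid_cell s t n k'" "s < t" "0 < n"
  shows "k = k'"
proof -
  define \<eta> where "\<eta> = (t - s) / real n"
  have \<eta>: "0 < \<eta>" using assms by (simp add: \<eta>_def)
  have "real k * \<eta> < real (Suc k') * \<eta>" "real k' * \<eta> < real (Suc k) * \<eta>"
    using assms(1,2) by (auto simp: grid_cell_def \<eta>_def[symmetric])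
  then show ?thesis using \<eta> by simp
qed

lemma card_cells_le:
  assumes "A \<subseteq> {s<..t}" "s < t" "0 < n"
  shows "of_nat (card {k\<in>{..<n}. A \<inter> grid_cell s t n k \<noteq> {}}) \<le> emeasure (count_space UNIV) A"
proof (cases "finite A")
  case True
  let ?K = "{k\<in>{..<n}. A \<inter> grid_cell s t n k \<noteq> {}}"
  have "\<forall>k\<in>?K. \<exists>r. r \<in> A \<inter> grid_cell s t n k" by blast
  then obtain \<rho> where \<rho>: "\<And>k. k \<in> ?K \<Longrightarrow> \<rho> k \<in> A \<inter> grid_cell s t n k" by metis
  have "inj_on \<rho> ?K"
  proof (rule inj_onI)
    fix k k' assume "k \<in> ?K" "k' \<in> ?K" "\<rho> k = \<rho> k'"
    with \<rho>[of k] \<rho>[of k'] have "\<rho> k \<in> grid_cell s t n k" "\<rho> k \<in> grid_cell s t n k'" by auto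
    from grid_cell_inj[OF this assms(2,3)] show "k = k'" .
  qed
  then have "card ?K \<le> card A"
    using \<rho> True by (intro card_inj_on_le[of \<rho>]) auto
  then show ?thesis using True by simp
qed simp

text \<open>Once the mesh is below the smallest distance between points of \<open>A\<close>, no two
  of them share a cell.\<close>

lemma card_le_card_cells_eventually:
  assumes "finite A" "A \<subseteq> {s<..t}" "s < t"
  shows "eventually (\<lambda>n. card A \<le> card {k\<in>{..<n}. A \<inter> grid_cell s t n k \<noteq> {}}) sequentially"
proof -
  obtain \<gamma> where \<gamma>: "0 < \<gamma>" "\<And>a b. a \<in> A \<Longrightarrow> b \<in> A \<Longrightarrow> a \<noteq> b \<Longrightarrow> \<gamma> \<le> dist a b"
  proof -
    have "\<exists>d>0. \<forall>b\<in>A. b \<noteq> a \<longrightarrow> d \<le> dist a b" for a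
      using finite_set_avoid[OF assms(1), of a] by auto
    then obtain d where d: "\<And>a. 0 < d a" "\<And>a b. b \<in> A \<Longrightarrow> b \<noteq> a \<Longrightarrow> d a \<le> dist a b" by metis
    define \<gamma> where "\<gamma> = Min (insert 1 (d ` A))"
    have "0 < \<gamma>" using assms(1) d by (auto simp: \<gamma>_def)
    moreover have "\<gamma> \<le> d a" if "a \<in> A" for a using assms(1) that by (auto simp: \<gamma>_def)
    moreover have "\<gamma> \<le> dist a b" if "a \<in> A" "b \<in> A" "a \<noteq> b" for a b
      using \<open>\<And>a. a \<in> A \<Longrightarrow> \<gamma> \<le> d a\<close>[OF that(1)] d(2)[of b a] that by auto
    ultimately show ?thesis using that[of \<gamma>] by blast
  qed
  have "(\<lambda>n. (t - s) / real n) \<longlonglongrightarrow> 0" by real_asymp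
  then have "eventually (\<lambda>n. (t - s) / real n < \<gamma>) sequentially"
    using \<gamma>(1) by (simp add: order_tendstoD)
  with eventually_gt_at_top[of 0] show ?thesis
  proof eventually_elim
    case (elim n)
    have "\<forall>r\<in>A. \<exists>k. k < n \<and> r \<in> grid_cell s t n k"
    proof
      fix r assume "r \<in> A"
      then have "r \<in> {s<..t}" using assms(2) by auto
      from grid_cell_exists[OF this elim(1)] show "\<exists>k. k < n \<and> r \<in> grid_cell s t n k" by blast
    qed
    then obtain \<kappa> where \<kappa>: "\<And>r. r \<in> A \<Longrightarrow> \<kappa> r < n \<and> r \<in> grid_cell s t n (\<kappa> r)" by metis
    have "inj_on \<kappa> A"
    proof
      fix a b assume ab: "a \<in> A" "b \<in> A" "\<kappa> a = \<kappa> b"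
      then have *: "a \<in> grid_cell s t n (\<kappa> a)" "b \<in> grid_cell s t n (\<kappa> a)"
        using \<kappa>[of a] \<kappa>[of b] by auto
      have "dist a b < (t - s) / real n"
        using * unfolding grid_cell_def by (auto simp: dist_real_def algebra_simps add_divide_distrib diff_divide_distrib)
      then show "a = b" using \<gamma>(2)[OF ab(1,2)] elim by fastforce
    qed
    then show ?case using \<kappa> by (intro card_inj_on_le[of \<kappa>]) auto
  qed
qed

text \<open>The number of occupied cells never exceeds the number of points and eventually reaches
  that of any finite subset. Grids with different \<open>n\<close> are not nested, so a lower limit
  replaces a supremum; it preserves measurability and is the form in which Fatou's lemma
  applies.\<close>

lemma liminf_card_cells:
  assumes "A \<subseteq> {s<..t}" "s < t"
  shows "liminf (\<lambda>n. of_nat (card {k\<in>{..<n}. A \<inter> grid_cell s t n k \<noteq> {}})) =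
    emeasure (count_space UNIV) A" (is "liminf ?c = _")
proof (rule antisym)
  have "liminf ?c \<le> liminf (\<lambda>n. emeasure (count_space UNIV) A)"
    by (rule Liminf_mono, rule eventually_mono[OF eventually_gt_at_top[of 0]])
      (use card_cells_le[OF assms] in auto)
  then show "liminf ?c \<le> emeasure (count_space UNIV) A" by (simp add: Liminf_const)
  have *: "of_nat (card B) \<le> liminf ?c" if "finite B" "B \<subseteq> A" for B
  proof (rule Liminf_bounded)
    have "B \<subseteq> {s<..t}" using that assms by auto
    from card_le_card_cells_eventually[OF that(1) this assms(2)]
    show "eventually (\<lambda>n. of_nat (card B) \<le> ?c n) sequentially"
    proof eventually_elim
      case (elim n)
      also have "card {k\<in>{..<n}. B \<inter> grid_cell s t n k \<noteq> {}} \<le>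
          card {k\<in>{..<n}. A \<inter> grid_cell s t n k \<noteq> {}}"
        using that by (intro card_mono) auto
      finally show ?case by simp
    qed
  qed
  show "emeasure (count_space UNIV) A \<le> liminf ?c"
  proof (cases "finite A")
    case True
    then show ?thesis using *[of A] by simp
  next
    case False
    have "of_nat N \<le> liminf ?c" for N
    proof -
      obtain B where "finite B" "card B = N" "B \<subseteq> A"
        using infinite_arbitrarily_large[OF False] by blast
      with *[of B] show ?thesis by simp
    qed
    then have "liminf ?c = \<top>"
      by (meson ennreal_Ex_less_of_nat linorder_not_less top.not_eq_extremum)
    then show ?thesis by simp
  qed
qed

section \<open>Measurability of functionals of the jumps\<close>

lemma sets_jump_sizes [simp, measurable_cong]: "sets (jump_sizes g s t) = sets borel"
  by (simp add: jump_sizes_def)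

lemma measurable_jump_sizes [simp]: "borel_measurable (jump_sizes g s t) = borel_measurable borel"
  by (rule measurable_cong_sets) auto

lemma space_jump_sizes [simp]: "space (jump_sizes g s t) = UNIV"
  by (simp add: jump_sizes_def)

lemma emeasure_jump_sizes:
  assumes "B \<in> sets borel"
  shows "emeasure (jump_sizes g s t) B =
    emeasure (count_space UNIV) {r \<in> {s<..t}. path_jump g r \<noteq> 0 \<and> path_jump g r \<in> B}"
proof -
  let ?J = "{r \<in> {s<..t}. path_jump g r \<noteq> 0}"
  have "emeasure (jump_sizes g s t) B = emeasure (count_space ?J) (path_jump g -` B \<inter> ?J)"
    unfolding jump_sizes_def using assms by (subst emeasure_distr) auto
  also have "path_jump g -` B \<inter> ?J = {r \<in> {s<..t}. path_jump g r \<noteq> 0 \<and> path_jump g r \<in> B}" (is "_ = ?A")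
    by auto
  also have "emeasure (count_space ?J) ?A = emeasure (count_space UNIV) ?A"
  proof -
    have "?A \<subseteq> ?J" by auto
    then show ?thesis by (simp only: emeasure_count_space subset_UNIV)
  qed
  finally show ?thesis .
qed

lemma nn_integral_jump_sizes:
  assumes [measurable]: "H \<in> borel_measurable borel"
  shows "(\<integral>\<^sup>+y. H y \<partial>jump_sizes g s t) =
    (\<integral>\<^sup>+r. H (path_jump g r) * indicator {r \<in> {s<..t}. path_jump g r \<noteq> 0} r \<partial>count_space UNIV)"
  unfolding jump_sizes_def
  by (subst nn_integral_distr) (auto simp: nn_integral_count_space_indicator)

lemma space_path_space [simp]: "space path_space = {g. cadlag g}"
  by (auto simp: path_space_def space_restrict_space space_PiM)

lemma measurable_path_eval [measurable]: "(\<lambda>g. g t) \<in> borel_measurable path_space"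
  unfolding path_space_def by (intro measurable_restrict_space1) measurable

lemma pred_countable_Bex:
  assumes "countable Q" "\<And>q. q \<in> Q \<Longrightarrow> Measurable.pred N (P q)"
  shows "Measurable.pred N (\<lambda>x. \<exists>q\<in>Q. P q x)"
proof -
  have "{x \<in> space N. \<exists>q\<in>Q. P q x} = (\<Union>q\<in>Q. {x \<in> space N. P q x})" by auto
  also have "\<dots> \<in> sets N" using assms by (intro sets.countable_UN') (auto simp: pred_def)
  finally show ?thesis by (simp add: pred_def)
qed

lemma measurable_exists_jump:
  assumes st: "0 \<le> s" "s < t" and F: "closed F" "0 \<notin> F"
  shows "Measurable.pred path_space (\<lambda>g. \<exists>r\<in>{s<..t}. path_jump g r \<in> F)"
proof -
  let ?Q = "insert s (insert t (\<rat> \<inter> {s<..<t}))"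
  have "countable (\<rat> \<inter> {s<..<t})" by (rule countable_subset[OF _ countable_rat]) auto
  then have Q: "countable ?Q" by simp
  \<comment> \<open>\<open>F\<close> may be uncountable, but the union of the balls around its
    points is open, so the quantifier becomes membership of one increment in a Borel set.\<close>
  have near: "Measurable.pred path_space (\<lambda>g. \<exists>y\<in>F. \<bar>g v - g u - y\<bar> < e)" for u v e
  proof -
    have "open (\<Union>y\<in>F. ball y e)" by auto
    then have [measurable]: "(\<Union>y\<in>F. ball y e) \<in> sets borel" by (rule borel_open)
    have "(\<exists>y\<in>F. \<bar>g v - g u - y\<bar> < e) \<longleftrightarrow> g v - g u \<in> (\<Union>y\<in>F. ball y e)" for g :: "real \<Rightarrow> real"
      by (auto simp: dist_real_def abs_minus_commute)
    then show ?thesis by (simp only:) measurable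
  qed
  have "Measurable.pred path_space (\<lambda>g. \<forall>n. \<exists>u\<in>?Q. \<exists>v\<in>?Q. u < v \<and> v - u < inverse (Suc n) \<and>
      (\<exists>y\<in>F. \<bar>g v - g u - y\<bar> < inverse (Suc n)))"
  proof (rule pred_intros_countable(1), rule pred_countable_Bex[OF Q], rule pred_countable_Bex[OF Q],
      intro pred_intros_logic(3))
    fix n :: nat and u v :: real
    show "Measurable.pred path_space (\<lambda>g. u < v)"
      "Measurable.pred path_space (\<lambda>g. v - u < inverse (real (Suc n)))" by simp_all
    show "Measurable.pred path_space (\<lambda>g. \<exists>y\<in>F. \<bar>g v - g u - y\<bar> < inverse (real (Suc n)))" by (rule near)
  qed
  note meas = this
  have eq: "(\<exists>r\<in>{s<..t}. path_jump g r \<in> F) \<longleftrightarrow>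
      (\<forall>n. \<exists>u\<in>?Q. \<exists>v\<in>?Q. u < v \<and> v - u < inverse (Suc n) \<and> (\<exists>y\<in>F. \<bar>g v - g u - y\<bar> < inverse (Suc n)))"
    if "g \<in> space path_space" for g
    using that by (intro exists_jump_iff st F) simp
  show ?thesis by (subst measurable_cong, erule eq, rule meas)
qed

text \<open>The number of jumps is the lower limit of the number of cells containing one, and
  whether a cell contains one is a measurable event. As \<open>F\<close> omits 0, every time with
  \<open>path_jump g r\<close> in \<open>F\<close> is a genuine jump.\<close>

lemma measurable_jump_sizes_closed:
  assumes st: "0 \<le> s" "s < t" and F: "closed F" "0 \<notin> F"
  shows "(\<lambda>g. emeasure (jump_sizes g s t) F) \<in> borel_measurable path_space"
proof -
  let ?A = "\<lambda>g. {r \<in> {s<..t}. path_jump g r \<in> F}"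
  have meas: "Measurable.pred path_space (\<lambda>g. ?A g \<inter> grid_cell s t n k \<noteq> {})" if "k < n" for n k
  proof -
    let ?a = "s + real k * ((t - s) / real n)" and ?b = "s + real (Suc k) * ((t - s) / real n)"
    have *: "0 < (t - s) / real n" using that st by simp
    have "real (Suc k) * ((t - s) / real n) \<le> real n * ((t - s) / real n)"
      using that * by (intro mult_right_mono) auto
    also have "\<dots> = t - s" using that by simp
    finally have b: "?b \<le> t" by simp
    have "0 \<le> real k * ((t - s) / real n)" using * by (intro mult_nonneg_nonneg) auto
    then have a: "s \<le> ?a" by simp
    have "?a < ?b" using * by (simp only: of_nat_Suc distrib_right)
    have eq: "(?A g \<inter> grid_cell s t n k \<noteq> {}) \<longleftrightarrow> (\<exists>r\<in>{?a<..?b}. path_jump g r \<in> F)" for g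
    proof -
      have "{?a<..?b} \<subseteq> {s<..t}" using a b by (simp only:
Ioc_subset_iff simp_thms)
      then show ?thesis unfolding grid_cell_def by blast
    qed
    show ?thesis unfolding eq using a st \<open>?a < ?b\<close> by (intro measurable_exists_jump F) auto
  qed
  have "emeasure (jump_sizes g s t) F = liminf (\<lambda>n. \<Sum>k<n. of_bool (?A g \<inter> grid_cell s t n k \<noteq> {}))" for g
  proof -
    have "emeasure (jump_sizes g s t) F = emeasure (count_space UNIV) (?A g)"
      using F by (subst emeasure_jump_sizes) (auto intro!: arg_cong[of _ _ "emeasure (count_space UNIV)"])
    also have "\<dots> = liminf (\<lambda>n. of_nat (card {k\<in>{..<n}. ?A g \<inter> grid_cell s t n k \<noteq> {}}))"
      using st by (intro liminf_card_cells[symmetric]) auto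
    finally show ?thesis by (simp add: of_bool_def sum.If_cases Int_def)
  qed
  moreover have "(\<lambda>g. liminf (\<lambda>n. \<Sum>k<n. of_bool (?A g \<inter> grid_cell s t n k \<noteq> {}) :: ennreal)) \<in> borel_measurable path_space"
  proof (intro borel_measurable_liminf borel_measurable_sum)
    fix n k :: nat assume "k \<in> {..<n}"
    then show "(\<lambda>g. of_bool (?A g \<inter> grid_cell s t n k \<noteq> {}) :: ennreal) \<in> borel_measurable path_space"
      unfolding of_bool_def by (intro measurable_If measurable_const meas[unfolded pred_def]) auto
  qed
  ultimately show ?thesis by simp
qed

text \<open>Dynkin argument starting from closed sets. Intersecting with
  \<open>{y. e \<le> \<bar>y\<bar>}\<close> removes 0 from the closed sets and makes all counts
  finite, so that complements can be treated by subtraction.\<close>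

lemma measurable_jump_sizes_away:
  assumes st: "0 \<le> s" "s < t" and "0 < e" and "B \<in> sets borel"
  shows "(\<lambda>g. emeasure (jump_sizes g s t) (B \<inter> {y. e \<le> \<bar>y\<bar>})) \<in> borel_measurable path_space"
proof -
  let ?C = "{y::real. e \<le> \<bar>y\<bar>}"
  have cC: "closed ?C" by (intro closed_Collect_le continuous_intros)
  have C0: "0 \<notin> ?C" using \<open>0 < e\<close> by simp
  have [measurable]: "?C \<in> sets borel" using cC by (rule borel_closed)
  have fin: "emeasure (jump_sizes g s t) ?C \<noteq> \<infinity>" if "cadlag g" for g
  proof -
    have "finite {r \<in> {s<..t}. path_jump g r \<noteq> 0 \<and> path_jump g r \<in> ?C}"
      by (rule finite_subset[OF _ finite_big_jumps[OF that st(1) \<open>0 < e\<close>, of t]]) auto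
    then show ?thesis by (simp add: emeasure_jump_sizes)
  qed
  have "B \<in> sigma_sets UNIV {S. closed S}"
    using assms(4) by (simp add: borel_eq_closed)
  then show ?thesis
  proof (induction rule: sigma_sets_induct_disjoint[rotated 2, consumes 1, case_names basic empty compl union])
    case (basic A)
    then show ?case using cC C0 by (intro measurable_jump_sizes_closed st) auto
  next
    case empty
    then show ?case by simp
  next
    case (compl A)
    then have [measurable]: "A \<in> sets borel" by (simp add: borel_eq_closed)
    have "emeasure (jump_sizes g s t) ((UNIV - A) \<inter> ?C) =
        emeasure (jump_sizes g s t) ?C - emeasure (jump_sizes g s t) (A \<inter> ?C)" if "cadlag g" for g
    proof -
      have "emeasure (jump_sizes g s t) (A \<inter> ?C) \<noteq> \<infinity>"
        using fin[OF that] emeasure_mono[of "A \<inter> ?C" ?C "jump_sizes g s t"] by (auto simp: top_unique)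
      then have "emeasure (jump_sizes g s t) (?C - A \<inter> ?C) =
          emeasure (jump_sizes g s t) ?C - emeasure (jump_sizes g s t) (A \<inter> ?C)"
        by (intro emeasure_Diff) auto
      moreover have "?C - A \<inter> ?C = (UNIV - A) \<inter> ?C" by auto
      ultimately show ?thesis by simp
    qed
    moreover have "(\<lambda>g. emeasure (jump_sizes g s t) ?C - emeasure (jump_sizes g s t) (A \<inter> ?C))
        \<in> borel_measurable path_space"
      using compl measurable_jump_sizes_closed[OF st cC C0] by (intro borel_measurable_minus_ennreal) auto
    ultimately show ?case
      by (subst measurable_cong[of path_space _ "\<lambda>g. emeasure (jump_sizes g s t) ?C - emeasure (jump_sizes g s t) (A \<inter> ?C)"]) auto
  next
    case (union A)
    then have [measurable]: "\<And>i. A i \<in> sets borel" by (auto simp: borel_eq_closed)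
    have "emeasure (jump_sizes g s t) ((\<Union>i. A i) \<inter> ?C) = (\<Sum>i. emeasure (jump_sizes g s t) (A i \<inter> ?C))" for g
    proof -
      have "(\<Sum>i. emeasure (jump_sizes g s t) (A i \<inter> ?C)) = emeasure (jump_sizes g s t) (\<Union>i. A i \<inter> ?C)"
        using union(1) by (intro suminf_emeasure) (auto simp: disjoint_family_on_def)
      then show ?thesis by simp
    qed
    then show ?case using union by simp
  qed (auto simp: Int_stable_def)
qed

text \<open>The nonzero reals are exhausted by the sets on which \<open>\<bar>y\<bar>\<close> is at
  least \<open>1 / (n + 1)\<close>. The point 0 is never charged, because \<open>jump_sizes\<close>
  counts genuine jumps only.\<close>

lemma measurable_emeasure_jump_sizes:
  assumes st: "0 \<le> s" "s < t" and [measurable]: "B \<in> sets borel"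
  shows "(\<lambda>g. emeasure (jump_sizes g s t) B) \<in> borel_measurable path_space"
proof -
  let ?B = "\<lambda>n. B \<inter> {y. inverse (real (Suc n)) \<le> \<bar>y\<bar>}"
  have B: "?B n \<in> sets borel" for n by measurable
  have "emeasure (jump_sizes g s t) B = (SUP n. emeasure (jump_sizes g s t) (?B n))" for g
  proof -
    have "(SUP n. emeasure (jump_sizes g s t) (?B n)) = emeasure (jump_sizes g s t) (\<Union>n. ?B n)"
    proof (rule SUP_emeasure_incseq)
      show "incseq ?B"
      proof (rule incseq_SucI)
        fix n
        have "inverse (real (Suc (Suc n))) \<le> inverse (real (Suc n))" by (simp add: field_simps)
        from order_trans[OF this] show "?B n \<subseteq> ?B (Suc n)" by (auto simp del: of_nat_Suc)
      qed
    qed (use B in auto)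
    also have "(\<Union>n. ?B n) = B - {0}"
    proof -
      have "\<exists>n. inverse (real (Suc n)) \<le> \<bar>y\<bar>" if "y \<noteq> 0" for y :: real
        using reals_Archimedean[of "\<bar>y\<bar>"] that by (auto intro: less_imp_le)
      then show ?thesis by (auto simp: not_le)
    qed
    also have "emeasure (jump_sizes g s t) (B - {0}) = emeasure (jump_sizes g s t) B"
      by (subst (1 2) emeasure_jump_sizes) (auto intro!: arg_cong[of _ _ "emeasure (count_space UNIV)"])
    finally show ?thesis by simp
  qed
  moreover have "(\<lambda>g. SUP n. emeasure (jump_sizes g s t) (?B n)) \<in> borel_measurable path_space"
    by (intro borel_measurable_SUP measurable_jump_sizes_away st) auto
  ultimately show ?thesis by (simp only:)
qed

lemma measurable_nn_integral_jump_sizes: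
  assumes st: "0 \<le> s" "s < t" and "H \<in> borel_measurable borel"
  shows "(\<lambda>g. \<integral>\<^sup>+y. H y \<partial>jump_sizes g s t) \<in> borel_measurable path_space"
  using assms(3)
proof (induction rule: borel_measurable_induct)
  case (cong f g)
  then have "f = g" by auto
  then show ?case using cong by simp
next
  case (set A)
  then show ?case using measurable_emeasure_jump_sizes[OF st, of A] by simp
next
  case (mult u c)
  have "(\<integral>\<^sup>+y. c * u y \<partial>jump_sizes g s t) = c * (\<integral>\<^sup>+y. u y \<partial>jump_sizes g s t)" for g
    using mult by (intro nn_integral_cmult) simp
  then show ?case using mult by simp
next
  case (add u v)
  have "(\<integral>\<^sup>+y. v y + u y \<partial>jump_sizes g s t) = (\<integral>\<^sup>+y. v y \<partial>jump_sizes g s t) + (\<integral>\<^sup>+y. u y \<partial>jump_sizes g s t)" for g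
    using add by (intro nn_integral_add) auto
  then show ?case using add by simp
next
  case (seq U)
  have "(\<integral>\<^sup>+y. (SUP i. U i) y \<partial>jump_sizes g s t) = (SUP i. \<integral>\<^sup>+y. U i y \<partial>jump_sizes g s t)" for g
    using seq by (simp add: SUP_apply image_comp nn_integral_monotone_convergence_SUP)
  then show ?case using seq by simp
qed

section \<open>Path segments of a Levy process\<close>

text \<open>The joint law of an i.i.d. family is a power of one measure, and such a product is
  invariant under permutations of its factors.\<close>

lemma prob_space_distr_swap:
  fixes \<xi> :: "nat \<Rightarrow> 'a \<Rightarrow> 'b"
  assumes "prob_space M" and ind: "prob_space.indep_vars M (\<lambda>_. N) \<xi> {..<m}"
    and id: "\<And>k. k < m \<Longrightarrow> distr M N (\<xi> k) = D" and p: "p permutes {..<m}" and "0 < m"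
  shows "distr M (\<Pi>\<^sub>M k\<in>{..<m}. N) (\<lambda>\<omega>. \<lambda>k\<in>{..<m}. \<xi> (p k) \<omega>) =
    distr M (\<Pi>\<^sub>M k\<in>{..<m}. N) (\<lambda>\<omega>. \<lambda>k\<in>{..<m}. \<xi> k \<omega>)"
proof -
  interpret prob_space M by fact
  have rv: "\<xi> k \<in> measurable M N" if "k < m" for k
    using ind that by (auto simp: indep_vars_def)
  have "prob_space D" using id[OF \<open>0 < m\<close>] rv[OF \<open>0 < m\<close>] prob_space_distr by metis
  have sD: "sets D = sets N" using id[OF \<open>0 < m\<close>] by (metis sets_distr)
  have pm: "p k < m" if "k < m" for k using permutes_in_image[OF p, of k] that by simp
  let ?\<xi> = "\<lambda>\<omega>. \<lambda>k\<in>{..<m}. \<xi> k \<omega>"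
  have "distr M (\<Pi>\<^sub>M k\<in>{..<m}. N) ?\<xi> = (\<Pi>\<^sub>M k\<in>{..<m}. distr M N (\<xi> k))"
    using ind rv \<open>0 < m\<close> by (subst (asm) indep_vars_iff_distr_eq_PiM') auto
  also have "\<dots> = (\<Pi>\<^sub>M k\<in>{..<m}. D)" by (intro PiM_cong) (auto simp: id)
  finally have *: "distr M (\<Pi>\<^sub>M k\<in>{..<m}. N) ?\<xi> = (\<Pi>\<^sub>M k\<in>{..<m}. D)" .
  have "(\<Pi>\<^sub>M k\<in>{..<m}. D) =
      distr (\<Pi>\<^sub>M k\<in>{..<m}. D) (\<Pi>\<^sub>M k\<in>{..<m}. D) (\<lambda>x. \<lambda>k\<in>{..<m}. x (p k))"
    using pm \<open>prob_space D\<close> by (intro distr_PiM_reindex[symmetric] permutes_inj_on[OF p]) auto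
  also have "\<dots> = distr (distr M (\<Pi>\<^sub>M k\<in>{..<m}. N) ?\<xi>) (\<Pi>\<^sub>M k\<in>{..<m}. N) (\<lambda>x. \<lambda>k\<in>{..<m}. x (p k))"
    unfolding * by (intro distr_cong sets_PiM_cong refl) (simp add: sD)
  also have "\<dots> = distr M (\<Pi>\<^sub>M k\<in>{..<m}. N) ((\<lambda>x. \<lambda>k\<in>{..<m}. x (p k)) \<circ> ?\<xi>)"
    using rv pm by (intro distr_distr measurable_restrict measurable_component_singleton) auto
  also have "(\<lambda>x. \<lambda>k\<in>{..<m}. x (p k)) \<circ> ?\<xi> = (\<lambda>\<omega>. \<lambda>k\<in>{..<m}. \<xi> (p k) \<omega>)"
    using pm by (auto simp: fun_eq_iff)
  finally show ?thesis using * by (simp only:)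
qed

text \<open>Clipping the time freezes the segment outside \<open>{0..l}\<close>. The result is a
  cadlag path on the whole half-line that depends only on the increments of \<open>Y\<close> over
  one cell and has the jumps of \<open>Y\<close> there, shifted to the origin.\<close>

lemma cadlag_segment:
  assumes Y: "cadlag Y" and a: "0 \<le> a" and l: "0 < l"
  shows "cadlag (\<lambda>r. Y (a + max 0 (min r l)) - Y a)"
    and "\<And>r. 0 < r \<Longrightarrow> r \<le> l \<Longrightarrow> path_jump (\<lambda>r. Y (a + max 0 (min r l)) - Y a) r = path_jump Y (a + r)"
proof -
  let ?W = "\<lambda>r. Y (a + max 0 (min r l)) - Y a"
  have right: "(?W \<longlongrightarrow> ?W r) (at_right r)" if r: "0 \<le> r" for r
  proof (cases "r < l")
    case True
    have "eventually (\<lambda>s. a + s \<in> {a + r<..} \<and> a + s \<noteq> a + r) (at_right r)"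
      by (rule eventually_at_rightI[of _ "r + 1"]) auto
    moreover have "((\<lambda>s. a + s) \<longlongrightarrow> a + r) (at_right r)" by (intro tendsto_intros)
    ultimately have *: "filterlim (\<lambda>s. a + s) (at_right (a + r)) (at_right r)"
      unfolding filterlim_at by simp
    have "(Y \<longlongrightarrow> Y (a + r)) (at_right (a + r))" using Y r a by (simp add: cadlag_def)
    from tendsto_diff[OF filterlim_compose[OF this *] tendsto_const]
    have "((\<lambda>s. Y (a + s) - Y a) \<longlongrightarrow> Y (a + r) - Y a) (at_right r)" .
    moreover have "eventually (\<lambda>s. Y (a + s) - Y a = ?W s) (at_right r)"
      using eventually_at_right_real[OF True] by eventually_elim (use r in auto)
    ultimately show ?thesis using True r by (auto elim: Lim_transform_eventually)
  next
    case False
    have "eventually (\<lambda>s. ?W r = ?W s) (at_right r)"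
      using eventually_at_right_less[of r] by eventually_elim (use False in auto)
    then show ?thesis by (intro Lim_transform_eventually[OF tendsto_const]) auto
  qed
  have left: "(?W \<longlongrightarrow> Y (a + r) - path_jump Y (a + r) - Y a) (at_left r)" if r: "0 < r" "r \<le> l" for r
  proof -
    have "eventually (\<lambda>s. a + s \<in> {..<a + r} \<and> a + s \<noteq> a + r) (at_left r)"
      by (rule eventually_at_leftI[of "r - 1"]) auto
    moreover have "((\<lambda>s. a + s) \<longlongrightarrow> a + r) (at_left r)" by (intro tendsto_intros)
    ultimately have "filterlim (\<lambda>s. a + s) (at_left (a + r)) (at_left r)"
      unfolding filterlim_at by simp
    from tendsto_diff[OF filterlim_compose[OF cadlag_tendsto_left[OF Y] this] tendsto_const, of "Y a"]
    have "((\<lambda>s. Y (a + s) - Y a) \<longlongrightarrow> Y (a + r) - path_jump Y (a + r) - Y a) (at_left r)"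
      using r a by simp
    moreover have "eventually (\<lambda>s. Y (a + s) - Y a = ?W s) (at_left r)"
      using eventually_at_left_real[OF r(1)] by eventually_elim (use r in auto)
    ultimately show ?thesis by (rule Lim_transform_eventually)
  qed
  show "cadlag ?W" unfolding cadlag_def
  proof (intro conjI allI impI)
    fix r :: real assume r: "0 < r"
    show "\<exists>L. (?W \<longlongrightarrow> L) (at_left r)"
    proof (cases "r \<le> l")
      case True
      then show ?thesis using left[OF r] by blast
    next
      case False
      then have "eventually (\<lambda>s. ?W r = ?W s) (at_left r)"
        using l by (intro eventually_at_leftI[of l]) auto
      from Lim_transform_eventually[OF tendsto_const this] show ?thesis by blast
    qed
  qed (use right in auto)
  fix r assume "0 < r" "r \<le> l"
  with path_jump_unique[OF left] show "path_jump ?W r = path_jump Y (a + r)" by simp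
qed

context levy_process
begin

text \<open>The set of all \<omega> with cadlag path is not known to be measurable, so some
  measurable set of full measure inside it is chosen.\<close>

definition cadlag_event :: "'a set" where
  "cadlag_event = (SOME G. G \<in> sets M \<and> prob G = 1 \<and> (\<forall>\<omega>\<in>G. cadlag (\<lambda>t. X t \<omega>)))"

text \<open>Off the event the path is zero, so that every path is cadlag, not just almost every one:
  a measurable map into \<open>path_space\<close> must take its values there everywhere.\<close>

definition version :: "real \<Rightarrow> 'a \<Rightarrow> real" where
  "version t \<omega> = (if \<omega> \<in> cadlag_event then X t \<omega> else 0)"

lemma cadlag_event:
  "cadlag_event \<in> sets M" "prob cadlag_event = 1" "\<And>\<omega>. \<omega> \<in> cadlag_event \<Longrightarrow> cadlag (\<lambda>t. X t \<omega>)"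
proof -
  obtain N where N: "N \<in> null_sets M" "{\<omega>\<in>space M. \<not> cadlag (\<lambda>t. X t \<omega>)} \<subseteq> N"
    using cadlag_paths by (auto elim!: AE_E simp: null_sets_def)
  have "emeasure M (space M - N) = 1"
    using N by (subst emeasure_Diff_null_set) (auto simp: emeasure_space_1)
  then have "\<exists>G. G \<in> sets M \<and> prob G = 1 \<and> (\<forall>\<omega>\<in>G. cadlag (\<lambda>t. X t \<omega>))"
    using N by (intro exI[of _ "space M - N"]) (auto simp: measure_def)
  from someI_ex[OF this]
  show "cadlag_event \<in> sets M" "prob cadlag_event = 1" "\<And>\<omega>. \<omega> \<in> cadlag_event \<Longrightarrow> cadlag (\<lambda>t. X t \<omega>)"
    unfolding cadlag_event_def by blast+
qed

lemma AE_cadlag_event: "AE \<omega> in M. \<omega> \<in> cadlag_event"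
  using cadlag_event(1,2) by (simp add: prob_eq_1)

lemma AE_version: "AE \<omega> in M. \<forall>t. version t \<omega> = X t \<omega>"
  using AE_cadlag_event by eventually_elim (simp add: version_def)

lemma measurable_version [measurable]: "0 \<le> t \<Longrightarrow> version t \<in> borel_measurable M"
  using cadlag_event(1) random_variable unfolding version_def by measurable

lemma cadlag_version: "cadlag (\<lambda>t. version t \<omega>)"
  using cadlag_event(3) by (cases "\<omega> \<in> cadlag_event") (auto simp: version_def cadlag_def)

text \<open>Independence is a property of the joint law, which does not see the null set on which
  \<open>version\<close> and \<open>X\<close> may differ.\<close>

lemma indep_increments_version:
  assumes \<tau>: "0 \<le> \<tau> (0::nat)" "mono_on {..n} \<tau>"
  shows "indep_vars (\<lambda>_. borel) (\<lambda>i \<omega>. version (\<tau> (Suc i)) \<omega> - version (\<tau> i) \<omega>) {..<n}"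
proof (cases "n = 0")
  case True
  then show ?thesis by (simp add: indep_vars_def indep_sets_def)
next
  case False
  have pos: "0 \<le> \<tau> i" if "i \<le> n" for i
    using \<tau> that monotone_onD[OF \<tau>(2), of 0 i] by auto
  have rvX: "(\<lambda>\<omega>. X (\<tau> (Suc i)) \<omega> - X (\<tau> i) \<omega>) \<in> borel_measurable M" if "i < n" for i
    using pos[of i] pos[of "Suc i"] that by (intro borel_measurable_diff random_variable) auto
  have rvY: "(\<lambda>\<omega>. version (\<tau> (Suc i)) \<omega> - version (\<tau> i) \<omega>) \<in> borel_measurable M" if "i < n" for i
    using pos[of i] pos[of "Suc i"] that by (intro borel_measurable_diff measurable_version) auto
  have "distr M (\<Pi>\<^sub>M i\<in>{..<n}. borel) (\<lambda>\<omega>. \<lambda>i\<in>{..<n}. version (\<tau> (Suc i)) \<omega> - version (\<tau> i) \<omega>) =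
      distr M (\<Pi>\<^sub>M i\<in>{..<n}. borel) (\<lambda>\<omega>. \<lambda>i\<in>{..<n}. X (\<tau> (Suc i)) \<omega> - X (\<tau> i) \<omega>)"
    using rvX rvY AE_version by (intro distr_cong_AE measurable_restrict refl) auto
  also have "\<dots> = (\<Pi>\<^sub>M i\<in>{..<n}. distr M borel (\<lambda>\<omega>. X (\<tau> (Suc i)) \<omega> - X (\<tau> i) \<omega>))"
    using independent_increments[OF \<tau>] rvX False
    by (subst (asm) indep_vars_iff_distr_eq_PiM') auto
  also have "\<dots> = (\<Pi>\<^sub>M i\<in>{..<n}. distr M borel (\<lambda>\<omega>. version (\<tau> (Suc i)) \<omega> - version (\<tau> i) \<omega>))"
    using rvX rvY AE_version by (intro PiM_cong distr_cong_AE refl) auto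
  finally show ?thesis
    using rvY False by (subst indep_vars_iff_distr_eq_PiM') auto
qed

lemma distr_increment_version:
  assumes "0 \<le> s" "s \<le> t"
  shows "distr M borel (\<lambda>\<omega>. version t \<omega> - version s \<omega>) = distr M borel (X (t - s))"
proof -
  have "distr M borel (\<lambda>\<omega>. version t \<omega> - version s \<omega>) = distr M borel (\<lambda>\<omega>. X t \<omega> - X s \<omega>)"
    using AE_version assms random_variable by (intro distr_cong_AE borel_measurable_diff measurable_version refl) auto
  then show ?thesis using stationary_increments[of s "t - s"] assms by simp
qed

definition segment :: "real \<Rightarrow> nat \<Rightarrow> 'a \<Rightarrow> real \<Rightarrow> real" where
  "segment l k \<omega> r = version (real k * l + max 0 (min r l)) \<omega> - version (real k * l) \<omega>"

lemma cadlag_segment_version: "0 < l \<Longrightarrow> cadlag (segment l k \<omega>)"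
  unfolding segment_def by (rule cadlag_segment(1)[OF cadlag_version]) auto

lemma path_jump_segment:
  "0 < r \<Longrightarrow> r \<le> l \<Longrightarrow> path_jump (segment l k \<omega>) r = path_jump (\<lambda>t. version t \<omega>) (real k * l + r)"
  unfolding segment_def by (rule cadlag_segment(2)[OF cadlag_version]) auto

lemma measurable_segment_component:
  "0 < l \<Longrightarrow> (\<lambda>\<omega>. segment l k \<omega> r) \<in> borel_measurable M"
  unfolding segment_def by (intro borel_measurable_diff measurable_version) auto

lemma measurable_segment_PiM: "0 < l \<Longrightarrow> segment l k \<in> measurable M (\<Pi>\<^sub>M t\<in>UNIV. borel)"
  using measurable_segment_component by (intro measurable_PiM_single') (auto simp: Pi_iff extensional_def)

lemma measurable_segment: "0 < l \<Longrightarrow> segment l k \<in> measurable M path_space"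
  unfolding path_space_def using cadlag_segment_version
  by (intro measurable_restrict_space2 measurable_segment_PiM) auto

text \<open>
  Finitely many values of a segment are partial sums of the increments over a fine common
  grid, so the independence and stationarity of increments carry over to segments.
\<close>

lemma segment_cylinder:
  assumes l: "0 < l" and J: "finite J"
  obtains n :: nat and V :: "nat \<Rightarrow> 'a \<Rightarrow> nat \<Rightarrow> real" and \<iota> :: "real \<Rightarrow> nat" where
    "\<And>r. r \<in> J \<Longrightarrow> \<iota> r \<le> n"
    "\<And>k \<omega> r. r \<in> J \<Longrightarrow> segment l k \<omega> r = (\<Sum>i<\<iota> r. V k \<omega> i)"
    "\<And>m. indep_vars (\<lambda>_. \<Pi>\<^sub>M i\<in>{..<n}. borel) V {..<m}"
    "\<And>k. distr M (\<Pi>\<^sub>M i\<in>{..<n}. borel) (V k) = distr M (\<Pi>\<^sub>M i\<in>{..<n}. borel) (V 0)"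
    "\<And>k. V k \<in> measurable M (\<Pi>\<^sub>M i\<in>{..<n}. borel)"
proof -
  define clip where "clip r = max 0 (min r l)" for r
  \<comment> \<open>Besides the clipped times of \<open>J\<close> the grid contains \<open>0\<close>
    and \<open>l\<close>, so that its copies in consecutive cells fit together without gaps.\<close>
  define S where "S = insert 0 (insert l (clip ` J))"
  have fS: "finite S" using J by (simp add: S_def)
  have S: "S \<subseteq> {0..l}" using l by (auto simp: S_def clip_def)
  define \<sigma> where "\<sigma> i = sorted_list_of_set S ! i" for i
  define n where "n = card S - 1"
  have "card {0, l} \<le> card S" using fS by (intro card_mono) (auto simp: S_def)
  then have cS: "card S = Suc n" "0 < n" using l by (auto simp: n_def)
  have len: "length (sorted_list_of_set S) = Suc n" using cS by simp
  have \<sigma>mono: "\<sigma> i \<le> \<sigma> j" if "i \<le> j" "j \<le> n" for i j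
    unfolding \<sigma>_def using that len by (intro sorted_nth_mono) auto
  have \<sigma>S: "\<sigma> i \<in> S" if "i \<le> n" for i
    using nth_mem[of i "sorted_list_of_set S"] that len fS by (simp add: \<sigma>_def)
  have \<sigma>ex: "\<exists>i\<le>n. \<sigma> i = s" if "s \<in> S" for s
    using that fS len unfolding \<sigma>_def by (metis in_set_conv_nth less_Suc_eq_le set_sorted_list_of_set)
  have \<sigma>0: "\<sigma> 0 = 0"
  proof -
    obtain i where "i \<le> n" "\<sigma> i = 0" using \<sigma>ex[of 0] by (auto simp: S_def)
    then have "\<sigma> 0 \<le> 0" using \<sigma>mono[of 0 i] by simp
    then show ?thesis using \<sigma>S[of 0] S by force
  qed
  have \<sigma>n: "\<sigma> n = l"
  proof -
    obtain i where "i \<le> n" "\<sigma> i = l" using \<sigma>ex[of l] by (auto simp: S_def)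
    then have "l \<le> \<sigma> n" using \<sigma>mono[of i n] by simp
    then show ?thesis using \<sigma>S[of n] S by force
  qed
  have \<sigma>pos: "0 \<le> \<sigma> i" if "i \<le> n" for i using \<sigma>S[OF that] S by auto
  define \<iota> where "\<iota> r = (SOME i. i \<le> n \<and> \<sigma> i = clip r)" for r
  have \<iota>: "\<iota> r \<le> n \<and> \<sigma> (\<iota> r) = clip r" if "r \<in> J" for r
  proof -
    have "clip r \<in> S" using that by (simp add: S_def)
    from someI_ex[OF \<sigma>ex[OF this]] show ?thesis by (simp add: \<iota>_def)
  qed
  define V where "V k \<omega> = (\<lambda>i\<in>{..<n}. version (real k * l + \<sigma> (Suc i)) \<omega> - version (real k * l + \<sigma> i) \<omega>)" for k \<omega>
  have rv: "(\<lambda>\<omega>. version (real k * l + \<sigma> (Suc i)) \<omega> - version (real k * l + \<sigma> i) \<omega>) \<in> borel_measurable M" if "i < n" for k i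
    using that l \<sigma>pos[of i] \<sigma>pos[of "Suc i"] by (intro borel_measurable_diff measurable_version) auto
  have rvV: "V k \<in> measurable M (\<Pi>\<^sub>M i\<in>{..<n}. borel)" for k
    unfolding V_def using rv by (intro measurable_restrict) auto
  show ?thesis
  proof (rule that[of \<iota> n V])
    fix r assume "r \<in> J" then show "\<iota> r \<le> n" using \<iota> by simp
  next
    fix k \<omega> r assume r: "r \<in> J"
    have "(\<Sum>i<\<iota> r. V k \<omega> i) = (\<Sum>i<\<iota> r. version (real k * l + \<sigma> (Suc i)) \<omega> - version (real k * l + \<sigma> i) \<omega>)"
      using \<iota>[OF r] by (intro sum.cong) (auto simp: V_def)
    also have "\<dots> = version (real k * l + clip r) \<omega> - version (real k * l) \<omega>"
      using sum_lessThan_telescope[of "\<lambda>i. version (real k * l + \<sigma> i) \<omega>" "\<iota> r"] \<iota>[OF r] \<sigma>0 by simp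
    finally show "segment l k \<omega> r = (\<Sum>i<\<iota> r. V k \<omega> i)" by (simp add: segment_def clip_def)
  next
    fix k
    show "V k \<in> measurable M (\<Pi>\<^sub>M i\<in>{..<n}. borel)" by (rule rvV)
    have law: "distr M (\<Pi>\<^sub>M i\<in>{..<n}. borel) (V k) = (\<Pi>\<^sub>M i\<in>{..<n}. distr M borel (X (\<sigma> (Suc i) - \<sigma> i)))" for k
    proof -
      have "indep_vars (\<lambda>_. borel) (\<lambda>i \<omega>. version (real k * l + \<sigma> (Suc i)) \<omega> - version (real k * l + \<sigma> i) \<omega>) {..<n}"
        using indep_increments_version[of "\<lambda>i. real k * l + \<sigma> i" n] l \<sigma>0 \<sigma>mono by (auto simp: mono_on_def)
      then have "distr M (\<Pi>\<^sub>M i\<in>{..<n}. borel) (V k) =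
          (\<Pi>\<^sub>M i\<in>{..<n}. distr M borel (\<lambda>\<omega>. version (real k * l + \<sigma> (Suc i)) \<omega> - version (real k * l + \<sigma> i) \<omega>))"
        unfolding V_def using rv \<open>0 < n\<close> by (subst (asm) indep_vars_iff_distr_eq_PiM') auto
      also have "\<dots> = (\<Pi>\<^sub>M i\<in>{..<n}. distr M borel (X (\<sigma> (Suc i) - \<sigma> i)))"
      proof (intro PiM_cong refl)
        fix i assume "i \<in> {..<n}"
        then show "distr M borel (\<lambda>\<omega>. version (real k * l + \<sigma> (Suc i)) \<omega> - version (real k * l + \<sigma> i) \<omega>) =
            distr M borel (X (\<sigma> (Suc i) - \<sigma> i))"
          using distr_increment_version[of "real k * l + \<sigma> i" "real k * l + \<sigma> (Suc i)"] l \<sigma>pos[of i]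
            \<sigma>mono[of i "Suc i"] by simp
      qed
      finally show ?thesis .
    qed
    show "distr M (\<Pi>\<^sub>M i\<in>{..<n}. borel) (V k) = distr M (\<Pi>\<^sub>M i\<in>{..<n}. borel) (V 0)"
      by (simp add: law)
  next
    fix m
    \<comment> \<open>The copies of the grid in all cells form one increasing sequence: index
      \<open>k * n + i\<close> with \<open>i < n\<close> is point \<open>i\<close> of cell
      \<open>k\<close>. The last point of a cell, \<open>\<sigma> n = l\<close>, is identified with
      the first point of the next one, \<open>\<sigma> 0 = 0\<close>.\<close>
    define \<tau> where "\<tau> j = real (j div n) * l + \<sigma> (j mod n)" for j
    have modn: "j mod n \<le> n" for j using \<open>0 < n\<close> by (simp add: less_imp_le)
    have \<tau>Suc: "\<tau> (Suc j) = real (j div n) * l + \<sigma> (Suc (j mod n))" for j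
    proof (cases "Suc (j mod n) = n")
      case True
      then have "Suc j mod n = 0" "Suc j div n = Suc (j div n)" by (auto simp: mod_Suc div_Suc)
      then show ?thesis using True \<sigma>0 \<sigma>n by (simp add: \<tau>_def algebra_simps)
    next
      case False
      then have "Suc j mod n = Suc (j mod n)" "Suc j div n = j div n" by (auto simp: mod_Suc div_Suc)
      then show ?thesis by (simp add: \<tau>_def)
    qed
    have "\<tau> j \<le> \<tau> (Suc j)" for j
    proof -
      have "j mod n < n" using \<open>0 < n\<close> by simp
      then show ?thesis unfolding \<tau>Suc using \<sigma>mono[of "j mod n" "Suc (j mod n)"] by (simp add: \<tau>_def)
    qed
    then have "mono \<tau>" by (simp add: mono_iff_le_Suc)
    then have ind: "indep_vars (\<lambda>_. borel) (\<lambda>j \<omega>. version (\<tau> (Suc j)) \<omega> - version (\<tau> j) \<omega>) {..<m * n}"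
      by (intro indep_increments_version) (auto simp: \<tau>_def \<sigma>0 mono_on_def dest: monoD)
    define K where "K k = {k * n..<k * n + n}" for k
    have K: "K k \<subseteq> {..<m * n}" if "k < m" for k
    proof -
      have "Suc k * n \<le> m * n" using that by (intro mult_le_mono) auto
      then show ?thesis by (auto simp: K_def)
    qed
    have Kdiv: "j div n = k" if "j \<in> K k" for j k
      using that \<open>0 < n\<close> unfolding K_def by (metis add.commute atLeastLessThan_iff div_nat_eqI mult.commute mult_Suc)
    have "disjoint_family_on K {..<m}"
      unfolding disjoint_family_on_def by (metis Kdiv disjoint_iff)
    from indep_vars_restrict[OF ind _ this, unfolded lessThan_iff, OF K]
    have "indep_vars (\<lambda>k. \<Pi>\<^sub>M j\<in>K k. borel) (\<lambda>k \<omega>. \<lambda>j\<in>K k. version (\<tau> (Suc j)) \<omega> - version (\<tau> j) \<omega>) {..<m}" by simp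
    from indep_vars_compose2[OF this, where N = "\<lambda>_. \<Pi>\<^sub>M i\<in>{..<n}. borel" and Y = "\<lambda>k x. \<lambda>i\<in>{..<n}. x (k * n + i)"]
    have "indep_vars (\<lambda>_. \<Pi>\<^sub>M i\<in>{..<n}. borel)
        (\<lambda>k \<omega>. \<lambda>i\<in>{..<n}. (\<lambda>j\<in>K k. version (\<tau> (Suc j)) \<omega> - version (\<tau> j) \<omega>) (k * n + i)) {..<m}"
      by (auto intro!: measurable_restrict measurable_component_singleton simp: K_def)
    moreover have "(\<lambda>i\<in>{..<n}. (\<lambda>j\<in>K k. version (\<tau> (Suc j)) \<omega> - version (\<tau> j) \<omega>) (k * n + i)) = V k \<omega>" for k \<omega>
    proof
      fix i
      show "(\<lambda>i\<in>{..<n}. (\<lambda>j\<in>K k. version (\<tau> (Suc j)) \<omega> - version (\<tau> j) \<omega>) (k * n + i)) i = V k \<omega> i"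
      proof (cases "i < n")
        case True
        then have "k * n + i \<in> K k" "(k * n + i) mod n = i" by (auto simp: K_def)
        then show ?thesis using True Kdiv[of "k * n + i" k] unfolding V_def \<tau>Suc by (simp add: \<tau>_def)
      qed (simp add: V_def)
    qed
    ultimately show "indep_vars (\<lambda>_. \<Pi>\<^sub>M i\<in>{..<n}. borel) V {..<m}" by simp
  qed
qed

lemma partial_sums_event:
  assumes J: "finite J" and \<iota>: "\<And>r. r \<in> J \<Longrightarrow> \<iota> r \<le> (n::nat)" and A: "\<And>r. r \<in> J \<Longrightarrow> A r \<in> sets borel"
  shows "{v \<in> space (\<Pi>\<^sub>M i\<in>{..<n}. borel). \<forall>r\<in>J. (\<Sum>i<\<iota> r. v i) \<in> A r} \<in> sets (\<Pi>\<^sub>M i\<in>{..<n}. (borel :: real measure))"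
proof (rule sets.sets_Collect_finite_All[OF _ J])
  fix r assume r: "r \<in> J"
  have "(\<lambda>v. \<Sum>i<\<iota> r. v i) \<in> borel_measurable (\<Pi>\<^sub>M i\<in>{..<n}. (borel :: real measure))"
    using \<iota>[OF r] by (intro borel_measurable_sum measurable_component_singleton) (auto intro: less_le_trans)
  from measurable_sets[OF this A[OF r]]
  show "{v \<in> space (\<Pi>\<^sub>M i\<in>{..<n}. borel). (\<Sum>i<\<iota> r. v i) \<in> A r} \<in> sets (\<Pi>\<^sub>M i\<in>{..<n}. (borel :: real measure))"
    by (simp add: vimage_def Int_def conj_commute)
qed

text \<open>It suffices to test cylinder sets, an intersection-stable generator. Finitely many
  cylinders involve finitely many times altogether; \<open>segment_cylinder\<close>, applied to the
  union of their time sets, turns them into events about the independent increment vectors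
  \<open>V\<close>.\<close>

lemma indep_segments_PiM:
  assumes l: "0 < l"
  shows "indep_vars (\<lambda>_. \<Pi>\<^sub>M t\<in>UNIV. borel) (segment l) {..<m}"
proof (cases "m = 0")
  case True
  then show ?thesis by (simp add: indep_vars_def indep_sets_def)
next
  case False
  let ?E = "prod_algebra UNIV (\<lambda>_::real. borel :: real measure)"
  have "prob (\<Inter>k\<in>{..<m}. segment l k -` A k \<inter> space M) = (\<Prod>k\<in>{..<m}. prob (segment l k -` A k \<inter> space M))"
    if A: "A \<in> {..<m} \<rightarrow> ?E" for A
  proof -
    have "\<forall>k\<in>{..<m}. \<exists>J E. finite J \<and> (\<forall>r\<in>J. E r \<in> sets borel) \<and> A k = prod_emb UNIV (\<lambda>_. borel) J (Pi\<^sub>E J E)"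
    proof
      fix k assume "k \<in> {..<m}"
      then have "A k \<in> ?E" using A by auto
      from prod_algebraE[OF this] show "\<exists>J E. finite J \<and> (\<forall>r\<in>J. E r \<in> sets borel) \<and> A k = prod_emb UNIV (\<lambda>_. borel) J (Pi\<^sub>E J E)"
        by metis
    qed
    then obtain J E where JE: "\<And>k. k < m \<Longrightarrow> finite (J k)" "\<And>k r. k < m \<Longrightarrow> r \<in> J k \<Longrightarrow> E k r \<in> sets borel"
      "\<And>k. k < m \<Longrightarrow> A k = prod_emb UNIV (\<lambda>_. borel) (J k) (Pi\<^sub>E (J k) (E k))"
      by (metis lessThan_iff)
    have fJ: "finite (\<Union>k<m. J k)" using JE(1) by auto
    obtain n V \<iota> where V: "\<And>r. r \<in> (\<Union>k<m. J k) \<Longrightarrow> \<iota> r \<le> (n::nat)"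
      "\<And>k \<omega> r. r \<in> (\<Union>k<m. J k) \<Longrightarrow> segment l k \<omega> r = (\<Sum>i<\<iota> r. V k \<omega> i)"
      "\<And>m. indep_vars (\<lambda>_. \<Pi>\<^sub>M i\<in>{..<n}. borel) V {..<m}"
      "\<And>k. V k \<in> measurable M (\<Pi>\<^sub>M i\<in>{..<n}. borel)"
      using segment_cylinder[OF l fJ] by metis
    define B where "B k = {v \<in> space (\<Pi>\<^sub>M i\<in>{..<n}. borel). \<forall>r\<in>J k. (\<Sum>i<\<iota> r. v i) \<in> E k r}" for k
    have B: "B k \<in> sets (\<Pi>\<^sub>M i\<in>{..<n}. borel)" if "k < m" for k
    proof -
      have "\<iota> r \<le> n" if "r \<in> J k" for r using V(1)[of r] that \<open>k < m\<close> by blast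
      then show ?thesis unfolding B_def using JE that by (intro partial_sums_event) auto
    qed
    have eq: "segment l k -` A k \<inter> space M = V k -` B k \<inter> space M" if k: "k < m" for k
    proof -
      have "segment l k \<omega> \<in> A k \<longleftrightarrow> (\<forall>r\<in>J k. segment l k \<omega> r \<in> E k r)" for \<omega>
        by (auto simp: JE(3)[OF k] prod_emb_def)
      moreover have "segment l k \<omega> r = (\<Sum>i<\<iota> r. V k \<omega> i)" if "r \<in> J k" for \<omega> r
        using that k by (intro V(2)) auto
      ultimately show ?thesis
        using measurable_space[OF V(4)[of k]] by (auto simp: B_def)
    qed
    have "prob (\<Inter>k\<in>{..<m}. V k -` B k \<inter> space M) = (\<Prod>k\<in>{..<m}. prob (V k -` B k \<inter> space M))"
      using False B by (intro indep_varsD_finite[OF V(3)]) auto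
    then show ?thesis using eq by simp
  qed
  then show ?thesis
    using False l by (subst indep_vars_finite[where E = "\<lambda>_. ?E"])
      (auto simp: sets_PiM space_PiM Int_stable_prod_algebra
          space_in_prod_algebra[where I = UNIV and M = "\<lambda>_. borel", simplified PiE_UNIV_domain space_borel Pi_UNIV]
        intro: measurable_segment_PiM dest: prod_algebra_sets_into_space[THEN subsetD])
qed

text \<open>Segments are cadlag everywhere, so the trace sigma-algebra has the same preimages under
  them as the product sigma-algebra.\<close>

lemma indep_segments:
  assumes l: "0 < l"
  shows "indep_vars (\<lambda>_. path_space) (segment l) {..<m}"
proof -
  have "{segment l k -` A \<inter> space M |A. A \<in> sets path_space} =
      {segment l k -` A \<inter> space M |A. A \<in> sets (\<Pi>\<^sub>M t\<in>UNIV. borel)}" for k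
  proof -
    have "segment l k -` ({g. cadlag g} \<inter> A) = segment l k -` A" for A
      using cadlag_segment_version[OF l] by auto
    then show ?thesis
      unfolding path_space_def sets_restrict_space Setcompr_eq_image image_image by simp
  qed
  then show ?thesis
    using indep_segments_PiM[OF l, of m] measurable_segment[OF l] by (simp add: indep_vars_def2)
qed

text \<open>The law on the product space is determined by cylinders, whose probabilities are those
  of increment vectors with a law independent of \<open>k\<close>. As segments are always cadlag,
  the equality passes to \<open>path_space\<close>.\<close>

lemma distr_segment:
  assumes l: "0 < l"
  shows "distr M path_space (segment l k) = distr M path_space (segment l 0)"
proof -
  let ?P = "\<Pi>\<^sub>M t\<in>(UNIV :: real set). (borel :: real measure)"
  have *: "distr M ?P (segment l k) = distr M ?P (segment l 0)"
  proof (rule measure_eqI_PiM_infinite)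
    fix A :: "real \<Rightarrow> real set" and J :: "real set"
    assume J: "finite J" and A: "\<And>r. r \<in> J \<Longrightarrow> A r \<in> sets borel"
    obtain n V \<iota> where V: "\<And>r. r \<in> J \<Longrightarrow> \<iota> r \<le> (n::nat)"
      "\<And>k \<omega> r. r \<in> J \<Longrightarrow> segment l k \<omega> r = (\<Sum>i<\<iota> r. V k \<omega> i)"
      "\<And>k. distr M (\<Pi>\<^sub>M i\<in>{..<n}. borel) (V k) = distr M (\<Pi>\<^sub>M i\<in>{..<n}. borel) (V 0)"
      "\<And>k. V k \<in> measurable M (\<Pi>\<^sub>M i\<in>{..<n}. borel)"
      using segment_cylinder[OF l J] by metis
    define B where "B = {v \<in> space (\<Pi>\<^sub>M i\<in>{..<n}. borel). \<forall>r\<in>J. (\<Sum>i<\<iota> r. v i) \<in> A r}"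
    have B: "B \<in> sets (\<Pi>\<^sub>M i\<in>{..<n}. borel)"
      unfolding B_def using J A V(1) by (intro partial_sums_event) auto
    let ?C = "prod_emb UNIV (\<lambda>_. borel) J (Pi\<^sub>E J A)"
    have C: "?C \<in> sets ?P" using J A by (intro sets_PiM_I) auto
    have "emeasure (distr M ?P (segment l k)) ?C = emeasure (distr M (\<Pi>\<^sub>M i\<in>{..<n}. borel) (V k)) B" for k
    proof -
      have "segment l k -` ?C \<inter> space M = V k -` B \<inter> space M"
      proof -
        have "segment l k \<omega> \<in> ?C \<longleftrightarrow> (\<forall>r\<in>J. segment l k \<omega> r \<in> A r)" for \<omega>
          by (auto simp: prod_emb_def)
        then show ?thesis
          using measurable_space[OF V(4)[of k]] V(2) by (auto simp: B_def)
      qed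
      then show ?thesis using B C V(4) measurable_segment_PiM[OF l] by (simp add: emeasure_distr)
    qed
    then show "emeasure (distr M ?P (segment l k)) ?C = emeasure (distr M ?P (segment l 0)) ?C"
      using V(3)[of k] by (simp only:)
  qed (auto intro!: prob_space.finite_measure prob_space_distr measurable_segment_PiM l)
  show ?thesis
  proof (rule measure_eqI)
    fix A assume A: "A \<in> sets (distr M path_space (segment l k))"
    then obtain A' where A': "A' \<in> sets ?P" "A = {g. cadlag g} \<inter> A'"
      by (auto simp: path_space_def sets_restrict_space)
    have "emeasure (distr M path_space (segment l k)) A = emeasure (distr M ?P (segment l k)) A'" for k
    proof -
      have "segment l k -` A = segment l k -` A'" using cadlag_segment_version[OF l] A' by auto
      then show ?thesis
        using A A' measurable_segment[OF l] measurable_segment_PiM[OF l] by (simp add: emeasure_distr)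
    qed
    then show "emeasure (distr M path_space (segment l k)) A = emeasure (distr M path_space (segment l 0)) A"
      using * by simp
  qed simp
qed

end

section \<open>Accumulation of jumps\<close>

lemma jump_sizes_cong_shift:
  assumes "\<And>r. r \<in> {s<..t} \<Longrightarrow> path_jump g r = path_jump g' (a + r)"
  shows "jump_sizes g s t = jump_sizes g' (a + s) (a + t)"
proof (rule measure_eqI)
  fix B assume "B \<in> sets (jump_sizes g s t)"
  then have B: "B \<in> sets borel" by simp
  let ?A = "{r \<in> {s<..t}. path_jump g r \<noteq> 0 \<and> path_jump g r \<in> B}"
  have "{r \<in> {a + s<..a + t}. path_jump g' r \<noteq> 0 \<and> path_jump g' r \<in> B} = (+) a ` ?A"
  proof (intro equalityI subsetI)
    fix r assume "r \<in> {r \<in> {a + s<..a + t}. path_jump g' r \<noteq> 0 \<and> path_jump g' r \<in> B}"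
    then have "r - a \<in> ?A" using assms[of "r - a"] by auto
    then show "r \<in> (+) a ` ?A" by (intro image_eqI[of _ _ "r - a"]) auto
  qed (use assms in auto)
  moreover have "emeasure (count_space UNIV) ((+) a ` A) = emeasure (count_space UNIV) A" for A
  proof -
    have inj: "inj_on ((+) a) A" by simp
    show ?thesis by (simp add: emeasure_count_space card_image[OF inj] finite_image_iff[OF inj])
  qed
  ultimately show "emeasure (jump_sizes g s t) B = emeasure (jump_sizes g' (a + s) (a + t)) B"
    by (simp only: emeasure_jump_sizes[OF B])
qed simp

lemma nn_integral_jump_sizes_add:
  assumes "s \<le> t" "t \<le> u" and [measurable]: "H \<in> borel_measurable borel"
  shows "(\<integral>\<^sup>+y. H y \<partial>jump_sizes g s u) = (\<integral>\<^sup>+y. H y \<partial>jump_sizes g s t) + (\<integral>\<^sup>+y. H y \<partial>jump_sizes g t u)"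
  unfolding nn_integral_jump_sizes[OF assms(3)]
  using assms(1,2) by (subst nn_integral_add[symmetric]) (auto intro!: nn_integral_cong simp: indicator_def)

context levy_process
begin

lemma jump_sizes_segment:
  assumes "0 < l" "0 \<le> s" "t \<le> l"
  shows "jump_sizes (segment l k \<omega>) s t = jump_sizes (\<lambda>t. version t \<omega>) (real k * l + s) (real k * l + t)"
  using assms by (intro jump_sizes_cong_shift path_jump_segment) auto

text \<open>Links two views of the same jumps: the short segments, which are i.i.d. and can be
  exchanged, and the single segment of length \<open>T\<close>, on which the pathwise analysis takes
  place.\<close>

lemma jump_sizes_segment_cell:
  assumes "0 < l" "real (Suc k) * l \<le> T"
  shows "jump_sizes (segment l k \<omega>) 0 l = jump_sizes (segment T 0 \<omega>) (real k * l) (real (Suc k) * l)"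
proof -
  have "0 < real (Suc k) * l" using assms by simp
  then show ?thesis
    using assms jump_sizes_segment[of l 0 l k \<omega>] jump_sizes_segment[of T "real k * l" "real (Suc k) * l" 0 \<omega>]
    by (simp add: algebra_simps)
qed

lemma jump_eq_path_jump_version:
  assumes "\<omega> \<in> cadlag_event"
  shows "jump X t \<omega> = path_jump (\<lambda>t. version t \<omega>) t"
  using assms by (simp add: jump_eq_path_jump version_def)

lemma emeasure_jump_sizes_UNIV_eq_0_iff:
  "emeasure (jump_sizes g s t) UNIV = 0 \<longleftrightarrow> {r \<in> {s<..t}. path_jump g r \<noteq> 0} = {}"
proof -
  have "{r \<in> {s<..t}. path_jump g r \<noteq> 0 \<and> path_jump g r \<in> UNIV} = {r \<in> {s<..t}. path_jump g r \<noteq> 0}" by auto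
  moreover have "(UNIV :: real set) \<in> sets borel" by simp
  ultimately show ?thesis
    by (simp add: emeasure_jump_sizes emeasure_count_space_eq_0 del: UNIV_I)
qed

text \<open>
  With \<open>q n\<close> the probability of no jump in an interval of length \<open>1 / n\<close>, there is no jump
  in \<open>(0, 1]\<close> with probability \<open>q n ^ n \<le> exp (- n * (1 - q n))\<close>, and \<open>n * (1 - q n)\<close>, the expected number
  of cells with a jump, is unbounded if \<open>\<nu>\<close> is infinite.
\<close>

lemma jumps_accumulate_at_zero:
  assumes \<nu>: "is_levy_measure M X \<nu>" "emeasure \<nu> (- {0}) = \<infinity>"
  shows "AE \<omega> in M. \<forall>e>0. \<exists>r\<in>{0<..e}. path_jump (\<lambda>t. version t \<omega>) r \<noteq> 0"
proof -
  define \<Omega>0 where "\<Omega>0 l = {g \<in> space path_space. emeasure (jump_sizes g 0 l) UNIV = 0}" for l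
  have \<Omega>0: "\<Omega>0 l \<in> sets path_space" if "0 < l" for l
  proof -
    have [measurable]: "(\<lambda>g. emeasure (jump_sizes g 0 l) UNIV) \<in> borel_measurable path_space"
      using that by (intro measurable_emeasure_jump_sizes) auto
    show ?thesis unfolding \<Omega>0_def by measurable
  qed
  define J where "J \<omega> = {r \<in> {0<..1}. path_jump (\<lambda>t. version t \<omega>) r \<noteq> 0}" for \<omega>
  define NJ where "NJ n k = segment (1 / real n) k -` \<Omega>0 (1 / real n) \<inter> space M" for n k
  have NJ_sets: "NJ n k \<in> sets M" if "0 < n" for n k
    unfolding NJ_def using that by (intro measurable_sets[OF measurable_segment] \<Omega>0) auto
  have NJ_iff: "\<omega> \<in> NJ n k \<longleftrightarrow> J \<omega> \<inter> grid_cell 0 1 n k = {}" if "k < n" "\<omega> \<in> space M" for \<omega> n k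
  proof -
    let ?l = "1 / real n"
    have l: "0 < ?l" "real (Suc k) * ?l \<le> 1" using that by (auto simp: field_simps)
    have cell: "grid_cell 0 1 n k = {real k * ?l<..real (Suc k) * ?l}" by (simp add: grid_cell_def)
    have "0 \<le> real k * ?l" by simp
    then have sub: "{real k * ?l<..real (Suc k) * ?l} \<subseteq> {0<..1}" using l(2) by (simp only: Ioc_subset_iff simp_thms)
    have "\<omega> \<in> NJ n k \<longleftrightarrow> emeasure (jump_sizes (segment ?l k \<omega>) 0 ?l) UNIV = 0"
      using that cadlag_segment_version[OF l(1)] by (simp add: NJ_def \<Omega>0_def)
    also have "jump_sizes (segment ?l k \<omega>) 0 ?l = jump_sizes (\<lambda>t. version t \<omega>) (real k * ?l) (real (Suc k) * ?l)"
      using jump_sizes_segment[OF l(1), of 0 ?l k \<omega>] by (simp add: algebra_simps add_divide_distrib)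
    also have "emeasure \<dots> UNIV = 0 \<longleftrightarrow> J \<omega> \<inter> grid_cell 0 1 n k = {}"
      unfolding emeasure_jump_sizes_UNIV_eq_0_iff cell J_def using sub by blast
    finally show ?thesis .
  qed
  have NJ_prob: "prob (NJ n k) = prob (NJ n 0)" if "0 < n" for n k
  proof -
    have l: "0 < 1 / real n" using that by simp
    have "prob (NJ n k) = measure (distr M path_space (segment (1 / real n) k)) (\<Omega>0 (1 / real n))" for k
      using l \<Omega>0 measurable_segment by (simp add: NJ_def measure_distr)
    then show ?thesis using distr_segment[OF l, of k] by (simp only:)
  qed
  define N0 where "N0 = {\<omega> \<in> space M. J \<omega> = {}}"
  have N0_eq: "N0 = (\<Inter>k\<in>{..<n}. NJ n k)" if "0 < n" for n
  proof (intro equalityI subsetI)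
    fix \<omega> assume "\<omega> \<in> N0" then show "\<omega> \<in> (\<Inter>k\<in>{..<n}. NJ n k)" by (auto simp: N0_def NJ_iff)
  next
    fix \<omega> assume \<omega>: "\<omega> \<in> (\<Inter>k\<in>{..<n}. NJ n k)"
    have "\<omega> \<in> NJ n 0" using \<omega> that by blast
    then have sp: "\<omega> \<in> space M" by (simp add: NJ_def)
    have "r \<notin> J \<omega>" for r
    proof
      assume r: "r \<in> J \<omega>"
      then have "r \<in> {0<..1}" by (simp add: J_def)
      from grid_cell_exists[OF this that] obtain k where "k < n" "r \<in> grid_cell 0 1 n k" .
      then show False using r \<omega> NJ_iff[of k n \<omega>] sp by blast
    qed
    then show "\<omega> \<in> N0" using sp by (auto simp: N0_def)
  qed
  have N0_prob: "prob N0 = prob (NJ n 0) ^ n" if "0 < n" for n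
  proof -
    have l: "0 < 1 / real n" using that by simp
    have "prob N0 = prob (\<Inter>k\<in>{..<n}. segment (1 / real n) k -` \<Omega>0 (1 / real n) \<inter> space M)"
      unfolding N0_eq[OF that] NJ_def by simp
    also have "\<dots> = (\<Prod>k\<in>{..<n}. prob (segment (1 / real n) k -` \<Omega>0 (1 / real n) \<inter> space M))"
      using that \<Omega>0[OF l] by (intro indep_varsD_finite[OF indep_segments[OF l]]) auto
    also have "\<dots> = (\<Prod>k\<in>{..<n}. prob (NJ n 0))"
      using NJ_prob[OF that] by (intro prod.cong) (auto simp: NJ_def)
    finally show ?thesis by simp
  qed
  have mean: "(\<integral>\<^sup>+\<omega>. emeasure (count_space UNIV) (J \<omega>) \<partial>M) = \<infinity>"
  proof -
    have "space (restrict_space borel (- {0::real})) = - {0}" by (simp add: space_restrict_space)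
    then have "- {0} \<in> sets (restrict_space borel (- {0::real}))" using sets.top by metis
    then have "- {0} \<in> sets \<nu>" using \<nu>(1) by (simp add: is_levy_measure_def)
    then have "\<infinity> = (\<integral>\<^sup>+\<omega>. emeasure (jump_measure X \<omega>) ({0<..1} \<times> (- {0})) \<partial>M)"
      using \<nu> by (simp add: is_levy_measure_def)
    also have "\<dots> = (\<integral>\<^sup>+\<omega>. emeasure (count_space UNIV) (J \<omega>) \<partial>M)"
    proof (rule nn_integral_cong_AE, use AE_cadlag_event in eventually_elim)
      case (elim \<omega>)
      have *: "{0<..1::real} \<times> (- {0::real}) \<in> sets (restrict_space borel ({0<..} \<times> (- {0})))"
      proof (subst sets_restrict_space_iff)
        have *: "A \<times> (- {0::real}) \<in> sets borel" if "A \<in> sets borel" for A :: "real set"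
          unfolding borel_prod[symmetric] using that by (intro pair_measureI) auto
        show "{0<..} \<times> (- {0::real}) \<inter> space borel \<in> sets (borel :: (real \<times> real) measure)"
          using *[of "{0<..}"] by simp
        show "{0<..1} \<times> (- {0}) \<subseteq> {0<..} \<times> (- {0}) \<and> {0<..1::real} \<times> (- {0::real}) \<in> sets borel"
          using *[of "{0<..1}"] by auto
      qed
      have "{t. 0 < t \<and> (t, jump X t \<omega>) \<in> {0<..1} \<times> (- {0})} = J \<omega>"
        using elim by (auto simp: J_def jump_eq_path_jump_version)
      then show ?case by (simp only: emeasure_jump_measure[OF *])
    qed
    finally show ?thesis by simp
  qed
  define c where "c n \<omega> = (\<Sum>k<n. indicator (space M - NJ n k) \<omega> :: ennreal)" for n \<omega>
  have c_meas: "c n \<in> borel_measurable M" for n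
    unfolding c_def using NJ_sets by (intro borel_measurable_sum borel_measurable_indicator sets.compl_sets) auto
  have c_int: "(\<integral>\<^sup>+\<omega>. c n \<omega> \<partial>M) = ennreal (real n * (1 - prob (NJ n 0)))" if "0 < n" for n
  proof -
    have "(\<integral>\<^sup>+\<omega>. c n \<omega> \<partial>M) = (\<Sum>k<n. emeasure M (space M - NJ n k))"
      unfolding c_def using NJ_sets[OF that] by (subst nn_integral_sum) auto
    also have "\<dots> = (\<Sum>k<n. ennreal (1 - prob (NJ n 0)))"
      using NJ_sets[OF that] NJ_prob[OF that]
      by (intro sum.cong refl) (simp add: emeasure_eq_measure prob_compl)
    finally show ?thesis
      by (simp add: ennreal_of_nat_eq_real_of_nat ennreal_mult[symmetric])
  qed
  have "emeasure (count_space UNIV) (J \<omega>) = liminf (\<lambda>n. c n \<omega>)" if "\<omega> \<in> space M" for \<omega>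
  proof -
    have "emeasure (count_space UNIV) (J \<omega>) =
        liminf (\<lambda>n. of_nat (card {k\<in>{..<n}. J \<omega> \<inter> grid_cell 0 1 n k \<noteq> {}}))"
      by (rule liminf_card_cells[symmetric]) (auto simp: J_def)
    also have "(\<lambda>n. of_nat (card {k\<in>{..<n}. J \<omega> \<inter> grid_cell 0 1 n k \<noteq> {}})) = (\<lambda>n. c n \<omega>)"
    proof
      fix n
      have "c n \<omega> = (\<Sum>k<n. if J \<omega> \<inter> grid_cell 0 1 n k \<noteq> {} then 1 else 0)"
        unfolding c_def using NJ_iff[of _ n \<omega>] that by (intro sum.cong) (auto simp: indicator_def)
      then show "of_nat (card {k\<in>{..<n}. J \<omega> \<inter> grid_cell 0 1 n k \<noteq> {}}) = c n \<omega>"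
        by (simp add: sum.If_cases Int_def)
    qed
    finally show ?thesis .
  qed
  \<comment> \<open>Fatou's lemma transfers the infinite expectation from the number of jumps to the
    numbers of occupied cells.\<close>
  then have "\<infinity> = (\<integral>\<^sup>+\<omega>. liminf (\<lambda>n. c n \<omega>) \<partial>M)"
    using mean by (simp cong: nn_integral_cong)
  also have "\<dots> \<le> liminf (\<lambda>n. \<integral>\<^sup>+\<omega>. c n \<omega> \<partial>M)" by (intro nn_integral_liminf c_meas)
  finally have inf: "liminf (\<lambda>n. \<integral>\<^sup>+\<omega>. c n \<omega> \<partial>M) = \<infinity>" by (simp add: top_unique)
  have N0_0: "prob N0 = 0"
  proof (rule ccontr)
    assume "prob N0 \<noteq> 0"
    then have pos: "0 < prob N0" by (simp add: zero_less_measure_iff)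
    have "(\<integral>\<^sup>+\<omega>. c n \<omega> \<partial>M) \<le> ennreal (- ln (prob N0))" if "0 < n" for n
    proof -
      have "prob N0 \<le> exp (- (1 - prob (NJ n 0))) ^ n"
        unfolding N0_prob[OF that] using exp_ge_add_one_self[of "- (1 - prob (NJ n 0))"] by (intro power_mono) auto
      also have "\<dots> = exp (- (real n * (1 - prob (NJ n 0))))"
        by (simp only: exp_of_nat_mult[symmetric] mult_minus_right)
      finally have "ln (prob N0) \<le> - (real n * (1 - prob (NJ n 0)))"
        using pos by (metis exp_gt_zero ln_exp ln_le_cancel_iff)
      then show ?thesis unfolding c_int[OF that] by (intro ennreal_leI) simp
    qed
    then have "liminf (\<lambda>n. \<integral>\<^sup>+\<omega>. c n \<omega> \<partial>M) \<le> liminf (\<lambda>n. ennreal (- ln (prob N0)))"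
      by (intro Liminf_mono eventually_mono[OF eventually_gt_at_top[of 0]])
    with inf show False by (simp add: Liminf_const top_unique)
  qed
  \<comment> \<open>The power \<open>prob (NJ n 0) ^ n\<close> vanishes, hence so does its base, for
    every \<open>n\<close>. This takes the statement from \<open>(0, 1]\<close> to arbitrarily short
    intervals at 0.\<close>
  have "AE \<omega> in M. \<forall>n. \<omega> \<notin> NJ (Suc n) 0"
  proof (subst AE_all_countable, rule allI)
    fix n
    have "prob (NJ (Suc n) 0) = 0" using N0_prob[of "Suc n"] N0_0 by auto
    then show "AE \<omega> in M. \<omega> \<notin> NJ (Suc n) 0"
      using NJ_sets[of "Suc n" 0] by (simp add: prob_eq_0)
  qed
  with AE_space show ?thesis
  proof eventually_elim
    case (elim \<omega>)
    show ?case
    proof (intro allI impI)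
      fix e :: real assume "0 < e"
      then obtain n where n: "inverse (real (Suc n)) < e" using reals_Archimedean by blast
      have "J \<omega> \<inter> grid_cell 0 1 (Suc n) 0 \<noteq> {}" using elim NJ_iff[of 0 "Suc n" \<omega>] by auto
      then obtain r where "r \<in> J \<omega>" "r \<in> grid_cell 0 1 (Suc n) 0" by blast
      then have "r \<in> {0<..e}" "path_jump (\<lambda>t. version t \<omega>) r \<noteq> 0"
        using n by (auto simp: J_def grid_cell_def inverse_eq_divide)
      then show "\<exists>r\<in>{0<..e}. path_jump (\<lambda>t. version t \<omega>) r \<noteq> 0" by blast
    qed
  qed
qed

end

section \<open>The Euler scheme driven by the jumps\<close>

text \<open>The exact solution follows the Euler recursion with noise
  \<open>?b k + \<rho> k\<close>, where \<open>\<rho> k\<close> is the error of freezing the drift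
  over a cell. As the solution jumps, a single \<open>\<rho> k\<close> need not be of order
  \<open>\<eta>\<close> squared; but it is at most \<open>\<eta> * L\<close> times the oscillation
  over the cell, and the oscillations, bounded by means of the variation \<open>V\<close>, have a
  sum independent of the grid. So the total error is of order \<open>\<eta>\<close>.\<close>

lemma euler_tendsto_solution:
  fixes f z J V :: "real \<Rightarrow> real"
  assumes T: "0 < T" and lip: "\<And>u v. \<bar>f u - f v\<bar> \<le> L * \<bar>u - v\<bar>"
    and int: "set_integrable lborel {0..T} (\<lambda>s. f (z s))"
    and z: "\<And>t. t \<in> {0..T} \<Longrightarrow> z t = x + (LINT s:{0..t}|lborel. f (z s)) + J t"
    and JV: "\<And>s t. 0 \<le> s \<Longrightarrow> s \<le> t \<Longrightarrow> t \<le> T \<Longrightarrow> \<bar>J t - J s\<bar> \<le> V t - V s"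
    and J0: "J 0 = 0"
  shows "(\<lambda>m. euler f (T / real m) x (\<lambda>k. J (real (Suc k) * (T / real m)) - J (real k * (T / real m))) m)
    \<longlonglongrightarrow> z T"
proof -
  have L: "0 \<le> L" using lip[of 1 0] by simp
  let ?g = "\<lambda>s. f (z s)"
  have sint: "set_integrable lborel {0..t} ?g" if "t \<le> T" for t
    using that by (intro set_integrable_subset[OF int]) auto
  have hk: "?g integrable_on {s..t}" if "0 \<le> s" "t \<le> T" for s t
  proof -
    have "?g integrable_on {0..T}" by (rule set_borel_integral_eq_integral(1)[OF int])
    moreover have "{s..t} \<subseteq> {0..T}" using that by auto
    ultimately show ?thesis by (rule integrable_subinterval_real)
  qed
  have zint: "z t = x + integral {0..t} ?g + J t" if "t \<in> {0..T}" for t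
    using z[OF that] set_borel_integral_eq_integral(2)[OF sint[of t]] that by simp
  have zdiff: "z t - z s = integral {s..t} ?g + (J t - J s)" if "0 \<le> s" "s \<le> t" "t \<le> T" for s t
    using Henstock_Kurzweil_Integration.integral_combine[of 0 s t ?g] that zint[of s] zint[of t] hk[of 0 t] by simp
  have "continuous_on {0..T} (\<lambda>t. integral {0..t} ?g)"
    by (intro indefinite_integral_continuous_1 hk) auto
  then have "bounded ((\<lambda>t. integral {0..t} ?g) ` {0..T})"
    by (intro compact_imp_bounded compact_continuous_image) auto
  then obtain B where B: "\<And>t. t \<in> {0..T} \<Longrightarrow> \<bar>integral {0..t} ?g\<bar> \<le> B"
    unfolding bounded_iff by (metis image_eqI real_norm_def)
  have zb: "\<bar>z t\<bar> \<le> \<bar>x\<bar> + B + (V T - V 0)" if t: "t \<in> {0..T}" for t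
    using zint[OF t] B[OF t] JV[of 0 t] JV[of t T] J0 t by (auto simp: abs_le_iff)
  define C where "C = \<bar>f 0\<bar> + L * (\<bar>x\<bar> + B + (V T - V 0))"
  have C: "\<bar>f (z t)\<bar> \<le> C" if "t \<in> {0..T}" for t
  proof -
    have "\<bar>f (z t)\<bar> \<le> \<bar>f 0\<bar> + L * \<bar>z t\<bar>" using lip[of "z t" 0] by simp
    also have "\<dots> \<le> C" unfolding C_def using zb[OF that] L by (intro add_left_mono mult_left_mono)
    finally show ?thesis .
  qed
  have C0: "0 \<le> C" using C[of 0] T by auto
  have zosc: "\<bar>z t - z s\<bar> \<le> C * (t - s) + (V t - V s)" if "0 \<le> s" "s \<le> t" "t \<le> T" for s t
  proof -
    have "norm (integral {s..t} ?g) \<le> integral {s..t} (\<lambda>_. C)"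
      using that by (intro integral_norm_bound_integral hk) (auto intro!: C)
    then show ?thesis using zdiff[OF that] JV[OF that] that by (simp add: mult.commute)
  qed
  have err: "\<bar>z T - euler f (T / real m) x (\<lambda>k. J (real (Suc k) * (T / real m)) - J (real k * (T / real m))) m\<bar>
      \<le> exp (T * L) * (T / real m * L * (C * T + (V T - V 0)))" if m: "0 < m" for m
  proof -
    define \<eta> where "\<eta> = T / real m"
    have \<eta>: "0 < \<eta>" "real m * \<eta> = T" using m T by (auto simp: \<eta>_def)
    let ?t = "\<lambda>k. real k * \<eta>"
    have tT: "?t k \<le> T" if "k \<le> m" for k
      using mult_right_mono[of "real k" "real m" \<eta>] that \<eta> by simp
    have t0: "0 \<le> ?t k" for k using \<eta> by simp
    have tS: "?t k \<le> ?t (Suc k)" for k using \<eta> by (intro mult_right_mono) auto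
    have tS': "?t (Suc k) - ?t k = \<eta>" for k by (simp add: algebra_simps)
    define \<rho> where "\<rho> k = integral {?t k..?t (Suc k)} ?g - \<eta> * f (z (?t k))" for k
    have \<rho>: "\<bar>\<rho> k\<bar> \<le> \<eta> * L * (C * \<eta> + (V (?t (Suc k)) - V (?t k)))" if k: "k < m" for k
    proof -
      have T': "?t (Suc k) \<le> T" using tT[of "Suc k"] k by simp
      let ?c = "f (z (?t k))"
      have "integral {?t k..?t (Suc k)} (\<lambda>s. ?g s - ?c) = integral {?t k..?t (Suc k)} ?g - integral {?t k..?t (Suc k)} (\<lambda>_. ?c)"
        by (intro Henstock_Kurzweil_Integration.integral_diff hk[OF t0 T']) auto
      then have "\<rho> k = integral {?t k..?t (Suc k)} (\<lambda>s. ?g s - ?c)"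
        unfolding \<rho>_def using tS[of k] tS'[of k] by simp
      also have "norm \<dots> \<le> integral {?t k..?t (Suc k)} (\<lambda>_. L * (C * \<eta> + (V (?t (Suc k)) - V (?t k))))"
      proof (rule integral_norm_bound_integral)
        show "(\<lambda>s. ?g s - ?c) integrable_on {?t k..?t (Suc k)}"
          by (intro integrable_diff hk[OF t0 T']) auto
        fix s assume s: "s \<in> {?t k..?t (Suc k)}"
        have "\<bar>z s - z (?t k)\<bar> \<le> C * (s - ?t k) + (V s - V (?t k))"
          using zosc[of "?t k" s] s t0[of k] T' by auto
        also have "\<dots> \<le> C * \<eta> + (V (?t (Suc k)) - V (?t k))"
        proof -
          have "C * (s - ?t k) \<le> C * \<eta>" using s tS'[of k] C0 by (intro mult_left_mono) auto
          moreover have "V s \<le> V (?t (Suc k))" using JV[of s "?t (Suc k)"] s t0[of k] T' by auto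
          ultimately show ?thesis by linarith
        qed
        finally show "norm (?g s - ?c) \<le> L * (C * \<eta> + (V (?t (Suc k)) - V (?t k)))"
          using lip[of "z s" "z (?t k)"] L by (auto intro: order_trans mult_left_mono)
      qed auto
      also have "\<dots> = \<eta> * L * (C * \<eta> + (V (?t (Suc k)) - V (?t k)))"
        using tS[of k] tS'[of k] by (simp add: mult.assoc)
      finally show ?thesis by simp
    qed
    let ?b = "\<lambda>k. J (?t (Suc k)) - J (?t k)"
    have exact: "z (?t k) = euler f \<eta> x (\<lambda>k. ?b k + \<rho> k) k" if "k \<le> m" for k using that
    proof (induction k)
      case 0
      then show ?case using zint[of 0] T J0 by simp
    next
      case (Suc k)
      then show ?case using zdiff[OF t0[of k] tS[of k] tT[of "Suc k"]] by (simp add: \<rho>_def)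
    qed
    have "\<bar>z T - euler f \<eta> x ?b m\<bar> = \<bar>euler f \<eta> x (\<lambda>k. ?b k + \<rho> k) m - euler f \<eta> x ?b m\<bar>"
      using exact[of m] \<eta> by simp
    also have "\<dots> \<le> (1 + \<eta> * L) ^ m * (\<Sum>k<m. \<bar>?b k + \<rho> k - ?b k\<bar>)"
      using \<eta> by (intro euler_upper_stability[OF lip]) auto
    also have "\<dots> \<le> exp (\<eta> * L) ^ m * (\<Sum>k<m. \<eta> * L * (C * \<eta> + (V (?t (Suc k)) - V (?t k))))"
      using \<rho> L \<eta> by (intro mult_mono power_mono exp_ge_add_one_self sum_mono sum_nonneg) auto
    also have "exp (\<eta> * L) ^ m = exp (T * L)"
      using \<eta>(2) by (simp add: exp_of_nat_mult[symmetric] mult.assoc[symmetric])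
    also have "(\<Sum>k<m. \<eta> * L * (C * \<eta> + (V (?t (Suc k)) - V (?t k)))) = \<eta> * L * (C * T + (V T - V 0))"
    proof -
      have "(\<Sum>k<m. V (?t (Suc k)) - V (?t k)) = V T - V 0"
        using sum_lessThan_telescope[of "\<lambda>k. V (?t k)" m] \<eta>(2) by simp
      moreover have "(\<Sum>k<m. C * \<eta>) = C * T" using \<eta>(2) by (simp add: algebra_simps)
      ultimately show ?thesis by (simp only: sum_distrib_left[symmetric] sum.distrib)
    qed
    finally show ?thesis unfolding \<eta>_def .
  qed
  have "(\<lambda>m. exp (T * L) * (T / real m * L * (C * T + (V T - V 0)))) \<longlonglongrightarrow> exp (T * L) * (0 * L * (C * T + (V T - V 0)))"
    by (intro tendsto_intros lim_const_over_n)
  then have lim: "(\<lambda>m. exp (T * L) * (T / real m * L * (C * T + (V T - V 0)))) \<longlonglongrightarrow> 0" by simp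
  have "(\<lambda>m. euler f (T / real m) x (\<lambda>k. J (real (Suc k) * (T / real m)) - J (real k * (T / real m))) m - z T)
      \<longlonglongrightarrow> 0"
    by (rule Lim_null_comparison[OF eventually_mono[OF eventually_gt_at_top[of 0]] lim])
      (use err in \<open>simp add: abs_minus_commute\<close>)
  then show ?thesis by (rule LIM_zero_cancel)
qed

section \<open>Integrals over the jumps of one path\<close>

definition jump_pos :: "(real \<Rightarrow> real) \<Rightarrow> (real \<Rightarrow> real) \<Rightarrow> real \<Rightarrow> real \<Rightarrow> ennreal" where
  "jump_pos h g s t = (\<integral>\<^sup>+y. ennreal (h y) \<partial>jump_sizes g s t)"

text \<open>The coercion \<open>ennreal\<close> cuts negative values off, so the two terms are the
  integrals of the positive and the negative part of \<open>h\<close>. Since \<open>enn2real\<close>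
  maps infinity to 0, the difference is the integral of \<open>h\<close> only if both are finite,
  which \<open>finite_variation_jumps\<close> provides. The unconditional definition is measurable
  in \<open>g\<close>.\<close>

definition jump_incr :: "(real \<Rightarrow> real) \<Rightarrow> (real \<Rightarrow> real) \<Rightarrow> real \<Rightarrow> real \<Rightarrow> real" where
  "jump_incr h g s t = enn2real (jump_pos h g s t) - enn2real (jump_pos (\<lambda>y. - h y) g s t)"

definition jump_var :: "(real \<Rightarrow> real) \<Rightarrow> (real \<Rightarrow> real) \<Rightarrow> real \<Rightarrow> real \<Rightarrow> real" where
  "jump_var h g s t = enn2real (jump_pos h g s t) + enn2real (jump_pos (\<lambda>y. - h y) g s t)"

definition big_jumps :: "(real \<Rightarrow> real) \<Rightarrow> real \<Rightarrow> (real \<Rightarrow> real) \<Rightarrow> real \<Rightarrow> real \<Rightarrow> ennreal" where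
  "big_jumps h c g s t = emeasure (jump_sizes g s t) {y. c < \<bar>h y\<bar>}"

lemma abs_jump_incr_le: "\<bar>jump_incr h g s t\<bar> \<le> jump_var h g s t"
  using enn2real_nonneg[of "jump_pos h g s t"] enn2real_nonneg[of "jump_pos (\<lambda>y. - h y) g s t"]
  unfolding jump_incr_def jump_var_def by linarith

lemma measurable_jump_functionals:
  assumes "0 < l" and [measurable]: "h \<in> borel_measurable borel"
  shows "(\<lambda>g. jump_incr h g 0 l) \<in> borel_measurable path_space"
    and "(\<lambda>g. jump_var h g 0 l) \<in> borel_measurable path_space"
    and "(\<lambda>g. big_jumps h c g 0 l) \<in> borel_measurable path_space"
proof -
  have [measurable]: "(\<lambda>g. jump_pos h g 0 l) \<in> borel_measurable path_space"
    "(\<lambda>g. jump_pos (\<lambda>y. - h y) g 0 l) \<in> borel_measurable path_space"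
    unfolding jump_pos_def using assms by (auto intro!: measurable_nn_integral_jump_sizes)
  show "(\<lambda>g. jump_incr h g 0 l) \<in> borel_measurable path_space"
    "(\<lambda>g. jump_var h g 0 l) \<in> borel_measurable path_space"
    unfolding jump_incr_def jump_var_def by measurable
  show "(\<lambda>g. big_jumps h c g 0 l) \<in> borel_measurable path_space"
    unfolding big_jumps_def using assms by (intro measurable_emeasure_jump_sizes) auto
qed

text \<open>Holds on almost every path by the integrability that \<open>solves_sde\<close>
  includes.\<close>

locale finite_variation_jumps =
  fixes h g :: "real \<Rightarrow> real" and T :: real
  assumes h [measurable]: "h \<in> borel_measurable borel"
    and finite_pos: "jump_pos h g 0 T < \<infinity>" and finite_neg: "jump_pos (\<lambda>y. - h y) g 0 T < \<infinity>"
begin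

lemma jump_pos_add:
  assumes "s \<le> t" "t \<le> u"
  shows "jump_pos h g s u = jump_pos h g s t + jump_pos h g t u"
    "jump_pos (\<lambda>y. - h y) g s u = jump_pos (\<lambda>y. - h y) g s t + jump_pos (\<lambda>y. - h y) g t u"
  unfolding jump_pos_def by (intro nn_integral_jump_sizes_add assms; measurable)+

lemma finite_sub:
  assumes "0 \<le> s" "s \<le> t" "t \<le> T"
  shows "jump_pos h g s t < \<infinity>" "jump_pos (\<lambda>y. - h y) g s t < \<infinity>"
  using assms finite_pos finite_neg jump_pos_add[of 0 s T] jump_pos_add[of s t T] by auto

lemma jump_incr_add:
  assumes "0 \<le> s" "s \<le> t" "t \<le> u" "u \<le> T"
  shows "jump_incr h g s u = jump_incr h g s t + jump_incr h g t u"
  using assms finite_sub[of s t] finite_sub[of t u]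
  by (simp add: jump_incr_def jump_pos_add[of s t u] enn2real_plus)

lemma jump_var_add:
  assumes "0 \<le> s" "s \<le> t" "t \<le> u" "u \<le> T"
  shows "jump_var h g s u = jump_var h g s t + jump_var h g t u"
  using assms finite_sub[of s t] finite_sub[of t u]
  by (simp add: jump_var_def jump_pos_add[of s t u] enn2real_plus)

lemma jump_empty: "jump_incr h g s s = 0" "jump_var h g s s = 0"
  by (simp_all add: jump_incr_def jump_var_def jump_pos_def nn_integral_jump_sizes)

lemma jump_var_grid:
  assumes "0 \<le> l" "real n * l \<le> T"
  shows "(\<Sum>k<n. jump_var h g (real k * l) (real (Suc k) * l)) = jump_var h g 0 (real n * l)"
  using assms(2)
proof (induction n)
  case 0
  then show ?case by (simp add: jump_empty)
next
  case (Suc n)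
  have "real n * l \<le> real (Suc n) * l" using \<open>0 \<le> l\<close> by (intro mult_right_mono) auto
  then show ?case using Suc \<open>0 \<le> l\<close> jump_var_add[of 0 "real n * l" "real (Suc n) * l"] by simp
qed

end

text \<open>Dominated convergence in the sum over jump times, with the sum over all of
  \<open>(0, T]\<close> as majorant. Pointwise convergence only asks whether a fixed time finally
  belongs to the intervals.\<close>

lemma nn_integral_jump_sizes_shrink:
  assumes [measurable]: "H \<in> borel_measurable borel" and fin: "(\<integral>\<^sup>+y. H y \<partial>jump_sizes g 0 T) < \<infinity>"
    and st: "\<And>n. 0 \<le> s n" "\<And>n. t n \<le> T"
    and lim: "\<And>r. eventually (\<lambda>n. r \<in> {s n<..t n} \<longleftrightarrow> r \<in> A) sequentially"
  shows "(\<lambda>n. \<integral>\<^sup>+y. H y \<partial>jump_sizes g (s n) (t n)) \<longlonglongrightarrow>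
    (\<integral>\<^sup>+r. H (path_jump g r) * indicator {r \<in> A. path_jump g r \<noteq> 0} r \<partial>count_space UNIV)"
  unfolding nn_integral_jump_sizes[OF assms(1)]
proof (rule nn_integral_dominated_convergence)
  show "(\<integral>\<^sup>+r. H (path_jump g r) * indicator {r \<in> {0<..T}. path_jump g r \<noteq> 0} r \<partial>count_space UNIV) < \<infinity>"
    using fin by (simp only: nn_integral_jump_sizes[OF assms(1)])
  show "AE r in count_space UNIV. H (path_jump g r) * indicator {r \<in> {s n<..t n}. path_jump g r \<noteq> 0} r \<le>
      H (path_jump g r) * indicator {r \<in> {0<..T}. path_jump g r \<noteq> 0} r" for n
    using st[of n] by (auto simp: indicator_def)
  show "AE r in count_space UNIV.
      (\<lambda>n. H (path_jump g r) * indicator {r \<in> {s n<..t n}. path_jump g r \<noteq> 0} r) \<longlonglongrightarrow>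
      H (path_jump g r) * indicator {r \<in> A. path_jump g r \<noteq> 0} r"
  proof (rule AE_I2)
    fix r
    show "(\<lambda>n. H (path_jump g r) * indicator {r \<in> {s n<..t n}. path_jump g r \<noteq> 0} r) \<longlonglongrightarrow>
        H (path_jump g r) * indicator {r \<in> A. path_jump g r \<noteq> 0} r"
      by (rule tendsto_eventually, rule eventually_mono[OF lim[of r]]) (auto simp: indicator_def)
  qed
qed simp_all

context finite_variation_jumps
begin

text \<open>Other jumps, even infinitely many, may share each interval with \<open>\<tau>\<close>;
  their contribution vanishes in the limit.\<close>

lemma jump_incr_shrink:
  assumes st: "\<And>n. 0 \<le> s n" "\<And>n. t n \<le> T" "\<And>n. \<tau> \<in> {s n<..t n}"
    and lim: "(\<lambda>n. t n - s n) \<longlonglongrightarrow> 0" and jump: "path_jump g \<tau> \<noteq> 0"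
  shows "(\<lambda>n. jump_incr h g (s n) (t n)) \<longlonglongrightarrow> h (path_jump g \<tau>)"
proof -
  have ev: "eventually (\<lambda>n. r \<in> {s n<..t n} \<longleftrightarrow> r \<in> {\<tau>}) sequentially" for r
  proof (cases "r = \<tau>")
    case False
    then have "eventually (\<lambda>n. t n - s n < \<bar>r - \<tau>\<bar>) sequentially"
      using lim by (intro order_tendstoD) auto
    then show ?thesis
    proof eventually_elim
      case (elim n)
      with st(3)[of n] False show ?case by auto
    qed
  qed (use st(3) in auto)
  have "(\<lambda>n. \<integral>\<^sup>+y. ennreal (k y) \<partial>jump_sizes g (s n) (t n)) \<longlonglongrightarrow> ennreal (k (path_jump g \<tau>))"
    if "k \<in> borel_measurable borel" "(\<integral>\<^sup>+y. ennreal (k y) \<partial>jump_sizes g 0 T) < \<infinity>" for k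
  proof -
    have "(\<integral>\<^sup>+r. ennreal (k (path_jump g r)) * indicator {r \<in> {\<tau>}. path_jump g r \<noteq> 0} r \<partial>count_space UNIV) =
        (\<integral>\<^sup>+r. ennreal (k (path_jump g \<tau>)) * indicator {\<tau>} r \<partial>count_space UNIV)"
      using jump by (intro nn_integral_cong) (auto simp: indicator_def)
    also have "\<dots> = ennreal (k (path_jump g \<tau>))" by (subst nn_integral_cmult_indicator) auto
    finally show ?thesis
      using nn_integral_jump_sizes_shrink[OF _ that(2) st(1,2) ev] that(1) by simp
  qed
  from this[of h] this[of "\<lambda>y. - h y"]
  have "(\<lambda>n. jump_pos h g (s n) (t n)) \<longlonglongrightarrow> ennreal (max 0 (h (path_jump g \<tau>)))"
    "(\<lambda>n. jump_pos (\<lambda>y. - h y) g (s n) (t n)) \<longlonglongrightarrow> ennreal (max 0 (- h (path_jump g \<tau>)))"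
    using finite_pos finite_neg h by (simp_all add: jump_pos_def ennreal_max_0')
  from tendsto_diff[OF tendsto_enn2real[OF this(1)] tendsto_enn2real[OF this(2)]]
  have "(\<lambda>n. jump_incr h g (s n) (t n)) \<longlonglongrightarrow> max 0 (h (path_jump g \<tau>)) - max 0 (- h (path_jump g \<tau>))"
    unfolding jump_incr_def by simp
  then show ?thesis by (simp add: max_def split: if_splits)
qed

lemma jump_var_tendsto_0:
  assumes t: "\<And>n. 0 \<le> t n" "\<And>n. t n \<le> T" "t \<longlonglongrightarrow> 0"
  shows "(\<lambda>n. jump_var h g 0 (t n)) \<longlonglongrightarrow> 0"
proof -
  have ev: "eventually (\<lambda>n. r \<in> {0<..t n} \<longleftrightarrow> r \<in> {}) sequentially" for r
  proof (cases "0 < r")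
    case True
    then have "eventually (\<lambda>n. t n < r) sequentially" using t(3) by (intro order_tendstoD) auto
    then show ?thesis by eventually_elim auto
  qed auto
  have "(\<lambda>n. \<integral>\<^sup>+y. ennreal (k y) \<partial>jump_sizes g 0 (t n)) \<longlonglongrightarrow> 0"
    if "k \<in> borel_measurable borel" "(\<integral>\<^sup>+y. ennreal (k y) \<partial>jump_sizes g 0 T) < \<infinity>" for k
    using nn_integral_jump_sizes_shrink[OF _ that(2) _ t(2) ev] that(1) by simp
  from this[of h] this[of "\<lambda>y. - h y"]
  have "(\<lambda>n. jump_pos h g 0 (t n)) \<longlonglongrightarrow> ennreal 0" "(\<lambda>n. jump_pos (\<lambda>y. - h y) g 0 (t n)) \<longlonglongrightarrow> ennreal 0"
    using finite_pos finite_neg h by (simp_all add: jump_pos_def)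
  from tendsto_add[OF tendsto_enn2real[OF this(1)] tendsto_enn2real[OF this(2)]]
  show ?thesis by (simp add: jump_var_def)
qed

text \<open>Markov's inequality for the integral of \<open>\<bar>h\<bar>\<close> over the jumps.
  \<open>finite_big_jumps\<close> does not give this, since \<open>h\<close> may be large at small
  jump sizes.\<close>

lemma finite_jumps_above:
  assumes "0 < c"
  shows "finite {r \<in> {0<..T}. path_jump g r \<noteq> 0 \<and> c < \<bar>h (path_jump g r)\<bar>}" (is "finite ?A")
proof -
  have "c * emeasure (count_space UNIV) ?A = (\<integral>\<^sup>+r. ennreal c * indicator ?A r \<partial>count_space UNIV)"
    by (subst nn_integral_cmult_indicator) auto
  also have "\<dots> \<le> (\<integral>\<^sup>+r. (ennreal (h (path_jump g r)) + ennreal (- h (path_jump g r))) *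
      indicator {r \<in> {0<..T}. path_jump g r \<noteq> 0} r \<partial>count_space UNIV)"
  proof (intro nn_integral_mono)
    fix r
    have "ennreal c \<le> ennreal (h (path_jump g r)) + ennreal (- h (path_jump g r))" if "r \<in> ?A"
      using that by (cases "0 \<le> h (path_jump g r)") (auto simp: ennreal_neg intro!: ennreal_leI)
    then show "ennreal c * indicator ?A r \<le> (ennreal (h (path_jump g r)) + ennreal (- h (path_jump g r))) *
      indicator {r \<in> {0<..T}. path_jump g r \<noteq> 0} r"
      by (auto simp: indicator_def)
  qed
  also have "\<dots> = (\<integral>\<^sup>+y. ennreal (h y) + ennreal (- h y) \<partial>jump_sizes g 0 T)"
    by (subst nn_integral_jump_sizes) auto
  also have "\<dots> = jump_pos h g 0 T + jump_pos (\<lambda>y. - h y) g 0 T"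
    unfolding jump_pos_def using h by (intro nn_integral_add) auto
  also have "\<dots> < \<infinity>" using finite_pos finite_neg by simp
  finally have "emeasure (count_space UNIV) ?A \<noteq> \<infinity>"
    using \<open>0 < c\<close> by (auto simp: ennreal_mult_less_top ennreal_mult_top)
  then show ?thesis by (auto simp: emeasure_count_space split: if_splits)
qed

end

section \<open>Exchanging the big jump\<close>

text \<open>An open set is a countable disjoint union of open intervals, its components, so the
  bound extends to open sets of finite length; and a null set is contained in open sets of
  arbitrarily small length.\<close>

lemma emeasure_null_of_interval_bound:
  fixes \<mu> :: "real measure"
  assumes sets: "sets \<mu> = sets borel" and "0 \<le> C"
    and le: "\<And>a b. a \<le> b \<Longrightarrow> emeasure \<mu> {a<..<b} \<le> ennreal (C * (b - a))"
    and A: "A \<in> null_sets lborel"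
  shows "emeasure \<mu> A = 0"
proof -
  have [measurable_cong]: "sets \<mu> = sets borel" by fact
  \<comment> \<open>Components are handled as bounded connected sets. Enlarging by \<open>e\<close>
    on both sides puts such a set into an open interval with the end points \<open>Inf c - e\<close>
    and \<open>Sup c + e\<close>; then \<open>e\<close> tends to 0.\<close>
  have connected_le: "emeasure \<mu> c \<le> ennreal C * emeasure lborel c"
    if c: "connected c" "c \<noteq> {}" "c \<in> sets borel" and fin: "emeasure lborel c < \<infinity>" for c :: "real set"
  proof -
    define s where "s = measure lborel c"
    have s: "emeasure lborel c = ennreal s" using fin by (simp add: s_def emeasure_eq_ennreal_measure)
    have uv: "v - u \<le> s" if "u \<in> c" "v \<in> c" for u v
    proof (cases "u \<le> v")
      case True
      then have "{u..v} \<subseteq> c" using connected_contains_Icc[OF c(1) that] by simp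
      then have "emeasure lborel {u..v} \<le> emeasure lborel c" using c(3) by (intro emeasure_mono) auto
      then show ?thesis using True s by (simp add: s_def ennreal_le_iff)
    next
      case False
      then show ?thesis by (simp add: s_def) (smt (verit) measure_nonneg)
    qed
    obtain x where x: "x \<in> c" using c by blast
    have bdd: "bdd_above c" "bdd_below c"
      using uv[OF x] uv[OF _ x] by (auto intro!: bdd_aboveI[of _ "x + s"] bdd_belowI[of _ "x - s"] simp: algebra_simps)
    have "Sup c \<le> u + s" if "u \<in> c" for u
      using c(2) uv[OF that] by (intro cSup_least) (auto simp: algebra_simps)
    then have "Sup c - s \<le> Inf c" using c(2) by (intro cInf_greatest) (auto simp: algebra_simps)
    then have len: "Sup c - Inf c \<le> s" by simp
    have "Inf c \<le> Sup c" using cInf_lower[OF x bdd(2)] cSup_upper[OF x bdd(1)] by linarith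
    have "emeasure \<mu> c \<le> ennreal (C * (s + 2 * e))" if "0 < e" for e
    proof -
      have "c \<subseteq> {Inf c - e<..<Sup c + e}"
      proof
        fix u assume u: "u \<in> c"
        show "u \<in> {Inf c - e<..<Sup c + e}"
          using cInf_lower[OF u bdd(2)] cSup_upper[OF u bdd(1)] that by auto
      qed
      then have "emeasure \<mu> c \<le> emeasure \<mu> {Inf c - e<..<Sup c + e}" by (intro emeasure_mono) auto
      also have "\<dots> \<le> ennreal (C * (Sup c + e - (Inf c - e)))"
        using \<open>Inf c \<le> Sup c\<close> that by (intro le) simp
      also have "\<dots> \<le> ennreal (C * (s + 2 * e))"
        using len \<open>0 \<le> C\<close> by (intro ennreal_leI mult_left_mono) auto
      finally show ?thesis .
    qed
    then have "eventually (\<lambda>e. emeasure \<mu> c \<le> ennreal (C * (s + 2 * e))) (at_right 0)"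
      by (auto simp: eventually_at_right_field intro!: exI[of _ 1])
    moreover have "((\<lambda>e. ennreal (C * (s + 2 * e))) \<longlongrightarrow> ennreal (C * (s + 2 * 0))) (at_right 0)"
      by (intro tendsto_intros)
    ultimately have "emeasure \<mu> c \<le> ennreal (C * (s + 2 * 0))"
      by (intro tendsto_lowerbound) auto
    then show ?thesis using s \<open>0 \<le> C\<close> by (simp add: ennreal_mult s_def)
  qed
  have open_le: "emeasure \<mu> U \<le> ennreal C * emeasure lborel U" if U: "open U" "emeasure lborel U < \<infinity>" for U
  proof -
    have op: "open c" if "c \<in> components U" for c using open_components[OF U(1) that] .
    have disj: "disjoint_family_on (\<lambda>c. c) (components U)"
      using pairwise_disjoint_components[of U] by (auto simp: disjoint_family_on_def pairwise_def disjnt_def)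
    have count: "countable (components U)"
    proof (rule countable_disjoint_open_subsets)
      show "disjoint (components U)"
        using disj by (auto simp: disjoint_family_on_def pairwise_def disjnt_def)
    qed (use op in auto)
    have "emeasure \<mu> U = emeasure \<mu> (\<Union>c\<in>components U. c)" using Union_components[of U] by simp
    also have "\<dots> = (\<integral>\<^sup>+c. emeasure \<mu> c \<partial>count_space (components U))"
      using op sets disj count by (intro emeasure_UN_countable) auto
    also have "\<dots> \<le> (\<integral>\<^sup>+c. ennreal C * emeasure lborel c \<partial>count_space (components U))"
    proof (intro nn_integral_mono connected_le)
      fix c assume "c \<in> space (count_space (components U))"
      then have c: "c \<in> components U" by simp
      show "connected c" "c \<noteq> {}" using c in_components_connected in_components_nonempty by auto
      show "c \<in> sets borel" using op[OF c] by simp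
      have "emeasure lborel c \<le> emeasure lborel U"
        using in_components_subset[OF c] U by (intro emeasure_mono) auto
      then show "emeasure lborel c < \<infinity>" using U(2) by (rule le_less_trans)
    qed
    also have "\<dots> = ennreal C * (\<integral>\<^sup>+c. emeasure lborel c \<partial>count_space (components U))"
      by (intro nn_integral_cmult) simp
    also have "(\<integral>\<^sup>+c. emeasure lborel c \<partial>count_space (components U)) = emeasure lborel (\<Union>c\<in>components U. c)"
      using op disj count by (intro emeasure_UN_countable[symmetric]) auto
    also have "(\<Union>c\<in>components U. c) = U" using Union_components[of U] by simp
    finally show ?thesis .
  qed
  have "emeasure \<mu> A \<le> ennreal (C * e)" if "0 < e" for e
  proof -
    have Aleb: "A \<in> sets lebesgue" using A by (auto simp: null_sets_def intro: sets_completionI_sets)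
    obtain U where U: "open U" "A \<subseteq> U" "U - A \<in> lmeasurable" "emeasure lebesgue (U - A) < ennreal e"
      by (rule sets_lebesgue_outer_open[OF Aleb \<open>0 < e\<close>])
    have "emeasure lborel U \<le> emeasure lborel (U - A) + emeasure lborel A"
      using A U by (intro order_trans[OF _ emeasure_subadditive] emeasure_mono) auto
    also have "\<dots> = emeasure lebesgue (U - A)"
      using A U by (simp add: null_sets_def borel_open sets.Diff)
    finally have lU: "emeasure lborel U \<le> ennreal e" using U(4) by auto
    have "emeasure \<mu> A \<le> emeasure \<mu> U" using U sets by (intro emeasure_mono) auto
    also have "\<dots> \<le> ennreal C * emeasure lborel U"
      using lU by (intro open_le U(1)) (auto simp: less_top[symmetric] top_unique)
    also have "\<dots> \<le> ennreal C * ennreal e" using lU by (intro mult_left_mono) auto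
    finally show ?thesis using \<open>0 \<le> C\<close> that by (simp add: ennreal_mult)
  qed
  then have "eventually (\<lambda>e. emeasure \<mu> A \<le> ennreal (C * e)) (at_right 0)"
    by (auto simp: eventually_at_right_field intro!: exI[of _ 1])
  moreover have "((\<lambda>e. ennreal (C * e)) \<longlongrightarrow> ennreal (C * 0)) (at_right 0)"
    by (intro tendsto_intros)
  ultimately have "emeasure \<mu> A \<le> ennreal (C * 0)" by (intro tendsto_lowerbound) auto
  then show ?thesis by simp
qed

text \<open>
  Here \<open>G i\<close> says that \<open>i\<close> is the special index. As \<open>\<xi>\<close> is i.i.d., the special index may be
  exchanged with a uniformly chosen one, so counting the exchanges that lead to \<open>R\<close> bounds
  the probability of \<open>R\<close>.
\<close>

lemma exchange_bound:
  fixes \<xi> :: "nat \<Rightarrow> 'a \<Rightarrow> 'b"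
  assumes "prob_space M" and ind: "prob_space.indep_vars M (\<lambda>_. N) \<xi> {..<m}"
    and id: "\<And>k. k < m \<Longrightarrow> distr M N (\<xi> k) = D" and B: "B \<subseteq> {..<m}" and "0 < m"
    and G: "\<And>i. i \<in> B \<Longrightarrow> Measurable.pred (\<Pi>\<^sub>M k\<in>{..<m}. N) (G i)"
    and R: "Measurable.pred (\<Pi>\<^sub>M k\<in>{..<m}. N) R"
    and sym: "\<And>i j w. i \<in> B \<Longrightarrow> j \<in> B \<Longrightarrow>
      G j (\<lambda>k\<in>{..<m}. w (Transposition.transpose i j k)) \<longleftrightarrow> G i w"
    and disj: "\<And>i j w. i \<in> B \<Longrightarrow> j \<in> B \<Longrightarrow> G i w \<Longrightarrow> G j w \<Longrightarrow> i = j"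
    and count: "\<And>i w. i \<in> B \<Longrightarrow> G i w \<Longrightarrow>
      real (card {j \<in> B. R (\<lambda>k\<in>{..<m}. w (Transposition.transpose i j k))}) \<le> C"
    and "0 \<le> C"
  defines "\<Xi> \<equiv> \<lambda>\<omega>. \<lambda>k\<in>{..<m}. \<xi> k \<omega>"
  shows "{\<omega> \<in> space M. \<exists>i\<in>B. G i (\<Xi> \<omega>) \<and> R (\<Xi> \<omega>)} \<in> sets M"
    and "real (card B) * measure M {\<omega> \<in> space M. \<exists>i\<in>B. G i (\<Xi> \<omega>) \<and> R (\<Xi> \<omega>)} \<le> C"
proof -
  interpret prob_space M by fact
  let ?P = "\<Pi>\<^sub>M k\<in>{..<m}. N"
  let ?\<sigma> = "\<lambda>i j w. \<lambda>k\<in>{..<m}. w (Transposition.transpose i j k)"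
  have fB: "finite B" using B finite_subset by blast
  have rv: "\<xi> k \<in> measurable M N" if "k < m" for k
    using ind that by (auto simp: indep_vars_def)
  have \<Xi>[measurable]: "\<Xi> \<in> measurable M ?P" unfolding \<Xi>_def using rv by (intro measurable_restrict) auto
  have tm: "Transposition.transpose i j k < m" if "i \<in> B" "j \<in> B" "k < m" for i j k
    using that B by (auto simp: Transposition.transpose_def)
  have \<sigma>: "?\<sigma> i j \<in> measurable ?P ?P" if "i \<in> B" "j \<in> B" for i j
    using tm[OF that] by (intro measurable_restrict measurable_component_singleton) auto
  define Ev where "Ev i = {\<omega> \<in> space M. G i (\<Xi> \<omega>) \<and> R (\<Xi> \<omega>)}" for i
  define Fv where "Fv i j = {\<omega> \<in> space M. G i (\<Xi> \<omega>) \<and> R (?\<sigma> i j (\<Xi> \<omega>))}" for i j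
  have GR: "{w \<in> space ?P. G i w \<and> R w} \<in> sets ?P" if "i \<in> B" for i
  proof -
    note [measurable] = G[OF that] R
    show ?thesis by measurable
  qed
  have Ev: "Ev i \<in> sets M" if "i \<in> B" for i
  proof -
    note [measurable] = G[OF that] R
    show ?thesis unfolding Ev_def by measurable
  qed
  have Fv: "Fv i j \<in> sets M" if "i \<in> B" "j \<in> B" for i j
  proof -
    note [measurable] = G[OF that(1)] measurable_compose[OF \<sigma>[OF that] R]
    show ?thesis unfolding Fv_def by measurable
  qed
  \<comment> \<open>Swapping \<open>i\<close> and \<open>j\<close> preserves the law of
    \<open>\<Xi>\<close>, and by \<open>sym\<close> it turns the condition \<open>G j\<close> into
    \<open>G i\<close>.\<close>
  have swap: "prob (Ev j) = prob (Fv i j)" if ij: "i \<in> B" "j \<in> B" for i j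
  proof -
    let ?p = "Transposition.transpose i j"
    have p: "?p permutes {..<m}" using ij B by (intro permutes_swap_id) auto
    have \<Xi>': "(\<lambda>\<omega>. \<lambda>k\<in>{..<m}. \<xi> (?p k) \<omega>) \<in> measurable M ?P"
      using rv tm[OF ij] by (intro measurable_restrict) auto
    have \<sigma>\<Xi>: "(\<lambda>k\<in>{..<m}. \<xi> (?p k) \<omega>) = ?\<sigma> i j (\<Xi> \<omega>)" for \<omega>
      using tm[OF ij] by (auto simp: \<Xi>_def fun_eq_iff)
    have "prob (Ev j) = measure (distr M ?P \<Xi>) {w \<in> space ?P. G j w \<and> R w}"
      using GR[OF ij(2)] measurable_space[OF \<Xi>]
      by (subst measure_distr) (auto simp: Ev_def intro!: arg_cong[of _ _ prob])
    also have "distr M ?P \<Xi> = distr M ?P (\<lambda>\<omega>. \<lambda>k\<in>{..<m}. \<xi> (?p k) \<omega>)"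
      unfolding \<Xi>_def using prob_space_distr_swap[OF \<open>prob_space M\<close> ind id p \<open>0 < m\<close>] by simp
    also have "measure \<dots> {w \<in> space ?P. G j w \<and> R w} = prob (Fv i j)"
      using GR[OF ij(2)] \<Xi>' measurable_space[OF \<Xi>'] sym[OF ij]
      by (subst measure_distr) (auto simp: Fv_def \<sigma>\<Xi> intro!: arg_cong[of _ _ prob])
    finally show ?thesis .
  qed
  have un: "{\<omega> \<in> space M. \<exists>i\<in>B. G i (\<Xi> \<omega>) \<and> R (\<Xi> \<omega>)} = (\<Union>i\<in>B. Ev i)" by (auto simp: Ev_def)
  show "{\<omega> \<in> space M. \<exists>i\<in>B. G i (\<Xi> \<omega>) \<and> R (\<Xi> \<omega>)} \<in> sets M"
    unfolding un using Ev fB by auto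
  have "real (card B) * prob (\<Union>i\<in>B. Ev i) \<le> real (card B) * (\<Sum>j\<in>B. prob (Ev j))"
    using Ev fB by (intro mult_left_mono finite_measure_subadditive_finite) auto
  \<comment> \<open>The factor \<open>card B\<close> is spent on listing all possible origins
    \<open>i\<close>: each \<open>prob (Ev j)\<close> becomes \<open>prob (Fv i j)\<close> for every
    \<open>i\<close>. For fixed \<omega> only the special index contributes, by \<open>disj\<close>,
    and the inner sum then counts the swaps bounded in \<open>count\<close>.\<close>
  also have "\<dots> = (\<Sum>i\<in>B. \<Sum>j\<in>B. prob (Ev j))" by simp
  also have "\<dots> = (\<Sum>i\<in>B. \<Sum>j\<in>B. prob (Fv i j))" using swap by (intro sum.cong) auto
  also have "\<dots> = (\<Sum>i\<in>B. \<Sum>j\<in>B. expectation (indicator (Fv i j)))"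
    using Fv by (intro sum.cong refl) simp
  also have "\<dots> = expectation (\<lambda>\<omega>. \<Sum>i\<in>B. \<Sum>j\<in>B. indicator (Fv i j) \<omega>)"
  proof -
    have int: "integrable M (indicator (Fv i j) :: 'a \<Rightarrow> real)" if "i \<in> B" "j \<in> B" for i j
      using Fv[OF that] by (simp add: emeasure_eq_measure)
    have "(\<Sum>j\<in>B. expectation (indicator (Fv i j) :: 'a \<Rightarrow> real)) = expectation (\<lambda>\<omega>. \<Sum>j\<in>B. indicator (Fv i j) \<omega>)"
      if "i \<in> B" for i
      using int[OF that] by (rule Bochner_Integration.integral_sum[symmetric])
    moreover have "(\<Sum>i\<in>B. expectation (\<lambda>\<omega>. \<Sum>j\<in>B. indicator (Fv i j) \<omega> :: real)) =
        expectation (\<lambda>\<omega>. \<Sum>i\<in>B. \<Sum>j\<in>B. indicator (Fv i j) \<omega>)"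
      using int by (intro Bochner_Integration.integral_sum[symmetric] Bochner_Integration.integrable_sum)
    ultimately show ?thesis by simp
  qed
  also have "\<dots> \<le> expectation (\<lambda>\<omega>. C)"
  proof (rule integral_mono)
    show "integrable M (\<lambda>\<omega>. \<Sum>i\<in>B. \<Sum>j\<in>B. indicator (Fv i j) \<omega> :: real)"
    proof (intro Bochner_Integration.integrable_sum)
      fix i j assume "i \<in> B" "j \<in> B"
      from Fv[OF this] show "integrable M (indicator (Fv i j) :: 'a \<Rightarrow> real)" by (simp add: emeasure_eq_measure)
    qed
    fix \<omega> assume "\<omega> \<in> space M"
    show "(\<Sum>i\<in>B. \<Sum>j\<in>B. indicator (Fv i j) \<omega>) \<le> C"
    proof (cases "\<exists>i\<in>B. G i (\<Xi> \<omega>)")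
      case False
      then have "(\<Sum>i\<in>B. \<Sum>j\<in>B. indicator (Fv i j) \<omega> :: real) = 0"
        by (intro sum.neutral ballI) (auto simp: Fv_def indicator_def)
      then show ?thesis using \<open>0 \<le> C\<close> by simp
    next
      case True
      then obtain i where i: "i \<in> B" "G i (\<Xi> \<omega>)" by blast
      have "indicator (Fv i' j) \<omega> = (0 :: real)" if "i' \<in> B" "i' \<noteq> i" for i' j
        using disj[OF that(1) i(1) _ i(2)] that(2) by (auto simp: Fv_def indicator_def)
      then have "(\<Sum>i'\<in>B. \<Sum>j\<in>B. indicator (Fv i' j) \<omega> :: real) =
          (\<Sum>i'\<in>B. if i' = i then \<Sum>j\<in>B. indicator (Fv i j) \<omega> else 0)"
        by (intro sum.cong) auto
      also have "\<dots> = (\<Sum>j\<in>B. indicator (Fv i j) \<omega>)" using i fB by simp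
      also have "\<dots> = real (card {j \<in> B. R (?\<sigma> i j (\<Xi> \<omega>))})"
        using i \<open>\<omega> \<in> space M\<close> fB by (simp add: Fv_def indicator_def sum.If_cases Int_def)
      also have "\<dots> \<le> C" by (rule count[OF i])
      finally show ?thesis .
    qed
  qed simp
  finally show "real (card B) * prob {\<omega> \<in> space M. \<exists>i\<in>B. G i (\<Xi> \<omega>) \<and> R (\<Xi> \<omega>)} \<le> C"
    unfolding un by (simp add: prob_space)
qed

lemma measurable_euler:
  assumes f: "f \<in> borel_measurable borel" and b: "\<And>k. k < n \<Longrightarrow> b k \<in> borel_measurable N"
  shows "(\<lambda>w. euler f \<eta> x (\<lambda>k. b k w) n) \<in> borel_measurable N"
  using b
proof (induction n)
  case (Suc n)
  then have [measurable]: "(\<lambda>w. euler f \<eta> x (\<lambda>k. b k w) n) \<in> borel_measurable N" "b n \<in> borel_measurable N"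
    by auto
  note [measurable] = f
  show ?case by simp
qed simp

section \<open>The probability estimate on a fixed grid\<close>

context levy_process
begin

text \<open>Translates the integral in the equation into functionals of a path in
  \<open>path_space\<close>. Only the values of \<open>h\<close> off 0 matter to the jump measure,
  so \<open>h\<close> may be replaced by a function \<open>H\<close> that is Borel on the whole
  line.\<close>

lemma jump_measure_integral:
  assumes \<omega>: "\<omega> \<in> cadlag_event" and t: "0 < T" "0 \<le> t" "t \<le> T"
    and H: "H \<in> borel_measurable borel" "\<And>y. y \<noteq> 0 \<Longrightarrow> H y = h y"
    and int: "set_integrable (jump_measure X \<omega>) ({0..t} \<times> (- {0})) (\<lambda>(s, y). h y)"
  shows "jump_pos H (segment T 0 \<omega>) 0 t < \<infinity>" "jump_pos (\<lambda>y. - H y) (segment T 0 \<omega>) 0 t < \<infinity>"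
    and "(LINT (s, y):{0..t} \<times> (- {0})|jump_measure X \<omega>. h y) = jump_incr H (segment T 0 \<omega>) 0 t"
proof -
  let ?g = "segment T 0 \<omega>"
  define F :: "real \<times> real \<Rightarrow> real" where "F p = indicator ({0..t} \<times> (- {0})) p *\<^sub>R (case p of (s, y) \<Rightarrow> h y)" for p
  have F: "integrable (jump_measure X \<omega>) F" using int by (simp add: set_integrable_def F_def[abs_def])
  have js: "jump_sizes ?g 0 t = jump_sizes (\<lambda>t. version t \<omega>) 0 t"
    using jump_sizes_segment[of T 0 t 0 \<omega>] t by simp
  have eq: "(\<integral>\<^sup>+p. ennreal (c * F p) \<partial>jump_measure X \<omega>) = jump_pos (\<lambda>y. c * H y) ?g 0 t" for c :: real
  proof -
    have [measurable]: "F \<in> borel_measurable (restrict_space borel ({0<..} \<times> (- {0})))"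
      using borel_measurable_integrable[OF F] by (simp add: jump_measure_def)
    have "(\<integral>\<^sup>+p. ennreal (c * F p) \<partial>jump_measure X \<omega>) =
        (\<integral>\<^sup>+r. ennreal (c * F (r, jump X r \<omega>)) \<partial>count_space {r. 0 < r \<and> jump X r \<omega> \<noteq> 0})"
      unfolding jump_measure_def by (subst nn_integral_distr) (auto simp: space_restrict_space)
    also have "\<dots> = (\<integral>\<^sup>+r. ennreal (c * F (r, jump X r \<omega>)) * indicator {r. 0 < r \<and> jump X r \<omega> \<noteq> 0} r \<partial>count_space UNIV)"
      by (rule nn_integral_count_space_indicator) simp
    also have "\<dots> = (\<integral>\<^sup>+r. ennreal (c * H (path_jump (\<lambda>t. version t \<omega>) r)) *
        indicator {r \<in> {0<..t}. path_jump (\<lambda>t. version t \<omega>) r \<noteq> 0} r \<partial>count_space UNIV)"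
      using H(2) by (intro nn_integral_cong) (auto simp: F_def indicator_def jump_eq_path_jump_version[OF \<omega>])
    also have "\<dots> = jump_pos (\<lambda>y. c * H y) ?g 0 t"
    proof -
      have "(\<lambda>y. ennreal (c * H y)) \<in> borel_measurable borel" using H(1) by measurable
      from nn_integral_jump_sizes[OF this] show ?thesis by (simp only: jump_pos_def js)
    qed
    finally show ?thesis .
  qed
  have pos: "(\<integral>\<^sup>+p. ennreal (F p) \<partial>jump_measure X \<omega>) = jump_pos H ?g 0 t"
    and neg: "(\<integral>\<^sup>+p. ennreal (- F p) \<partial>jump_measure X \<omega>) = jump_pos (\<lambda>y. - H y) ?g 0 t"
    using eq[of 1] eq[of "- 1"] by simp_all
  show "jump_pos H ?g 0 t < \<infinity>" "jump_pos (\<lambda>y. - H y) ?g 0 t < \<infinity>"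
    using F unfolding pos[symmetric] neg[symmetric] real_integrable_def by (auto simp: less_top[symmetric])
  show "(LINT (s, y):{0..t} \<times> (- {0})|jump_measure X \<omega>. h y) = jump_incr H ?g 0 t"
    using real_lebesgue_integral_def[OF F]
    unfolding set_lebesgue_integral_def F_def[symmetric] pos neg jump_incr_def by simp
qed

text \<open>Two notions of size are combined. The count \<open>big_jumps\<close> makes the special
  index unique and marks it in a way that swaps inside \<open>B\<close> respect. The Euler scheme,
  however, sees the whole increment of the cell, small jumps included, so \<open>jump_incr\<close>
  is required to be large as well. The variation is summed from time 0, which keeps the scheme near
  its start; swaps inside the first \<open>n\<close> cells do not change this sum.\<close>

definition one_big_jump :: "(real \<Rightarrow> real) \<Rightarrow> real \<Rightarrow> real \<Rightarrow> real \<Rightarrow> nat set \<Rightarrow> nat \<Rightarrow> nat \<Rightarrow> (nat \<Rightarrow> real \<Rightarrow> real) \<Rightarrow> bool" where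
  "one_big_jump h l s c B n i w \<longleftrightarrow> (\<Sum>k<n. jump_var h (w k) 0 l) \<le> s \<and>
     c \<le> \<bar>jump_incr h (w i) 0 l\<bar> \<and> big_jumps h c (w i) 0 l = 1 \<and>
     (\<forall>k\<in>B - {i}. big_jumps h c (w k) 0 l = 0)"

text \<open>Combines \<open>exchange_bound\<close> with the count from
  \<open>card_swaps_hitting_interval\<close>. Cell \<open>a\<close> of the coarse grid with
  \<open>Q\<close> cells is the block \<open>B\<close> of \<open>K\<close> fine cells. Keeping
  \<open>Q\<close> fixed while \<open>K\<close> grows makes the first two terms on the right
  negligible against \<open>K\<close>, while the last one grows like \<open>K\<close> through
  \<open>l\<close>.\<close>

lemma discrete_interval_bound:
  fixes a Q K :: nat
  assumes T: "0 < T" and h: "h \<in> borel_measurable borel"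
    and lip: "\<And>u v. \<bar>f u - f v\<bar> \<le> L * \<bar>u - v\<bar>" and "0 < \<kappa>" and "0 < d"
    and gap: "monotone_gap f {x-\<delta>..x+\<delta>} d \<kappa>"
    and aQ: "a < Q" and "0 < K"
    and drift: "real (Suc a) * (T / real Q) * (\<bar>f x\<bar> + L * \<delta>) \<le> \<delta> / 2"
    and short: "real (Suc a) * (T / real Q) * L \<le> 1 / 2"
    and fine: "T / real (Q * K) * L \<le> 1 / 2" and "0 \<le> \<delta>" and "0 < \<epsilon>" and "\<alpha> \<le> \<beta>"
  defines "l \<equiv> T / real (Q * K)" and "B \<equiv> {a * K..<Suc a * K}"
  defines "EV \<equiv> {\<omega> \<in> space M. (\<exists>i\<in>B. one_big_jump h l (\<delta> / 2) (2 * d) B (Suc a * K) i (\<lambda>k. segment l k \<omega>)) \<and>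
      euler f l x (\<lambda>k. jump_incr h (segment l k \<omega>) 0 l) (Q * K) \<in> {\<alpha><..<\<beta>}}"
  shows "EV \<in> sets M"
    and "real K * prob EV \<le> \<delta> / 2 / \<epsilon> +
      (1 + (\<beta> - \<alpha> + 2 * (2 * exp (T * L) * \<epsilon>)) / (exp (- 2 * T * L) * (l * \<kappa>)))"
proof -
  let ?m = "Q * K" and ?n = "Suc a * K"
  let ?P = "\<Pi>\<^sub>M k\<in>{..<?m}. path_space"
  let ?G = "one_big_jump h l (\<delta> / 2) (2 * d) B ?n"
  let ?R = "\<lambda>w. euler f l x (\<lambda>k. jump_incr h (w k) 0 l) ?m \<in> {\<alpha><..<\<beta>}"
  let ?C = "\<delta> / 2 / \<epsilon> + (1 + (\<beta> - \<alpha> + 2 * (2 * exp (T * L) * \<epsilon>)) / (exp (- 2 * T * L) * (l * \<kappa>)))"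
  have "?n \<le> ?m" using aQ by (intro mult_le_mono1) simp
  moreover have "0 < ?m" using aQ \<open>0 < K\<close> by simp
  ultimately have m: "0 < ?m" "?n \<le> ?m" by simp_all
  have l: "0 < l" using T m by (simp add: l_def)
  have ml: "real ?m * l = T" using m by (simp add: l_def)
  have nl: "real ?n * l = real (Suc a) * (T / real Q)" using m \<open>0 < K\<close> by (simp add: l_def field_simps)
  have B: "B \<subseteq> {..<?n}" by (auto simp: B_def)
  then have Bm: "B \<subseteq> {..<?m}" using m by auto
  have L: "0 \<le> L" using lip[of 1 0] by simp
  have f: "f \<in> borel_measurable borel"
  proof -
    have "L-lipschitz_on UNIV f" using lip L by (intro lipschitz_onI) (auto simp: dist_real_def)
    then show ?thesis by (intro borel_measurable_continuous_onI lipschitz_on_continuous_on)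
  qed
  have comp: "(\<lambda>w. F (w k)) \<in> borel_measurable ?P"
    if "F \<in> borel_measurable path_space" "k < ?m" for F k
    using that by (intro measurable_compose[OF measurable_component_singleton]) auto
  note J = measurable_jump_functionals[OF l h]
  have G: "Measurable.pred ?P (?G i)" if "i \<in> B" for i
  proof -
    have im: "i < ?m" using that Bm by auto
    have 1: "(\<lambda>w. \<Sum>k<?n. jump_var h (w k) 0 l) \<in> borel_measurable ?P"
      using m by (intro borel_measurable_sum comp J) auto
    have 2: "(\<lambda>w. jump_incr h (w i) 0 l) \<in> borel_measurable ?P" by (intro comp J im)
    have 3: "(\<lambda>w. big_jumps h (2 * d) (w k) 0 l) \<in> borel_measurable ?P" if "k \<in> B" for k
      using that Bm by (intro comp J) auto
    have 4: "Measurable.pred ?P (\<lambda>w. \<forall>k\<in>B - {i}. big_jumps h (2 * d) (w k) 0 l = 0)"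
    proof (rule pred_intros_finite)
      fix k assume "k \<in> B - {i}"
      then have [measurable]: "(\<lambda>w. big_jumps h (2 * d) (w k) 0 l) \<in> borel_measurable ?P" by (intro 3) auto
      show "Measurable.pred ?P (\<lambda>w. big_jumps h (2 * d) (w k) 0 l = 0)" by measurable
    qed (simp add: B_def)
    note [measurable] = 1 2 3[OF that] 4
    show ?thesis unfolding one_big_jump_def by measurable
  qed
  have R: "Measurable.pred ?P ?R"
  proof -
    have [measurable]: "(\<lambda>w. euler f l x (\<lambda>k. jump_incr h (w k) 0 l) ?m) \<in> borel_measurable ?P"
      by (intro measurable_euler f comp J)
    show ?thesis by measurable
  qed

  have sym: "?G j (\<lambda>k\<in>{..<?m}. w (Transposition.transpose i j k)) \<longleftrightarrow> ?G i w"
    if ij: "i \<in> B" "j \<in> B" for i j w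
  proof -
    let ?p = "Transposition.transpose i j"
    let ?w = "\<lambda>k\<in>{..<?m}. w (?p k)"
    have w: "?w k = w (?p k)" if "k < ?m" for k using that by simp
    have "(\<Sum>k<?n. jump_var h (?w k) 0 l) = (\<Sum>k<?n. jump_var h (w (?p k)) 0 l)"
      using m by (intro sum.cong) auto
    also have "\<dots> = (\<Sum>k<?n. jump_var h (w k) 0 l)"
    proof -
      have "i \<in> {..<?n}" "j \<in> {..<?n}" using ij B by auto
      from sum.permute[OF permutes_swap_id[OF this], of "\<lambda>k. jump_var h (w k) 0 l"]
      show ?thesis by (simp add: o_def)
    qed
    finally have s: "(\<Sum>k<?n. jump_var h (?w k) 0 l) = (\<Sum>k<?n. jump_var h (w k) 0 l)" .
    have j: "?w j = w i" using ij Bm by auto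
    have "(\<forall>k\<in>B - {j}. big_jumps h (2 * d) (?w k) 0 l = 0) \<longleftrightarrow>
        (\<forall>k\<in>B - {i}. big_jumps h (2 * d) (w k) 0 l = 0)"
    proof -
      note p = permutes_swap_id[OF ij]
      have "?p ` (B - {j}) = ?p ` B - ?p ` {j}" by (intro image_set_diff permutes_inj[OF p])
      then have B_eq: "B - {i} = ?p ` (B - {j})" by (simp add: permutes_image[OF p])
      have "?w k = w (?p k)" if "k \<in> B - {j}" for k using that Bm by (intro w) auto
      then show ?thesis unfolding B_eq Set.ball_simps(9) by (intro ball_cong refl) (simp only:)
    qed
    then show ?thesis unfolding one_big_jump_def s j by simp
  qed
  have disj: "i = j" if "i \<in> B" "j \<in> B" "?G i w" "?G j w" for i j w
  proof (rule ccontr)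
    assume "i \<noteq> j"
    then have "big_jumps h (2 * d) (w j) 0 l = 0" using that by (auto simp: one_big_jump_def)
    with that(4) show False by (simp add: one_big_jump_def)
  qed
  have count: "real (card {j \<in> B. ?R (\<lambda>k\<in>{..<?m}. w (Transposition.transpose i j k))}) \<le> ?C"
    if i: "i \<in> B" "?G i w" for i w
  proof -
    let ?b = "\<lambda>k. jump_incr h (w k) 0 l" and ?v = "\<lambda>k. jump_var h (w k) 0 l"
    have "euler f l x (\<lambda>k. jump_incr h ((\<lambda>k\<in>{..<?m}. w (Transposition.transpose i j k)) k) 0 l) ?m =
        euler f l x (?b \<circ> Transposition.transpose i j) ?m" for j
      by (intro euler_cong) simp
    then have eq: "{j \<in> B. ?R (\<lambda>k\<in>{..<?m}. w (Transposition.transpose i j k))} =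
        {j \<in> B. euler f l x (?b \<circ> Transposition.transpose i j) ?m \<in> {\<alpha><..<\<beta>}}" by simp
    have "real (card {j \<in> B. euler f l x (?b \<circ> Transposition.transpose i j) ?m \<in> {\<alpha><..<\<beta>}}) \<le>
      \<delta> / 2 / \<epsilon> + (1 + (\<beta> - \<alpha> + 2 * (2 * exp (real ?m * l * L) * \<epsilon>)) / (exp (- 2 * (real ?m * l) * L) * (l * \<kappa>)))"
    proof (rule card_swaps_hitting_interval[OF lip l \<open>0 < \<kappa>\<close> _ gap _ abs_jump_incr_le _ _ _ _ _ m(2) B \<open>0 < \<epsilon>\<close> \<open>\<alpha> \<le> \<beta>\<close>])
      show "l * L \<le> 1 / 2" using fine by (simp add: l_def)
      show "real ?n * l * (\<bar>f x\<bar> + L * \<delta>) \<le> \<delta> / 2" using drift unfolding nl .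
      show "real ?n * (l * L) \<le> 1 / 2" using short unfolding mult.assoc[symmetric] nl .
      show "(\<Sum>k<?n. ?v k) \<le> \<delta> / 2" "2 * d \<le> \<bar>?b i\<bar>" using i(2) by (auto simp: one_big_jump_def)
      show "i < ?n" using i(1) B by auto
    qed (use \<open>0 < d\<close> in auto)
    then show ?thesis unfolding eq ml .
  qed
  have C0: "0 \<le> ?C"
    using \<open>0 < \<epsilon>\<close> \<open>0 \<le> \<delta>\<close> \<open>\<alpha> \<le> \<beta>\<close> l \<open>0 < \<kappa>\<close> by (intro add_nonneg_nonneg divide_nonneg_nonneg mult_nonneg_nonneg) auto
  have EV: "EV = {\<omega> \<in> space M. \<exists>i\<in>B. ?G i (\<lambda>k\<in>{..<?m}. segment l k \<omega>) \<and> ?R (\<lambda>k\<in>{..<?m}. segment l k \<omega>)}"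
  proof -
    have r: "?R (\<lambda>k\<in>{..<?m}. segment l k \<omega>) \<longleftrightarrow>
        euler f l x (\<lambda>k. jump_incr h (segment l k \<omega>) 0 l) ?m \<in> {\<alpha><..<\<beta>}" for \<omega>
      using euler_cong[of ?m "\<lambda>k. jump_incr h ((\<lambda>k\<in>{..<?m}. segment l k \<omega>) k) 0 l"
          "\<lambda>k. jump_incr h (segment l k \<omega>) 0 l" f l x] by simp
    have g: "?G i (\<lambda>k\<in>{..<?m}. segment l k \<omega>) \<longleftrightarrow> ?G i (\<lambda>k. segment l k \<omega>)" if "i \<in> B" for i \<omega>
    proof -
      have "(\<Sum>k<?n. jump_var h ((\<lambda>k\<in>{..<?m}. segment l k \<omega>) k) 0 l) = (\<Sum>k<?n. jump_var h (segment l k \<omega>) 0 l)"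
        using m by (intro sum.cong) auto
      then show ?thesis unfolding one_big_jump_def using that Bm by (auto simp: subset_iff)
    qed
    show ?thesis unfolding EV_def r using g by auto
  qed
  have card: "card B = K" by (simp add: B_def)
  note bound = exchange_bound[where M = M and N = path_space and \<xi> = "segment l" and m = "?m"
      and D = "distr M path_space (segment l 0)" and B = B and G = "?G" and R = "?R" and C = "?C",
      OF prob_space_axioms indep_segments[OF l] distr_segment[OF l] Bm m(1) G R sym disj count C0]
  show "EV \<in> sets M" unfolding EV by (rule bound(1))
  show "real K * prob EV \<le> ?C" using bound(2) unfolding card EV .
qed

end

section \<open>Isolating a big jump\<close>

context finite_variation_jumps
begin

lemma jump_var_mono:
  assumes "0 \<le> t" "t \<le> u" "u \<le> T"
  shows "jump_var h g 0 t \<le> jump_var h g 0 u"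
  using assms jump_var_add[of 0 t u] abs_jump_incr_le[of h g t u] by simp

text \<open>Everything is chosen successively: a time \<open>t\<close> before which the variation is
  small, a jump time \<open>r\<close> before \<open>t\<close>, a threshold
  \<open>2 / (n + 1)\<close> below the size of that jump, and a grid so fine that the other jumps
  above the threshold are farther from \<open>r\<close> than the mesh. All parameters are natural
  numbers, so countably many events result.\<close>

lemma exists_isolated_big_jump:
  assumes "0 < T" "0 < b" "0 < s" and h0: "\<And>y. y \<noteq> 0 \<Longrightarrow> h y \<noteq> 0"
    and acc: "\<And>e. 0 < e \<Longrightarrow> \<exists>r\<in>{0<..e}. path_jump g r \<noteq> 0"
  shows "\<exists>n Q a :: nat. a < Q \<and> real (Suc a) * (T / real Q) \<le> b \<and>
    jump_var h g 0 (real (Suc a) * (T / real Q)) \<le> s \<and>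
    big_jumps h (2 * inverse (real (Suc n))) g (real a * (T / real Q)) (real (Suc a) * (T / real Q)) = 1"
proof -
  let ?b = "min b T"
  have b: "0 < ?b" using assms by simp
  have "(\<lambda>n. jump_var h g 0 (?b / real (Suc n))) \<longlonglongrightarrow> 0"
  proof (rule jump_var_tendsto_0)
    show "?b / real (Suc n) \<le> T" for n
    proof -
      have "?b / real (Suc n) \<le> ?b / 1" using b by (intro divide_left_mono) auto
      then show ?thesis by simp
    qed
    show "(\<lambda>n. ?b / real (Suc n)) \<longlonglongrightarrow> 0"
      using LIMSEQ_Suc[OF lim_const_over_n[of ?b]] by simp
  qed (use b in auto)
  then have "eventually (\<lambda>n. jump_var h g 0 (?b / real (Suc n)) < s) sequentially"
    using \<open>0 < s\<close> by (rule order_tendstoD)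
  then obtain N where N: "jump_var h g 0 (?b / real (Suc N)) < s"
    by (meson eventually_happens trivial_limit_sequentially)
  define t where "t = ?b / real (Suc N)"
  have "t \<le> ?b / 1" unfolding t_def using b by (intro divide_left_mono) auto
  then have t: "0 < t" "t \<le> b" "t \<le> T" using b by (auto simp: t_def)
  \<comment> \<open>The second half of \<open>t\<close> is kept in reserve for the mesh, so that the
    cell of \<open>r\<close> does not extend beyond \<open>t\<close>.\<close>
  obtain r where r: "0 < r" "r \<le> t / 2" "path_jump g r \<noteq> 0" using acc[of "t / 2"] t by auto
  have "0 < \<bar>h (path_jump g r)\<bar> / 2" using h0[OF r(3)] by simp
  then obtain n where "inverse (real (Suc n)) < \<bar>h (path_jump g r)\<bar> / 2" using reals_Archimedean by blast
  then have n: "2 * inverse (real (Suc n)) < \<bar>h (path_jump g r)\<bar>" by linarith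
  let ?c = "2 * inverse (real (Suc n))"
  let ?F = "{r \<in> {0<..T}. path_jump g r \<noteq> 0 \<and> ?c < \<bar>h (path_jump g r)\<bar>}"
  have "finite ?F" by (rule finite_jumps_above) simp
  from finite_set_avoid[OF this, of r] obtain \<gamma> where \<gamma>: "0 < \<gamma>" "\<And>r'. r' \<in> ?F \<Longrightarrow> r' \<noteq> r \<Longrightarrow> \<gamma> \<le> dist r r'"
    by blast
  have "0 < min \<gamma> (t / 2)" using \<gamma>(1) t by simp
  with lim_const_over_n[of T] have "eventually (\<lambda>Q. T / real Q < min \<gamma> (t / 2)) sequentially"
    by (rule order_tendstoD)
  from eventually_happens[OF eventually_conj[OF this eventually_gt_at_top[of 0]]]
  obtain Q :: nat where Q: "T / real Q < \<gamma>" "T / real Q < t / 2" "0 < Q" by auto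
  have "r \<in> {0<..T}" using r t by auto
  from grid_cell_exists[OF this Q(3)] obtain a where a: "a < Q" "r \<in> grid_cell 0 T Q a" .
  let ?p = "real a * (T / real Q)" and ?q = "real (Suc a) * (T / real Q)"
  have pq: "?q = ?p + T / real Q" by (simp only: of_nat_Suc distrib_right mult_1_left add.commute)
  have p: "?p < r" "r \<le> ?q" "0 \<le> ?p" using a(2) \<open>0 < T\<close> by (auto simp: grid_cell_def)
  have q: "?q \<le> t" using p pq Q r by linarith
  have "{r' \<in> {?p<..?q}. path_jump g r' \<noteq> 0 \<and> path_jump g r' \<in> {y. ?c < \<bar>h y\<bar>}} = {r}"
  proof (intro equalityI subsetI)
    fix r' assume r': "r' \<in> {r' \<in> {?p<..?q}. path_jump g r' \<noteq> 0 \<and> path_jump g r' \<in> {y. ?c < \<bar>h y\<bar>}}"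
    then have "?p < r'" "r' \<le> ?q" by auto
    then have "r' \<in> {0<..T}" using p(3) q t(3) by (auto simp only: greaterThanAtMost_iff)
    then have "r' \<in> ?F" using r' by auto
    moreover have "dist r r' < \<gamma>"
    proof -
      have "?p < r'" "r' \<le> ?q" using r' by auto
      then have "\<bar>r - r'\<bar> < T / real Q" using p pq by linarith
      then show ?thesis using Q(1) by (simp add: dist_real_def)
    qed
    ultimately show "r' \<in> {r}" using \<gamma>(2)[of r'] by fastforce
  qed (use p r n in auto)
  then have "big_jumps h ?c g ?p ?q = 1"
    unfolding big_jumps_def by (subst emeasure_jump_sizes) simp_all
  moreover have "jump_var h g 0 ?q \<le> s"
    using jump_var_mono[of ?q t] p q t N by (simp add: t_def)
  ultimately show ?thesis using a q t by (intro exI[of _ n] exI[of _ Q] exI[of _ a]) auto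
qed

end

section \<open>Refining the grid\<close>

context levy_process
begin

text \<open>The grids with \<open>Q * Suc n\<close> cells all have \<open>p\<close> and
  \<open>q\<close> as grid points. Because the interval between \<open>\<alpha>\<close> and
  \<open>\<beta>\<close> is open, convergence of the schemes puts almost every \<omega> of the event
  into the discrete events for all large \<open>n\<close>; Fatou's lemma and
  \<open>discrete_interval_bound\<close> give the estimate up to \<open>\<epsilon>\<close>.\<close>

lemma interval_bound:
  fixes a Q :: nat and \<zeta> :: "'a \<Rightarrow> real"
  assumes T: "0 < T" and h: "h \<in> borel_measurable borel"
    and lip: "\<And>u v. \<bar>f u - f v\<bar> \<le> L * \<bar>u - v\<bar>" and "0 < \<kappa>" and "0 < d"
    and gap: "monotone_gap f {x-\<delta>..x+\<delta>} d \<kappa>"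
    and aQ: "a < Q"
    and drift: "real (Suc a) * (T / real Q) * (\<bar>f x\<bar> + L * \<delta>) \<le> \<delta> / 2"
    and short: "real (Suc a) * (T / real Q) * L \<le> 1 / 2" and "0 \<le> \<delta>"
    and fv: "AE \<omega> in M. finite_variation_jumps h (segment T 0 \<omega>) T"
    and \<zeta>: "\<zeta> \<in> borel_measurable M"
    and conv: "AE \<omega> in M. (\<lambda>m. euler f (T / real m) x
      (\<lambda>k. jump_incr h (segment T 0 \<omega>) 0 (real (Suc k) * (T / real m)) -
        jump_incr h (segment T 0 \<omega>) 0 (real k * (T / real m))) m) \<longlonglongrightarrow> \<zeta> \<omega>"
    and "\<alpha> \<le> \<beta>"
  defines "p \<equiv> real a * (T / real Q)" and "q \<equiv> real (Suc a) * (T / real Q)"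
  defines "E \<equiv> {\<omega> \<in> space M. jump_var h (segment T 0 \<omega>) 0 q \<le> \<delta> / 2 \<and>
      big_jumps h (2 * d) (segment T 0 \<omega>) p q = 1}"
  shows "E \<in> sets M"
    and "emeasure M {\<omega> \<in> E. \<zeta> \<omega> \<in> {\<alpha><..<\<beta>}} \<le> ennreal (real Q / (exp (- 2 * T * L) * T * \<kappa>) * (\<beta> - \<alpha>))"
proof -
  have L: "0 \<le> L" using lip[of 1 0] by simp
  have Q: "0 < Q" using aQ by simp
  have TQ: "0 < T / real Q" using T Q by simp
  have pq: "0 \<le> p" "p < q" "q \<le> T"
  proof -
    show "0 \<le> p" unfolding p_def by (rule mult_nonneg_nonneg[OF _ less_imp_le[OF TQ]]) simp
    show "p < q" unfolding p_def q_def by (rule mult_strict_right_mono[OF _ TQ]) simp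
    have "q \<le> real Q * (T / real Q)" unfolding q_def using aQ TQ by (intro mult_right_mono) auto
    then show "q \<le> T" using Q by simp
  qed
  have q: "0 < q" using pq by linarith
  show E: "E \<in> sets M"
  proof -
    have [measurable]: "segment T 0 \<in> measurable M path_space" by (rule measurable_segment[OF T])
    have [measurable]: "(\<lambda>g. jump_var h g 0 q) \<in> borel_measurable path_space"
      by (rule measurable_jump_functionals(2)[OF q h])
    have [measurable]: "(\<lambda>g. big_jumps h (2 * d) g p q) \<in> borel_measurable path_space"
      unfolding big_jumps_def using pq h by (intro measurable_emeasure_jump_sizes) auto
    show ?thesis unfolding E_def by measurable
  qed
  define l where "l n = T / real (Q * Suc n)" for n
  define B where "B n = {a * Suc n..<Suc a * Suc n}" for n
  define EV where "EV n = {\<omega> \<in> space M.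
      (\<exists>i\<in>B n. one_big_jump h (l n) (\<delta> / 2) (2 * d) (B n) (Suc a * Suc n) i (\<lambda>k. segment (l n) k \<omega>)) \<and>
      euler f (l n) x (\<lambda>k. jump_incr h (segment (l n) k \<omega>) 0 (l n)) (Q * Suc n) \<in> {\<alpha><..<\<beta>}}" for n
  have l0: "0 < l n" for n
  proof -
    have "0 < Q * Suc n" using Q by simp
    then have "0 < real (Q * Suc n)" by (simp only: of_nat_0_less_iff)
    with T show ?thesis unfolding l_def by (rule divide_pos_pos)
  qed
  have l_lim: "l \<longlonglongrightarrow> 0"
  proof -
    have "strict_mono (\<lambda>n. Q * Suc n)" using Q by (intro strict_monoI) simp
    from LIMSEQ_subseq_LIMSEQ[OF lim_const_over_n[of T] this] show ?thesis
      by (simp only: l_def[abs_def] o_def)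
  qed
  have "eventually (\<lambda>n. l n * L < 1 / 2) sequentially"
    using tendsto_mult_left_zero[OF l_lim, of L] by (intro order_tendstoD) auto
  then have fine: "eventually (\<lambda>n. l n * L \<le> 1 / 2) sequentially" by eventually_elim simp
  have bound: "emeasure M {\<omega> \<in> E. \<zeta> \<omega> \<in> {\<alpha><..<\<beta>}} \<le>
      ennreal ((\<beta> - \<alpha> + 4 * exp (T * L) * \<epsilon>) * real Q / (exp (- 2 * T * L) * T * \<kappa>))" if \<epsilon>: "0 < \<epsilon>" for \<epsilon>
  proof -
    let ?c = "exp (- 2 * T * L) * T * \<kappa>"
    let ?D = "\<lambda>n. (\<delta> / 2 / \<epsilon> + 1) / real (Suc n) + (\<beta> - \<alpha> + 4 * exp (T * L) * \<epsilon>) * real Q / ?c"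
    have EVn: "EV n \<in> sets M \<and> prob (EV n) \<le> ?D n" if "l n * L \<le> 1 / 2" for n
    proof
      note db = discrete_interval_bound[OF T h lip \<open>0 < \<kappa>\<close> \<open>0 < d\<close> gap aQ zero_less_Suc drift short
        that[unfolded l_def] \<open>0 \<le> \<delta>\<close> \<epsilon> \<open>\<alpha> \<le> \<beta>\<close>, folded l_def B_def, folded EV_def]
      show "EV n \<in> sets M" by (rule db(1))
      \<comment> \<open>The mesh \<open>l n\<close> in the denominator contributes exactly one
        factor \<open>Suc n\<close>, the number of positions, by which the estimate is divided
        afterwards.\<close>
      have "(\<beta> - \<alpha> + 2 * (2 * exp (T * L) * \<epsilon>)) / (exp (- 2 * T * L) * (l n * \<kappa>)) =
          real (Suc n) * ((\<beta> - \<alpha> + 4 * exp (T * L) * \<epsilon>) * real Q / ?c)"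
        using T Q \<open>0 < \<kappa>\<close> by (simp add: l_def divide_simps del: of_nat_Suc) (simp add: algebra_simps)
      then have "real (Suc n) * prob (EV n) \<le> \<delta> / 2 / \<epsilon> + 1 +
          real (Suc n) * ((\<beta> - \<alpha> + 4 * exp (T * L) * \<epsilon>) * real Q / ?c)"
        using db(2) by simp
      also have "\<dots> = real (Suc n) * ?D n" by (simp add: field_simps del: of_nat_Suc)
      finally show "prob (EV n) \<le> ?D n" by (rule mult_left_le_imp_le) simp
    qed
    have "(\<lambda>n. (\<delta> / 2 / \<epsilon> + 1) / real (Suc n)) \<longlonglongrightarrow> 0" using LIMSEQ_Suc[OF lim_const_over_n] by simp
    from tendsto_add[OF this tendsto_const]
    have D_lim: "(\<lambda>n. ennreal (?D n)) \<longlonglongrightarrow> ennreal ((\<beta> - \<alpha> + 4 * exp (T * L) * \<epsilon>) * real Q / ?c)"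
      by (intro tendsto_ennrealI) simp
    \<comment> \<open>The discrete bound is available only on sufficiently fine grids; emptying the
      event on the coarse ones does not affect the lower limit.\<close>
    define EV' where "EV' n = (if l n * L \<le> 1 / 2 then EV n else {})" for n
    have EV': "EV' n \<in> sets M" for n using EVn by (simp add: EV'_def)
    have "AE \<omega> in M. indicator {\<omega> \<in> E. \<zeta> \<omega> \<in> {\<alpha><..<\<beta>}} \<omega> \<le> liminf (\<lambda>n. indicator (EV' n) \<omega> :: ennreal)"
      using fv conv AE_space
    proof eventually_elim
      case (elim \<omega>)
      let ?g = "segment T 0 \<omega>"
      interpret finite_variation_jumps h ?g T by (rule elim(1))
      show ?case
      proof (cases "\<omega> \<in> E \<and> \<zeta> \<omega> \<in> {\<alpha><..<\<beta>}")
        case False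
        then show ?thesis by simp
      next
        case True
        let ?J = "\<lambda>r. path_jump ?g r \<noteq> 0 \<and> path_jump ?g r \<in> {y. 2 * d < \<bar>h y\<bar>}"
        have hd: "{y. 2 * d < \<bar>h y\<bar>} \<in> sets borel" by measurable
        have big: "big_jumps h (2 * d) ?g s t = emeasure (count_space UNIV) {r \<in> {s<..t}. ?J r}" for s t
          unfolding big_jumps_def by (rule emeasure_jump_sizes[OF hd])
        have one: "emeasure (count_space UNIV) {r \<in> {p<..q}. ?J r} = 1" using True by (simp add: E_def big)
        then have "card {r \<in> {p<..q}. ?J r} = 1" by (auto simp: emeasure_count_space split: if_splits)
        then obtain \<tau> where \<tau>: "{r \<in> {p<..q}. ?J r} = {\<tau>}" by (auto simp: card_1_singleton_iff)
        then have \<tau>pq: "p < \<tau>" "\<tau> \<le> q" "?J \<tau>" by auto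
        then have \<tau>T: "\<tau> \<in> {0<..T}" using pq by auto
        have "\<exists>i. i < Q * Suc n \<and> \<tau> \<in> {real i * l n<..real (Suc i) * l n}" for n
        proof -
          have "0 < Q * Suc n" using Q by simp
          from grid_cell_exists[OF \<tau>T this] show ?thesis by (auto simp: grid_cell_def l_def)
        qed
        then obtain \<iota> where \<iota>: "\<And>n. \<iota> n < Q * Suc n" "\<And>n. \<tau> \<in> {real (\<iota> n) * l n<..real (Suc (\<iota> n)) * l n}"
          by metis
        have ml: "real (Q * Suc n) * l n = T" for n using Q by (simp add: l_def del: of_nat_Suc of_nat_mult)
        have cellT: "real (Suc k) * l n \<le> T" if "k < Q * Suc n" for k n
        proof -
          have "real (Suc k) \<le> real (Q * Suc n)" using Suc_leI[OF that] by (simp only: of_nat_le_iff)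
          from mult_right_mono[OF this less_imp_le[OF l0[of n]]] show ?thesis by (simp only: ml)
        qed
        have pl: "p = real (a * Suc n) * l n" and ql: "q = real (Suc a * Suc n) * l n" for n
        proof -
          have "T / real Q = real (Suc n) * l n" by (simp add: l_def del: of_nat_Suc mult_Suc_right)
          then show "p = real (a * Suc n) * l n" "q = real (Suc a * Suc n) * l n"
            unfolding p_def q_def by (simp_all only: of_nat_mult mult.assoc)
        qed
        let ?cell = "\<lambda>n k. {real k * l n<..real (Suc k) * l n}"
        let ?incr = "\<lambda>n k. jump_incr h ?g (real k * l n) (real (Suc k) * l n)"
        \<comment> \<open>The cells containing \<open>\<tau>\<close> shrink to it, so their
          increments tend to the value of \<open>h\<close> at this jump. That value exceeds
          \<open>2 * d\<close> strictly in modulus, hence so do the increments for large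
          \<open>n\<close>.\<close>
        have jl: "(\<lambda>n. ?incr n (\<iota> n)) \<longlonglongrightarrow> h (path_jump ?g \<tau>)"
        proof (rule jump_incr_shrink)
          show "0 \<le> real (\<iota> n) * l n" for n using l0[of n] by simp
          show "real (Suc (\<iota> n)) * l n \<le> T" for n by (rule cellT[OF \<iota>(1)])
          show "\<tau> \<in> ?cell n (\<iota> n)" for n by (rule \<iota>(2))
          have "real (Suc (\<iota> n)) * l n - real (\<iota> n) * l n = l n" for n by (simp add: algebra_simps)
          then show "(\<lambda>n. real (Suc (\<iota> n)) * l n - real (\<iota> n) * l n) \<longlonglongrightarrow> 0" using l_lim by simp
        qed (use \<tau>pq in auto)
        have ev1: "eventually (\<lambda>n. 2 * d < \<bar>?incr n (\<iota> n)\<bar>) sequentially"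
          using tendsto_rabs[OF jl] \<tau>pq by (intro order_tendstoD) auto
        let ?b = "\<lambda>n k. jump_incr h ?g 0 (real (Suc k) * l n) - jump_incr h ?g 0 (real k * l n)"
        have "strict_mono (\<lambda>n. Q * Suc n)" using Q by (intro strict_monoI) simp
        from LIMSEQ_subseq_LIMSEQ[OF elim(2) this]
        have lim: "(\<lambda>n. euler f (l n) x (?b n) (Q * Suc n)) \<longlonglongrightarrow> \<zeta> \<omega>"
          by (simp only: o_def l_def)
        have "eventually (\<lambda>n. euler f (l n) x (?b n) (Q * Suc n) \<in> {\<alpha><..<\<beta>}) sequentially"
          using topological_tendstoD[OF lim open_greaterThanLessThan] True by blast
        with ev1 fine have "eventually (\<lambda>n. \<omega> \<in> EV' n) sequentially"
        proof eventually_elim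
          case (elim n)
          have seg: "jump_sizes (segment (l n) k \<omega>) 0 (l n) = jump_sizes ?g (real k * l n) (real (Suc k) * l n)"
            if "k < Q * Suc n" for k
            by (rule jump_sizes_segment_cell[OF l0 cellT[OF that]])
          have Bm: "k < Q * Suc n" if "k < Suc a * Suc n" for k
            using that aQ mult_le_mono1[of "Suc a" Q "Suc n"] by linarith
          have B: "k < Suc a * Suc n" if "k \<in> B n" for k using that by (simp add: B_def)
          have cellpq: "?cell n k \<subseteq> {p<..q}" if "k \<in> B n" for k
          proof -
            have "a * Suc n \<le> k" "Suc k \<le> Suc a * Suc n"
              using that unfolding B_def by (simp_all only: atLeastLessThan_iff Suc_le_eq)
            then have *: "real (a * Suc n) \<le> real k" "real (Suc k) \<le> real (Suc a * Suc n)"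
              by (simp_all only: of_nat_le_iff)
            have "real (a * Suc n) * l n \<le> real k * l n"
              by (rule mult_right_mono[OF *(1) less_imp_le[OF l0]])
            moreover have "real (Suc k) * l n \<le> real (Suc a * Suc n) * l n"
              by (rule mult_right_mono[OF *(2) less_imp_le[OF l0]])
            ultimately show ?thesis unfolding pl[of n] ql[of n] Ioc_subset_iff by blast
          qed
          have i: "\<iota> n \<in> B n"
          proof -
            have "real (\<iota> n) * l n < real (Suc a * Suc n) * l n"
              using \<iota>(2)[of n] \<tau>pq(2) ql[of n] by (auto simp del: of_nat_mult mult_Suc mult_Suc_right)
            then have "real (\<iota> n) < real (Suc a * Suc n)" using l0[of n] by (simp only: mult_less_cancel_right_pos)
            moreover have "real (a * Suc n) * l n < real (Suc (\<iota> n)) * l n"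
              using \<iota>(2)[of n] \<tau>pq(1) pl[of n] by (auto simp del: of_nat_mult mult_Suc_right of_nat_Suc)
            then have "real (a * Suc n) < real (Suc (\<iota> n))" using l0[of n] by (simp only: mult_less_cancel_right_pos)
            ultimately show ?thesis unfolding of_nat_less_iff by (simp add: B_def)
          qed
          have bigk: "big_jumps h (2 * d) (segment (l n) k \<omega>) 0 (l n) =
              emeasure (count_space UNIV) {r \<in> ?cell n k. ?J r}" if "k \<in> B n" for k
            using seg[OF Bm[OF B[OF that]]] big by (simp only: big_jumps_def)
          have set_k: "{r \<in> ?cell n k. ?J r} =
              {\<tau>} \<inter> ?cell n k" if "k \<in> B n" for k
            using cellpq[OF that] \<tau> by blast
          have "one_big_jump h (l n) (\<delta> / 2) (2 * d) (B n) (Suc a * Suc n) (\<iota> n) (\<lambda>k. segment (l n) k \<omega>)"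
            unfolding one_big_jump_def
          proof (intro conjI ballI)
            have "(\<Sum>k<Suc a * Suc n. jump_var h (segment (l n) k \<omega>) 0 (l n)) =
                (\<Sum>k<Suc a * Suc n. jump_var h ?g (real k * l n) (real (Suc k) * l n))"
            proof (intro sum.cong refl)
              fix k assume "k \<in> {..<Suc a * Suc n}"
              then have "k < Q * Suc n" using Bm by blast
              from seg[OF this] show "jump_var h (segment (l n) k \<omega>) 0 (l n) =
                  jump_var h ?g (real k * l n) (real (Suc k) * l n)"
                by (simp only: jump_var_def jump_pos_def)
            qed
            also have "\<dots> = jump_var h ?g 0 (real (Suc a * Suc n) * l n)"
              using l0[of n] pq(3) by (intro jump_var_grid) (auto simp only: ql[of n] less_imp_le)
            also have "\<dots> \<le> \<delta> / 2" using True unfolding ql[of n, symmetric] by (simp add: E_def)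
            finally show "(\<Sum>k<Suc a * Suc n. jump_var h (segment (l n) k \<omega>) 0 (l n)) \<le> \<delta> / 2" .
            have "jump_incr h (segment (l n) (\<iota> n) \<omega>) 0 (l n) =
                ?incr n (\<iota> n)"
              using seg[OF \<iota>(1)] by (simp only: jump_incr_def jump_pos_def)
            then show "2 * d \<le> \<bar>jump_incr h (segment (l n) (\<iota> n) \<omega>) 0 (l n)\<bar>" using elim(1) by simp
            show "big_jumps h (2 * d) (segment (l n) (\<iota> n) \<omega>) 0 (l n) = 1"
              unfolding bigk[OF i] set_k[OF i] using \<iota>(2)[of n] by (simp add: Int_absorb2)
            fix k assume k: "k \<in> B n - {\<iota> n}"
            have "\<tau> \<notin> ?cell n k"
            proof
              assume "\<tau> \<in> ?cell n k"
              then have "k = \<iota> n"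
                using \<iota>(2)[of n] Q T by (intro grid_cell_inj[of \<tau> 0 T "Q * Suc n"]) (auto simp: grid_cell_def l_def)
              then show False using k by simp
            qed
            then have "{\<tau>} \<inter> ?cell n k = {}" by blast
            moreover have kB: "k \<in> B n" using k by simp
            ultimately show "big_jumps h (2 * d) (segment (l n) k \<omega>) 0 (l n) = 0"
              unfolding bigk[OF kB] set_k[OF kB] by simp
          qed
          moreover have "euler f (l n) x (\<lambda>k. jump_incr h (segment (l n) k \<omega>) 0 (l n)) (Q * Suc n) =
              euler f (l n) x (?b n) (Q * Suc n)"
          proof (rule euler_cong)
            fix k assume k: "k < Q * Suc n"
            have "jump_incr h (segment (l n) k \<omega>) 0 (l n) = ?incr n k"
              using seg[OF k] by (simp only: jump_incr_def jump_pos_def)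
            moreover have "jump_incr h ?g 0 (real (Suc k) * l n) =
                jump_incr h ?g 0 (real k * l n) + ?incr n k"
              using l0[of n] by (intro jump_incr_add cellT[OF k] mult_right_mono) auto
            ultimately show "jump_incr h (segment (l n) k \<omega>) 0 (l n) = ?b n k" by simp
          qed
          ultimately have "\<omega> \<in> EV n" using i elim(3) \<open>\<omega> \<in> space M\<close> unfolding EV_def by auto
          then show ?case using elim(2) by (simp add: EV'_def)
        qed
        then have "1 \<le> liminf (\<lambda>n. indicator (EV' n) \<omega> :: ennreal)"
          by (intro Liminf_bounded) (auto elim: eventually_mono)
        then show ?thesis using True by simp
      qed
    qed
    then have "(\<integral>\<^sup>+\<omega>. indicator {\<omega> \<in> E. \<zeta> \<omega> \<in> {\<alpha><..<\<beta>}} \<omega> \<partial>M) \<le> (\<integral>\<^sup>+\<omega>. liminf (\<lambda>n. indicator (EV' n) \<omega>) \<partial>M)"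
      by (rule nn_integral_mono_AE)
    also have "\<dots> \<le> liminf (\<lambda>n. \<integral>\<^sup>+\<omega>. indicator (EV' n) \<omega> \<partial>M)"
      using EV' by (intro nn_integral_liminf) simp
    also have "\<dots> \<le> liminf (\<lambda>n. ennreal (?D n))"
    proof (rule Liminf_mono, use fine in eventually_elim)
      case (elim n)
      with EVn[OF elim] EV'[of n] show ?case
        by (simp add: EV'_def emeasure_eq_measure ennreal_leI)
    qed
    also have "\<dots> = ennreal ((\<beta> - \<alpha> + 4 * exp (T * L) * \<epsilon>) * real Q / ?c)"
      by (rule lim_imp_Liminf[OF _ D_lim]) simp
    finally have "(\<integral>\<^sup>+\<omega>. indicator {\<omega> \<in> E. \<zeta> \<omega> \<in> {\<alpha><..<\<beta>}} \<omega> \<partial>M) \<le>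
        ennreal ((\<beta> - \<alpha> + 4 * exp (T * L) * \<epsilon>) * real Q / ?c)" .
    moreover have "{\<omega> \<in> E. \<zeta> \<omega> \<in> {\<alpha><..<\<beta>}} \<in> sets M"
    proof -
      have "{\<omega> \<in> E. \<zeta> \<omega> \<in> {\<alpha><..<\<beta>}} = E \<inter> (\<zeta> -` {\<alpha><..<\<beta>} \<inter> space M)" by (auto simp: E_def)
      then show ?thesis using E \<zeta> by (simp add: measurable_sets)
    qed
    ultimately show ?thesis by simp
  qed
  \<comment> \<open>The left-hand side does not depend on \<open>\<epsilon>\<close>, which may now
    tend to 0 from the right.\<close>
  let ?u = "emeasure M {\<omega> \<in> E. \<zeta> \<omega> \<in> {\<alpha><..<\<beta>}}"
  let ?w = "\<lambda>\<epsilon>. ennreal ((\<beta> - \<alpha> + 4 * exp (T * L) * \<epsilon>) * real Q / (exp (- 2 * T * L) * T * \<kappa>))"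
  have "eventually (\<lambda>\<epsilon>. ?u \<le> ?w \<epsilon>) (at_right 0)"
    using bound by (auto simp: eventually_at_right_field intro!: exI[of _ 1])
  moreover have "(?w \<longlongrightarrow> ?w 0) (at_right 0)"
    using T \<open>0 < \<kappa>\<close> by (intro tendsto_intros) auto
  ultimately have "?u \<le> ?w 0" by (intro tendsto_lowerbound) auto
  then show "?u \<le> ennreal (real Q / (exp (- 2 * T * L) * T * \<kappa>) * (\<beta> - \<alpha>))" by (simp add: mult.commute)
qed

end

section \<open>Absolute continuity of the law of the solution\<close>

theorem theorem5p5:
  fixes M :: "'a measure"
    and X Z :: "real \<Rightarrow> 'a \<Rightarrow> real"
    and \<nu> :: "real measure"
    and f h :: "real \<Rightarrow> real"
    and x T :: real
  assumes "0 < T"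
    and "complete_measure M"
    and "levy_process M X"
    and "is_levy_measure M X \<nu>"
    and "emeasure \<nu> (- {0}) = \<infinity>"
    and "\<forall>y. f differentiable (at y)"
    and "bounded (range (deriv f))"
    and "\<exists>U. open U \<and> x \<in> U \<and> (strict_mono_on U f \<or> strict_antimono_on U f)"
    and "integrable \<nu> h"
    and "integrable \<nu> (\<lambda>y. (h y)\<^sup>2)"
    and "\<forall>y. y \<noteq> 0 \<longrightarrow> h y \<noteq> 0"
    and "solves_sde M X f h x T Z"
  shows "absolutely_continuous lborel (distr M lborel (Z T))"
proof -
  interpret levy_process M X by fact
  obtain L where L: "\<And>y. \<bar>deriv f y\<bar> \<le> L" using assms(7) unfolding bounded_iff by auto
  have deriv: "(f has_field_derivative deriv f y) (at y)" for y
    using assms(6) by (simp add: DERIV_deriv_iff_real_differentiable)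
  have lip: "\<bar>f u - f v\<bar> \<le> L * \<bar>u - v\<bar>" for u v
    using field_differentiable_bound[of UNIV f "deriv f" L u v] deriv L by simp
  have L0: "0 \<le> L" using lip[of 1 0] by simp
  have cont: "continuous_on S f" for S
    using deriv by (meson DERIV_isCont continuous_at_imp_continuous_on)
  obtain U where U: "open U" "x \<in> U" "strict_mono_on U f \<or> strict_antimono_on U f" using assms(8) by blast
  obtain \<delta> where \<delta>: "0 < \<delta>" "cball x \<delta> \<subseteq> U" using U by (auto simp: open_contains_cball)
  have sub: "{x - \<delta>..x + \<delta>} \<subseteq> U" using \<delta>(2) by (simp add: cball_eq_atLeastAtMost)
  have mono: "strict_mono_on {x - \<delta>..x + \<delta>} f \<or> strict_antimono_on {x - \<delta>..x + \<delta>} f"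
    using U(3) sub by (meson monotone_on_subset)
  \<comment> \<open>\<open>h\<close> is known to be measurable only on the nonzero reals, where
    \<open>\<nu>\<close> lives, whereas the jump functionals integrate a Borel function on the whole
    line. Jumps of size 0 are not counted, so the value at 0 is immaterial.\<close>
  define H where "H y = indicator (- {0}) y *\<^sub>R h y" for y :: real
  have H: "H \<in> borel_measurable borel"
  proof -
    have "sets \<nu> = sets (restrict_space borel (- {0}))" using assms(4) by (simp add: is_levy_measure_def)
    then have "h \<in> borel_measurable (restrict_space borel (- {0}))"
      using borel_measurable_integrable[OF assms(9)] by (simp cong: measurable_cong_sets)
    then show ?thesis unfolding H_def[abs_def] by (subst (asm) borel_measurable_restrict_space_iff) auto
  qed
  have Hh: "H y = h y" "H y \<noteq> 0" if "y \<noteq> 0" for y using that assms(11) by (auto simp: H_def)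
  have ZT: "Z T \<in> borel_measurable M" using assms(1,12) by (simp add: solves_sde_def)
  have sde: "AE \<omega> in M. \<forall>t\<in>{0..T}. set_integrable lborel {0..t} (\<lambda>s. f (Z s \<omega>)) \<and>
        set_integrable (jump_measure X \<omega>) ({0..t} \<times> (- {0})) (\<lambda>(s, y). h y) \<and>
        Z t \<omega> = x + (LINT s:{0..t}|lborel. f (Z s \<omega>)) + (LINT (s, y):{0..t} \<times> (- {0})|jump_measure X \<omega>. h y)"
    using assms(12) by (simp add: solves_sde_def)
  have fv: "AE \<omega> in M. finite_variation_jumps H (segment T 0 \<omega>) T"
    using sde AE_cadlag_event
  proof eventually_elim
    case (elim \<omega>)
    then have "set_integrable (jump_measure X \<omega>) ({0..T} \<times> (- {0})) (\<lambda>(s, y). h y)" using assms(1) by simp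
    from jump_measure_integral(1,2)[OF elim(2) assms(1) _ _ H Hh(1) this] assms(1) H
    show ?case by unfold_locales auto
  qed
  have conv: "AE \<omega> in M. (\<lambda>m. euler f (T / real m) x
      (\<lambda>k. jump_incr H (segment T 0 \<omega>) 0 (real (Suc k) * (T / real m)) -
        jump_incr H (segment T 0 \<omega>) 0 (real k * (T / real m))) m) \<longlonglongrightarrow> Z T \<omega>"
    using sde AE_cadlag_event fv
  proof eventually_elim
    case (elim \<omega>)
    interpret finite_variation_jumps H "segment T 0 \<omega>" T by (rule elim(3))
    show ?case
    proof (rule euler_tendsto_solution[OF assms(1) lip, where z = "\<lambda>t. Z t \<omega>" and V = "jump_var H (segment T 0 \<omega>) 0"])
      show "set_integrable lborel {0..T} (\<lambda>s. f (Z s \<omega>))" using elim(1) assms(1) by simp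
      fix t assume t: "t \<in> {0..T}"
      with elim(1) have t': "set_integrable (jump_measure X \<omega>) ({0..t} \<times> (- {0})) (\<lambda>(s, y). h y)"
        "Z t \<omega> = x + (LINT s:{0..t}|lborel. f (Z s \<omega>)) + (LINT (s, y):{0..t} \<times> (- {0})|jump_measure X \<omega>. h y)"
        by blast+
      from jump_measure_integral(3)[OF elim(2) assms(1) _ _ H Hh(1) t'(1)] t t'(2)
      show "Z t \<omega> = x + (LINT s:{0..t}|lborel. f (Z s \<omega>)) + jump_incr H (segment T 0 \<omega>) 0 t" by simp
    next
      fix s t :: real assume "0 \<le> s" "s \<le> t" "t \<le> T"
      then show "\<bar>jump_incr H (segment T 0 \<omega>) 0 t - jump_incr H (segment T 0 \<omega>) 0 s\<bar> \<le>
          jump_var H (segment T 0 \<omega>) 0 t - jump_var H (segment T 0 \<omega>) 0 s"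
        using jump_incr_add[of 0 s t] jump_var_add[of 0 s t] abs_jump_incr_le[of H "segment T 0 \<omega>" s t] by simp
    qed (rule jump_empty)
  qed
  \<comment> \<open>An interval ending no later than \<open>b\<close> meets the conditions
    \<open>drift\<close> and \<open>short\<close> of \<open>interval_bound\<close>; the summands 1
    keep the denominators positive.\<close>
  define b where "b = min (\<delta> / 2 / (\<bar>f x\<bar> + L * \<delta> + 1)) (1 / 2 / (L + 1))"
  have b0: "0 < b" using \<delta>(1) L0 by (auto simp: b_def intro!: divide_pos_pos add_nonneg_pos)
  have b1: "q * (\<bar>f x\<bar> + L * \<delta>) \<le> \<delta> / 2" "q * L \<le> 1 / 2" if "0 \<le> q" "q \<le> b" for q
  proof -
    have *: "0 < \<bar>f x\<bar> + L * \<delta> + 1" "0 < L + 1" using \<delta>(1) L0 by (auto intro!: add_nonneg_pos)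
    have q: "q \<le> \<delta> / 2 / (\<bar>f x\<bar> + L * \<delta> + 1)" "q \<le> 1 / 2 / (L + 1)"
      using that(2) unfolding b_def by linarith+
    have "q * (\<bar>f x\<bar> + L * \<delta>) \<le> q * (\<bar>f x\<bar> + L * \<delta> + 1)" using that by (intro mult_left_mono) auto
    also have "\<dots> \<le> \<delta> / 2" using q(1) *(1) by (simp only: pos_le_divide_eq)
    finally show "q * (\<bar>f x\<bar> + L * \<delta>) \<le> \<delta> / 2" .
    have "q * L \<le> q * (L + 1)" using that by (intro mult_left_mono) auto
    also have "\<dots> \<le> 1 / 2" using q(2) *(2) by (simp only: pos_le_divide_eq)
    finally show "q * L \<le> 1 / 2" .
  qed
  define E where "E n Q a = {\<omega> \<in> space M. jump_var H (segment T 0 \<omega>) 0 (real (Suc a) * (T / real Q)) \<le> \<delta> / 2 \<and>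
      big_jumps H (2 * inverse (real (Suc n))) (segment T 0 \<omega>) (real a * (T / real Q)) (real (Suc a) * (T / real Q)) = 1}"
    for n Q a :: nat
  have cover: "AE \<omega> in M. \<exists>n Q a. a < Q \<and> real (Suc a) * (T / real Q) \<le> b \<and> \<omega> \<in> E n Q a"
    using fv jumps_accumulate_at_zero[OF assms(4,5)] AE_space
  proof eventually_elim
    case (elim \<omega>)
    interpret finite_variation_jumps H "segment T 0 \<omega>" T by (rule elim(1))
    have acc: "\<exists>r\<in>{0<..e}. path_jump (segment T 0 \<omega>) r \<noteq> 0" if "0 < e" for e
    proof -
      have "0 < min e T" using that assms(1) by simp
      then obtain r where "r \<in> {0<..min e T}" "path_jump (\<lambda>t. version t \<omega>) r \<noteq> 0" using elim(2) by blast
      then show ?thesis using path_jump_segment[of r T 0 \<omega>] by (intro bexI[of _ r]) auto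
    qed
    have "0 < \<delta> / 2" using \<delta>(1) by simp
    from exists_isolated_big_jump[OF assms(1) b0 this Hh(2) acc] elim(3) show ?case
      unfolding E_def by blast
  qed
  show ?thesis unfolding absolutely_continuous_def
  proof
    fix A assume A: "A \<in> null_sets (lborel :: real measure)"
    then have A_borel: "A \<in> sets borel" by (simp add: null_sets_def)
    \<comment> \<open>Each event is treated with its own gap \<open>\<kappa>\<close>, which depends
      on the threshold, and its own density bound \<open>C\<close>. No uniformity is required, as
      only countably many null sets are united.\<close>
    have "AE \<omega> in M. \<omega> \<in> E n Q a \<longrightarrow> Z T \<omega> \<notin> A" if aQ: "a < Q" and qb: "real (Suc a) * (T / real Q) \<le> b" for n Q a
    proof -
      have "0 < inverse (real (Suc n))" by simp
      from strict_mono_gap[OF cont mono this] obtain \<kappa>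
        where \<kappa>: "0 < \<kappa>" "monotone_gap f {x-\<delta>..x+\<delta>} (inverse (real (Suc n))) \<kappa>" .
      have q0: "0 \<le> real (Suc a) * (T / real Q)" using assms(1) by simp
      note ib = interval_bound[OF assms(1) H lip \<kappa>(1) \<open>0 < inverse (real (Suc n))\<close> \<kappa>(2) aQ b1[OF q0 qb]
        less_imp_le[OF \<delta>(1)] fv ZT conv, folded E_def]
      define C where "C = real Q / (exp (- 2 * T * L) * T * \<kappa>)"
      have C: "0 \<le> C" using assms(1) \<kappa>(1) by (simp add: C_def)
      have E: "E n Q a \<in> sets M" by (rule ib(1)[of 0 0]) simp
      define \<mu> where "\<mu> = distr (density M (indicator (E n Q a))) borel (Z T)"
      have \<mu>: "emeasure \<mu> D = emeasure M {\<omega> \<in> E n Q a. Z T \<omega> \<in> D}" if "D \<in> sets borel" for D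
      proof -
        have ZD: "Z T -` D \<inter> space M \<in> sets M" using ZT that by (rule measurable_sets)
        have "emeasure \<mu> D = emeasure (density M (indicator (E n Q a))) (Z T -` D \<inter> space M)"
          unfolding \<mu>_def using ZT that by (subst emeasure_distr) auto
        also have "\<dots> = emeasure M (E n Q a \<inter> (Z T -` D \<inter> space M))" using E ZD by (rule emeasure_restricted)
        also have "E n Q a \<inter> (Z T -` D \<inter> space M) = {\<omega> \<in> E n Q a. Z T \<omega> \<in> D}" by (auto simp: E_def)
        finally show ?thesis .
      qed
      have "emeasure \<mu> A = 0"
      proof (rule emeasure_null_of_interval_bound[OF _ C _ A])
        show "sets \<mu> = sets borel" by (simp add: \<mu>_def)
        fix \<alpha> \<beta> :: real assume "\<alpha> \<le> \<beta>"
        from ib(2)[OF this] show "emeasure \<mu> {\<alpha><..<\<beta>} \<le> ennreal (C * (\<beta> - \<alpha>))" by (simp add: \<mu> C_def)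
      qed
      then have "emeasure M {\<omega> \<in> E n Q a. Z T \<omega> \<in> A} = 0" using \<mu> A_borel by simp
      moreover have "{\<omega> \<in> E n Q a. Z T \<omega> \<in> A} \<in> sets M"
      proof -
        have "{\<omega> \<in> E n Q a. Z T \<omega> \<in> A} = E n Q a \<inter> (Z T -` A \<inter> space M)" by (auto simp: E_def)
        then show ?thesis using E measurable_sets[OF ZT A_borel] by simp
      qed
      ultimately show ?thesis by (intro AE_I[of _ _ "{\<omega> \<in> E n Q a. Z T \<omega> \<in> A}"]) auto
    qed
    then have "AE \<omega> in M. \<forall>n Q a. a < Q \<and> real (Suc a) * (T / real Q) \<le> b \<longrightarrow> \<omega> \<in> E n Q a \<longrightarrow> Z T \<omega> \<notin> A"
      by (simp only: AE_all_countable) auto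
    with cover have "AE \<omega> in M. Z T \<omega> \<notin> A" by eventually_elim blast
    then have "emeasure M (Z T -` A \<inter> space M) = 0"
      using measurable_sets[OF ZT A_borel] by (subst (asm) AE_iff_measurable) (auto simp: vimage_def Int_def conj_commute)
    then show "A \<in> null_sets (distr M lborel (Z T))"
      using A ZT by (intro null_setsI) (auto simp: emeasure_distr null_sets_def)
  qed
qed

end
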